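(* The following four identities hold. (1) $$\mathrm{m}\left((1+z)(1+y)+(1-z)(x-y)\right)=\frac{7}{2\pi^2}\zeta(3)+\frac{\log(2)}{2}.$$ (2) $$\mathrm{m}\left(4(1+y)+(1-y)(x-x^{-1})(z-z^{-1})\right)=\frac{14}{\pi^2}\zeta(3).$$ (3) $$\mathrm{m}\left((1+x)(y-y^{-1})+(1-x)(z-z^{-1})\right)=\frac{7}{\pi^2}\zeta(3).$$ (4) $$\mathrm{m}\left(16(1+y)^2-4(z+z^{-1})^2+(1+y)^2(z-z^{-1})^2(x+x^{-1})^2\right)=\frac{14}{\pi^2}\zeta(3)+\frac4\pi G.$$
   Context: For a nonzero Laurent polynomial $P$ in $n$ variables, its (logarithmic) Mahler measure is $\mathrm{m}(P)=\int_0^1\cdots\int_0^1\log|P(e^{2\pi i\theta_1},\dots,e^{2\pi i\theta_n})|\,d\theta_1\cdots d\theta_n$. Here $\zeta$ is the Riemann zeta function and $G=\sum_{n=0}^\infty\frac{(-1)^n}{(2n+1)^2}$ is Catalan's constant. *)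

theory Defs
  imports "HOL-Analysis.Analysis" "HOL-Library.Poly_Mapping"
begin

text \<open>
  A Laurent polynomial in finitely many variables indexed by \<open>'n\<close> is a finitely supported map from
  exponent vectors in \<open>\<int>\<^sup>n\<close> to coefficients. Its ring structure (convolution product)
  is the one of \<^theory>\<open>HOL-Library.Poly_Mapping\<close>.
\<close>

type_synonym ('n, 'a) laurent_poly = "(int ^ 'n) \<Rightarrow>\<^sub>0 'a"

definition laurent_var :: "'n::finite \<Rightarrow> ('n, 'a::zero_neq_one) laurent_poly" where
  "laurent_var i = Poly_Mapping.single (axis i 1) 1"

definition laurent_var_inverse :: "'n::finite \<Rightarrow> ('n, 'a::zero_neq_one) laurent_poly" where
  "laurent_var_inverse i = Poly_Mapping.single (axis i (- 1)) 1"

definition laurent_eval :: "('n::finite, 'a::field) laurent_poly \<Rightarrow> 'a ^ 'n \<Rightarrow> 'a" where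
  "laurent_eval P w =
     (\<Sum>e\<in>Poly_Mapping.keys P. Poly_Mapping.lookup P e * (\<Prod>i\<in>UNIV. (w $ i) powi (e $ i)))"

text \<open>
  \<^term>\<open>cbox 0 1 :: (real ^ 'n) set\<close> is the unit cube. For a nonzero Laurent polynomial the integrand is
  Lebesgue integrable, and the convention \<open>ln 0 = 0\<close> only matters on the zero set, which is a null set.
  The Bochner integral of a non-integrable function is 0, so a nonzero value of the Mahler
  measure entails integrability.
\<close>

definition mahler_measure :: "('n::finite, complex) laurent_poly \<Rightarrow> real" where
  "mahler_measure P =
     (LINT \<theta>:cbox 0 1|lborel.
        ln (cmod (laurent_eval P (\<chi> i. exp (2 * of_real pi * \<i> * of_real (\<theta> $ i))))))"

text \<open>The Riemann zeta function on its half-line of convergence \<open>s > 1\<close>.\<close>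

definition zeta :: "real \<Rightarrow> real" where
  "zeta s = suminf (\<lambda>n. 1 / real (Suc n) powr s)"

definition catalan_const :: real where
  "catalan_const = suminf (\<lambda>n. (- 1) ^ n / (2 * real n + 1)\<^sup>2)"

end

theory Submission
  imports Defs "HOL-Real_Asymp.Real_Asymp" "HOL-Complex_Analysis.Cauchy_Integral_Formula"
begin

text \<open>
  Jensen's formula in one suitable variable (twice for the fourth polynomial, which splits into two
  linear factors in \<open>y\<close>) reduces the four measures to the means over the unit square of
  \<open>ln (1 + |sin u sin v|)\<close>, \<open>ln (|sin u| + |sin v|)\<close> and \<open>ln (1 + |cos v|)\<close>. For the fourth polynomial
  the mean of \<open>ln (A + |cos v|)\<close> with \<open>A\<^sup>2 = cos\<^sup>2 v + sin\<^sup>2 v sin\<^sup>2 u\<close> also occurs; it equals the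
  first of these means, as both arise from the triple mean of
  \<open>ln (cos\<^sup>2 v + sin\<^sup>2 v sin\<^sup>2 u cos\<^sup>2 t)\<close> by integrating first over \<open>t\<close> or first over \<open>v\<close>.

  The first two double means are computed by differentiating in \<open>v\<close> and integrating by parts, which
  leads in both cases to the integral of \<open>(pi/2 - v) ln (cot (v/2))\<close> over \<open>[0, pi/2]\<close>. The expansion of
  \<open>ln |1 + e\<^sup>i\<^sup>t|\<close> into cosines shows that this integral is \<open>2 (1 + 1/3\<^sup>3 + 1/5\<^sup>3 + ...)\<close>.
\<close>

section \<open>Fourier expansion of the logarithm of |1 + exp(it)|\<close>

text \<open>The logarithms that occur are bounded above and unbounded only towards minus infinity.
  This shapes the measure theory: given an upper bound, an iterated integral already yields
  integrability on a product, and a gauge integral over \<open>{0..1}\<close> already yields a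
  Bochner integral. Jensen's formula is proved for \<open>p + q u\<close> with coefficients of
  different modulus, so that no zero lies on the circle; parameters violating this have a coordinate
  in the finite set \<open>zeros_sin_cos\<close>, hence form a null set. The double means are
  computed on [0, pi/2], where sine and cosine are nonnegative, and carried to absolute values of
  sin (2 pi t) and cos (2 pi t) on [0, 1] by folding with the tent map, which preserves the uniform
  measure. At radius 1 the logarithmic series does not converge uniformly near t = pi, so termwise
  integration is done at radius r < 1 and r -> 1 is taken on both sides.\<close>

lemma sin_ge_half:
  fixes x :: real
  assumes "0 \<le> x" "x \<le> pi / 2"
  shows "x / 2 \<le> sin x"
proof -
  have "\<bar>sin x - (\<Sum>m<3. sin_coeff m * x ^ m)\<bar> \<le> inverse (fact 3) * \<bar>x\<bar> ^ 3"
    by (rule Maclaurin_sin_bound)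
  also have "(\<Sum>m<3. sin_coeff m * x ^ m) = x"
    by (simp add: sin_coeff_def numeral_3_eq_3)
  also have "inverse (fact 3) * \<bar>x\<bar> ^ 3 = x ^ 3 / 6"
    using assms by (simp add: fact_numeral)
  finally have "x - sin x \<le> x ^ 3 / 6"
    by linarith
  \<comment> \<open>This makes the cubic error \<open>x ^ 3 / 6\<close> at most
    \<open>x / 2\<close>. It rests on pi/2 < 1.7 and 1.7^2 = 2.89.\<close>
  also have "x ^ 3 \<le> 3 * x"
  proof -
    have "x \<le> 17 / 10"
      using assms(2) pi_approx by simp
    then have "x * x \<le> 17/10 * (17/10)"
      using assms by (intro mult_mono) auto
    then have "x * x \<le> 3"
      by simp
    then have "x * (x * x) \<le> x * 3"
      using assms by (intro mult_left_mono) auto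
    then show ?thesis
      by (simp add: power3_eq_cube mult_ac)
  qed
  finally show ?thesis
    by simp
qed

text \<open>Rotation by \<open>cis (- t)\<close> turns the number into \<open>cis (- t) + r\<close>.
  In this form the imaginary part does not depend on \<open>r\<close>, which gives lower bounds
  uniform in \<open>r\<close>.\<close>

lemma cmod_one_plus_cis_squared:
  "(cmod (1 + of_real r * cis t))\<^sup>2 = (r + cos t)\<^sup>2 + (sin t)\<^sup>2"
proof -
  have "(r * sin t)\<^sup>2 = r\<^sup>2 * (1 - (cos t)\<^sup>2)"
    by (simp add: power_mult_distrib sin_squared_eq)
  then show ?thesis
    by (simp add: cmod_power2 sin_squared_eq) (simp add: power2_eq_square algebra_simps)
qed

text \<open>The only zero on the closed half disc is at r = 1, t = pi, and the modulus is bounded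
  below linearly in the distance of \<open>t\<close> from pi, uniformly in \<open>r\<close>. Up to
  pi/2 the real part suffices, beyond it the imaginary part \<open>sin t\<close> of the rotated
  number.\<close>

lemma cmod_one_plus_cis_ge:
  assumes "0 \<le> r" "0 \<le> t" "t \<le> pi"
  shows "(pi - t) / 4 \<le> cmod (1 + of_real r * cis t)"
proof (cases "t \<le> pi / 2")
  case True
  have "1 \<le> Re (1 + of_real r * cis t)"
    using assms True by (simp add: cos_ge_zero)
  also have "\<dots> \<le> cmod (1 + of_real r * cis t)"
    by (rule complex_Re_le_cmod)
  finally have "1 \<le> cmod (1 + of_real r * cis t)" .
  moreover have "(pi - t) / 4 \<le> 1"
    using pi_less_4 assms by simp
  ultimately show ?thesis
    by (rule order_trans[rotated])
next
  case False
  have "(pi - t) / 2 \<le> sin (pi - t)"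
    using assms False by (intro sin_ge_half) auto
  moreover have "sin t \<le> cmod (1 + of_real r * cis t)"
    by (rule power2_le_imp_le) (simp_all add: cmod_one_plus_cis_squared)
  ultimately show ?thesis
    using assms by simp
qed

lemma cmod_one_plus_cis_le: 
  assumes "0 \<le> r" "r \<le> 1"
  shows "cmod (1 + of_real r * cis t) \<le> 2"
proof -
  have "cmod (1 + of_real r * cis t) \<le> cmod 1 + cmod (of_real r * cis t)"
    by (rule norm_triangle_ineq)
  then show ?thesis
    using assms by (simp add: norm_mult)
qed

text \<open>A dominating function independent of \<open>r\<close>, for the limit r -> 1. Upper and
  lower bound can simply be combined into one sum because \<open>ln 2\<close> is nonnegative and
  \<open>(pi - t) / 4\<close> is below 1.\<close>

lemma abs_ln_cmod_one_plus_cis_le: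
  assumes "0 \<le> r" "r \<le> 1" "0 \<le> t" "t < pi"
  shows "\<bar>ln (cmod (1 + of_real r * cis t))\<bar> \<le> ln 2 - ln ((pi - t) / 4)"
proof -
  have 1: "(pi - t) / 4 \<le> cmod (1 + of_real r * cis t)" "0 < (pi - t) / 4"
    using assms cmod_one_plus_cis_ge[of r t] by auto
  then have "ln ((pi - t) / 4) \<le> ln (cmod (1 + of_real r * cis t))"
    by (intro ln_mono) auto
  moreover have "ln (cmod (1 + of_real r * cis t)) \<le> ln 2"
    using 1 assms cmod_one_plus_cis_le[of r t] by (intro ln_mono) auto
  moreover have "ln ((pi - t) / 4) \<le> 0"
    using 1 assms pi_less_4 by (subst ln_le_zero_iff) auto
  moreover have "0 \<le> ln (2::real)"
    by simp
  ultimately show ?thesis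
    by linarith
qed

lemma integrable_ln_pi_minus: "(\<lambda>t. ln 2 - ln ((pi - t) / 4)) integrable_on {0..pi}"
proof -
  \<comment> \<open>An antiderivative on the open interval. It is continuous up to t = pi because y
    ln y tends to 0, which is also its value at 0.\<close>
  let ?F = "\<lambda>t. (ln 2 + ln 4) * t + (pi - t) * ln (pi - t) - (pi - t)"
  have "continuous_on {0..pi} ?F"
  proof -
    have *: "((\<lambda>y::real. y * ln y) \<longlongrightarrow> 0) (at_right 0)"
      by real_asymp
    have "continuous (at y within {0..}) (\<lambda>y::real. y * ln y)" if "y \<ge> 0" for y
    proof (cases "y = 0")
      case True
      have "at 0 within {0::real..} = at_right 0"
        by (auto simp: at_within_def intro!: arg_cong[where f = "\<lambda>A. inf (nhds 0) (principal A)"])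
      then show ?thesis
        using * True by (simp add: continuous_within)
    qed (use that in \<open>auto intro!: continuous_intros\<close>)
    then have "continuous_on {0..} (\<lambda>y::real. y * ln y)"
      by (simp add: continuous_on_eq_continuous_within)
    then have "continuous_on {0..pi} (\<lambda>t. (pi - t) * ln (pi - t))"
      by (rule continuous_on_compose2) (auto intro!: continuous_intros)
    then have "continuous_on {0..pi} (\<lambda>t. (ln 2 + ln 4) * t + ((pi - t) * ln (pi - t)) - (pi - t))"
      by (intro continuous_on_add continuous_on_diff) (auto intro!: continuous_intros)
    then show ?thesis .
  qed
  moreover have "(?F has_vector_derivative (ln 2 - ln ((pi - t) / 4))) (at t)"
    if "t \<in> {0<..<pi}" for t
    using that
    by (auto simp: has_real_derivative_iff_has_vector_derivative[symmetric] ln_div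
             intro!: derivative_eq_intros)
  ultimately have "((\<lambda>t. ln 2 - ln ((pi - t) / 4)) has_integral (?F pi - ?F 0)) {0..pi}"
    by (intro fundamental_theorem_of_calculus_interior) auto
  then show ?thesis
    by blast
qed

lemma Re_of_real_mult_cis: "Re (of_real x * cis t) = x * cos t"
  by simp

text \<open>Real part of the power series of Ln (1 + w) at w = r cis t. Inside the disc it converges
  uniformly in \<open>t\<close>, with majorant a multiple of \<open>r ^ k\<close>, so it may be
  integrated term by term against a continuous weight.\<close>

lemma integral_ln_cmod_one_plus_cis_sums:
  fixes \<phi> :: "real \<Rightarrow> real"
  assumes r: "0 \<le> r" "r < 1" and \<phi>: "continuous_on {a..b} \<phi>"
  defines "c \<equiv> \<lambda>k. integral {a..b} (\<lambda>t. \<phi> t * cos (real k * t))"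
  shows "(\<lambda>t. \<phi> t * ln (cmod (1 + of_real r * cis t))) integrable_on {a..b}"
    and "(\<lambda>k. - ((- r) ^ k) / real k * c k) sums
           integral {a..b} (\<lambda>t. \<phi> t * ln (cmod (1 + of_real r * cis t)))"
proof -
  \<comment> \<open>The series is indexed from 0; its term at \<open>k = 0\<close> is 0 because
    division by \<open>real 0\<close> gives 0.\<close>
  let ?f = "\<lambda>k t. \<phi> t * (- ((- r) ^ k) / real k * cos (real k * t))"
  have sums: "(\<lambda>k. ?f k t) sums (\<phi> t * ln (cmod (1 + of_real r * cis t)))" for t
  proof -
    have *: "cmod (of_real r * cis t) < 1"
      using r by (simp add: norm_mult)
    have ne: "1 + of_real r * cis t \<noteq> 0"
    proof
      assume "1 + of_real r * cis t = 0"
      then have "of_real r * cis t = - 1"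
        by (simp add: add_eq_0_iff)
      with * show False
        by simp
    qed
    have "(\<lambda>n. Re (- ((- (of_real r * cis t)) ^ n) / of_nat n)) sums Re (ln (1 + of_real r * cis t))"
      using Ln_series'[OF *] by (rule sums_Re)
    also have "Re (ln (1 + of_real r * cis t)) = ln (cmod (1 + of_real r * cis t))"
      using ne by (rule Re_Ln)
    also have "(\<lambda>n. Re (- ((- (of_real r * cis t)) ^ n) / of_nat n))
        = (\<lambda>n. - ((- r) ^ n) / real n * cos (real n * t))"
    proof
      fix n
      have "(- (of_real r * cis t)) ^ n = (of_real (- r) * cis t) ^ n"
        by simp
      also have "\<dots> = of_real ((- r) ^ n) * cis (real n * t)"
        by (simp only: power_mult_distrib Complex.DeMoivre of_real_power)
      finally have "- ((- (of_real r * cis t)) ^ n) / of_nat n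
          = of_real (- ((- r) ^ n) / real n) * cis (real n * t)"
        by (simp only: of_real_divide of_real_minus of_real_of_nat_eq) simp
      then show "Re (- ((- (of_real r * cis t)) ^ n) / of_nat n) = - ((- r) ^ n) / real n * cos (real n * t)"
        by (simp only: Re_of_real_mult_cis)
    qed
    finally show ?thesis
      by (rule sums_mult)
  qed
  have "compact (\<phi> ` {a..b})"
    by (intro compact_continuous_image \<phi>) auto
  then obtain B where B: "\<And>t. t \<in> {a..b} \<Longrightarrow> \<bar>\<phi> t\<bar> \<le> B"
    by (fastforce dest!: compact_imp_bounded simp: bounded_iff)
  have "uniform_limit {a..b} (\<lambda>n t. \<Sum>k<n. ?f k t) (\<lambda>t. suminf (\<lambda>k. ?f k t)) sequentially"
  proof (rule Weierstrass_m_test)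
    fix k t assume t: "t \<in> {a..b}"
    have "\<bar>- ((- r) ^ k) / real k * cos (real k * t)\<bar> \<le> r ^ k * 1"
      unfolding abs_mult using r
      by (intro mult_mono) (auto simp: power_abs abs_mult divide_le_eq mult_le_cancel_left1)
    then show "norm (?f k t) \<le> B * r ^ k"
      using B[OF t] r unfolding real_norm_def abs_mult[of "\<phi> t"] by (intro mult_mono) auto
  qed (use r in \<open>auto intro!: summable_mult summable_geometric\<close>)
  moreover have "(suminf (\<lambda>k. ?f k t)) = \<phi> t * ln (cmod (1 + of_real r * cis t))" for t
    using sums by (simp add: sums_iff)
  ultimately have "uniform_limit {a..b} (\<lambda>n t. \<Sum>k<n. ?f k t)
      (\<lambda>t. \<phi> t * ln (cmod (1 + of_real r * cis t))) sequentially"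
    by simp
  then have ul: "uniform_limit {a..b} (\<lambda>n t. \<Sum>k<n. ?f k t)
      (\<lambda>t. \<phi> t * ln (cmod (1 + of_real r * cis t))) sequentially" .
  have cont: "continuous_on {a..b} (\<lambda>t. \<Sum>k<n. ?f k t)" for n
  proof (intro continuous_on_sum)
    show "continuous_on {a..b} (?f k)" for k
      by (rule continuous_on_mult[OF \<phi> continuous_on_mult[OF continuous_on_const]])
         (intro continuous_intros)
  qed
  obtain I J where I: "\<And>n. ((\<lambda>t. \<Sum>k<n. ?f k t) has_integral I n) {a..b}"
    and J: "((\<lambda>t. \<phi> t * ln (cmod (1 + of_real r * cis t))) has_integral J) {a..b}"
    and IJ: "I \<longlonglongrightarrow> J"
    by (rule uniform_limit_integral[OF ul cont sequentially_bot]) (rule that)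
  have I_eq: "I = (\<lambda>n. \<Sum>k<n. - ((- r) ^ k) / real k * c k)"
  proof
    fix n
    have "(?f k has_integral (- ((- r) ^ k) / real k * c k)) {a..b}" for k
    proof -
      have "((\<lambda>t. \<phi> t * cos (real k * t)) has_integral c k) {a..b}"
        unfolding c_def by (intro integrable_integral integrable_continuous_real continuous_intros \<phi>)
      from has_integral_mult_right[OF this, of "- ((- r) ^ k) / real k"] show ?thesis
        by (simp add: mult_ac)
    qed
    then have "((\<lambda>t. \<Sum>k<n. ?f k t) has_integral (\<Sum>k<n. - ((- r) ^ k) / real k * c k)) {a..b}"
      by (intro has_integral_sum) auto
    then show "I n = (\<Sum>k<n. - ((- r) ^ k) / real k * c k)"
      using I[of n] by (rule has_integral_unique[symmetric])
  qed
  show "(\<lambda>k. - ((- r) ^ k) / real k * c k) sums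
           integral {a..b} (\<lambda>t. \<phi> t * ln (cmod (1 + of_real r * cis t)))"
    unfolding sums_def integral_unique[OF J] using IJ unfolding I_eq .
  show "(\<lambda>t. \<phi> t * ln (cmod (1 + of_real r * cis t))) integrable_on {a..b}"
    using J by blast
qed

text \<open>An Abel limit r -> 1 in the preceding expansion: dominated convergence moves the limit
  into the integral, and Tannery's theorem, with the summable majorant
  \<open>\<bar>c k\<bar> / real k\<close>, moves it into the series.\<close>

lemma has_integral_ln_cmod_one_plus_cis:
  fixes \<phi> :: "real \<Rightarrow> real"
  assumes ab: "0 \<le> a" "a \<le> b" "b \<le> pi" and \<phi>: "continuous_on {a..b} \<phi>"
  defines "c \<equiv> \<lambda>k. integral {a..b} (\<lambda>t. \<phi> t * cos (real k * t))"
  assumes c: "summable (\<lambda>k. \<bar>c k\<bar> / real k)"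
  shows "((\<lambda>t. \<phi> t * ln (cmod (1 + cis t))) has_integral suminf (\<lambda>k. - ((- 1) ^ k) / real k * c k)) {a..b}"
proof -
  define r where "r = (\<lambda>n. 1 - 1 / real (n + 2))"
  have r: "0 \<le> r n" "r n < 1" for n
    by (auto simp: r_def)
  have r1: "r \<longlonglongrightarrow> 1"
    unfolding r_def by real_asymp
  let ?f = "\<lambda>n t. \<phi> t * ln (cmod (1 + of_real (r n) * cis t))"
  let ?g = "\<lambda>t. \<phi> t * ln (cmod (1 + cis t))"
  have "compact (\<phi> ` {a..b})"
    by (intro compact_continuous_image \<phi>) auto
  then obtain B where B: "\<And>t. t \<in> {a..b} \<Longrightarrow> \<bar>\<phi> t\<bar> \<le> B"
    by (fastforce dest!: compact_imp_bounded simp: bounded_iff)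
  let ?h = "\<lambda>t. B * (ln 2 - ln ((pi - t) / 4))"
  \<comment> \<open>End points are dropped because for b = pi both the domination and the pointwise
    limit can fail at t = pi, where \<open>1 + cis t\<close> is 0.\<close>
  have f: "?f n integrable_on {a<..<b}" for n
    using integral_ln_cmod_one_plus_cis_sums(1)[OF r \<phi>] by (simp add: integrable_on_Icc_iff_Ioo)
  have h: "?h integrable_on {a<..<b}"
  proof -
    have "(\<lambda>t. ln 2 - ln ((pi - t) / 4)) integrable_on {a..b}"
      by (rule integrable_on_subinterval[OF integrable_ln_pi_minus]) (use ab in auto)
    then have "?h integrable_on {a..b}"
      by (rule integrable_on_mult_right)
    then show ?thesis
      by (simp add: integrable_on_Icc_iff_Ioo)
  qed
  have le: "norm (?f n t) \<le> ?h t" if "t \<in> {a<..<b}" for n t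
    unfolding real_norm_def abs_mult
    using that ab r[of n] B[of t]
    by (intro mult_mono abs_ln_cmod_one_plus_cis_le) auto
  have lim: "(\<lambda>n. ?f n t) \<longlonglongrightarrow> ?g t" if "t \<in> {a<..<b}" for t
  proof -
    have "(pi - t) / 4 \<le> cmod (1 + of_real 1 * cis t)"
      using that ab by (intro cmod_one_plus_cis_ge) auto
    then have "1 + cis t \<noteq> 0"
      using that ab by auto
    moreover have "(\<lambda>n. 1 + of_real (r n) * cis t) \<longlonglongrightarrow> 1 + of_real 1 * cis t"
      by (intro tendsto_intros r1)
    ultimately have "(\<lambda>n. ln (cmod (1 + of_real (r n) * cis t))) \<longlonglongrightarrow> ln (cmod (1 + cis t))"
      by (intro tendsto_ln tendsto_norm) auto
    then show ?thesis
      by (rule tendsto_mult_left)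
  qed
  have gI: "?g integrable_on {a<..<b}"
    and gl: "(\<lambda>n. integral {a<..<b} (?f n)) \<longlonglongrightarrow> integral {a<..<b} ?g"
    using dominated_convergence[OF f h le lim] by auto
  have "(\<lambda>n. integral {a<..<b} (?f n)) = (\<lambda>n. suminf (\<lambda>k. - ((- r n) ^ k) / real k * c k))"
    using integral_ln_cmod_one_plus_cis_sums(2)[OF r \<phi>]
    by (simp add: integral_open_interval_real[symmetric] sums_iff c_def)
  moreover have "(\<lambda>n. suminf (\<lambda>k. - ((- r n) ^ k) / real k * c k)) \<longlonglongrightarrow> suminf (\<lambda>k. - ((- 1) ^ k) / real k * c k)"
  proof (rule tannerys_theorem[THEN conjunct2, THEN conjunct2])
    show "(\<lambda>n. - ((- r n) ^ k) / real k * c k) \<longlonglongrightarrow> - ((- 1) ^ k) / real k * c k" for k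
      by (cases "k = 0") (auto intro!: tendsto_intros r1)
    have "norm (- ((- r n) ^ k) / real k * c k) \<le> \<bar>c k\<bar> / real k" for k n
    proof -
      have "\<bar>- ((- r n) ^ k)\<bar> * (\<bar>c k\<bar> / real k) \<le> 1 * (\<bar>c k\<bar> / real k)"
        using r[of n] by (intro mult_right_mono) (auto simp: power_abs power_le_one)
      then show ?thesis
        by (simp add: abs_mult)
    qed
    then show "\<forall>\<^sub>F (k, n) in at_top \<times>\<^sub>F sequentially.
        norm (- ((- r n) ^ k) / real k * c k) \<le> \<bar>c k\<bar> / real k"
      by (intro always_eventually allI) (simp only: case_prod_beta)
  qed (rule c, rule sequentially_bot)
  ultimately have "(\<lambda>n. integral {a<..<b} (?f n)) \<longlonglongrightarrow> suminf (\<lambda>k. - ((- 1) ^ k) / real k * c k)"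
    by simp
  with gl have "integral {a<..<b} ?g = suminf (\<lambda>k. - ((- 1) ^ k) / real k * c k)"
    by (rule LIMSEQ_unique)
  with gI have "(?g has_integral suminf (\<lambda>k. - ((- 1) ^ k) / real k * c k)) {a<..<b}"
    by (simp only: has_integral_integrable_integral simp_thms)
  then show ?thesis
    by (simp only: has_integral_Icc_iff_Ioo)
qed

section \<open>Series for zeta(3) and Catalan's constant, and the integrals of ln (1 + cos t) that
  produce them\<close>

text \<open>The shift to an index starting at 0 adds the term \<open>1 / 0 = 0\<close> and matches
  the indexing of the cosine coefficients.\<close>

lemma zeta_3_sums: "(\<lambda>k. 1 / real k ^ 3) sums zeta 3"
proof -
  have *: "1 / real (Suc n) powr 3 = 1 / real (Suc n) ^ 3" for n
    by (simp add: powr_numeral)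
  have "summable (\<lambda>n. 1 / real n ^ 3)"
    using inverse_power_summable[of 3, where ?'a = real] by (simp add: field_simps)
  then have "summable (\<lambda>n. 1 / real (Suc n) ^ 3)"
    by (subst summable_Suc_iff)
  then have "(\<lambda>n. 1 / real (Suc n) ^ 3) sums zeta 3"
    unfolding zeta_def * by (rule summable_sums)
  then show ?thesis
    by (subst (asm) sums_Suc_iff) simp
qed

text \<open>The even terms contribute 1/2^3 of the whole series, which leaves the factor
  7/8.\<close>

lemma odd_zeta_3_sums: "(\<lambda>k. if odd k then 1 / real k ^ 3 else 0) sums (7 / 8 * zeta 3)"
proof -
  have "(\<lambda>k. 1 / 8 * (1 / real k ^ 3)) sums (1 / 8 * zeta 3)"
    by (intro sums_mult zeta_3_sums)
  from sums_if[OF sums_zero this]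
  have "(\<lambda>k. if even k then 1 / 8 * (1 / real (k div 2) ^ 3) else 0) sums (1 / 8 * zeta 3)"
    by simp
  from sums_diff[OF zeta_3_sums this]
  have "(\<lambda>k. 1 / real k ^ 3 - (if even k then 1 / 8 * (1 / real (k div 2) ^ 3) else 0)) sums (7 / 8 * zeta 3)"
    by simp
  also have "(\<lambda>k. 1 / real k ^ 3 - (if even k then 1 / 8 * (1 / real (k div 2) ^ 3) else 0))
      = (\<lambda>k. if odd k then 1 / real k ^ 3 else 0)"
  proof
    fix k
    show "1 / real k ^ 3 - (if even k then 1 / 8 * (1 / real (k div 2) ^ 3) else 0)
        = (if odd k then 1 / real k ^ 3 else 0)"
      by (cases "even k") (auto elim!: evenE simp: power_mult_distrib)
  qed
  finally show ?thesis .
qed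

lemma catalan_const_sums: "(\<lambda>n. (- 1) ^ n / (2 * real n + 1)\<^sup>2) sums catalan_const"
proof -
  have "summable (\<lambda>n. (- 1) ^ n / (2 * real n + 1)\<^sup>2)"
  proof (rule summable_comparison_test)
    have "summable (\<lambda>n. 1 / real n ^ 2)"
      using inverse_power_summable[of 2, where ?'a = real] by (simp add: field_simps)
    then show "summable (\<lambda>n. 1 / real (Suc n) ^ 2)"
      by (subst summable_Suc_iff)
    have "norm ((- 1) ^ n / (2 * real n + 1)\<^sup>2) \<le> 1 / (real (Suc n))\<^sup>2" for n
      by (auto simp: norm_divide norm_power abs_mult intro!: divide_left_mono power_mono)
    then show "\<exists>N. \<forall>n\<ge>N. norm ((- 1) ^ n / (2 * real n + 1)\<^sup>2) \<le> 1 / (real (Suc n))\<^sup>2"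
      by blast
  qed
  then show ?thesis
    unfolding catalan_const_def by (rule summable_sums)
qed

text \<open>Since the squared modulus of \<open>1 + cis t\<close> is 2 (1 + cos t); this translates
  the cosine expansion into statements on \<open>ln (1 + cos t)\<close>.\<close>

lemma ln_cmod_one_plus_cis:
  assumes "0 \<le> t" "t < pi"
  shows "ln (cmod (1 + cis t)) = (ln 2 + ln (1 + cos t)) / 2"
proof -
  have "cos pi < cos t"
    using assms by (intro cos_monotone_0_pi) auto
  then have pos: "0 < 1 + cos t"
    by simp
  have "(cmod (1 + cis t))\<^sup>2 = 2 * (1 + cos t)"
    using cmod_one_plus_cis_squared[of 1 t] by (simp add: sin_squared_eq power2_eq_square algebra_simps)
  moreover have "ln (2 * (1 + cos t)) = ln 2 + ln (1 + cos t)"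
    using pos by (intro ln_mult_pos) auto
  ultimately have "ln ((cmod (1 + cis t))\<^sup>2) = ln 2 + ln (1 + cos t)"
    by simp
  moreover have "cmod (1 + cis t) > 0"
    using \<open>(cmod (1 + cis t))\<^sup>2 = 2 * (1 + cos t)\<close> pos by (metis less_irrefl mult_pos_pos norm_ge_zero order_le_less power_zero_numeral zero_less_numeral)
  ultimately show ?thesis
    by (simp add: ln_realpow)
qed

lemma has_integral_cos_mult:
  assumes "a \<le> b" "k > 0"
  shows "((\<lambda>t. cos (real k * t)) has_integral (sin (real k * b) - sin (real k * a)) / real k) {a..b}"
proof -
  have "((\<lambda>t. cos (real k * t)) has_integral (sin (real k * b) / real k - sin (real k * a) / real k)) {a..b}"
    using assms
    by (intro fundamental_theorem_of_calculus)
       (auto simp: has_real_derivative_iff_has_vector_derivative[symmetric] intro!: derivative_eq_intros)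
  then show ?thesis
    by (simp add: diff_divide_distrib)
qed

text \<open>With weight 1 all cosine coefficients of positive index vanish on [0, pi] and the index
  0 is removed by the division by \<open>real 0\<close>. So ln |1 + cis t| has integral 0, and only
  the constant -ln 2 contributes.\<close>

lemma has_integral_ln_one_plus_cos_0_pi: "((\<lambda>t. ln (1 + cos t)) has_integral (- pi * ln 2)) {0..pi}"
proof -
  let ?c = "\<lambda>k. integral {0..pi} (\<lambda>t. 1 * cos (real k * t))"
  have c: "?c k = 0" if "k > 0" for k
    using has_integral_cos_mult[of 0 pi k] that by (simp add: integral_unique sin_npi)
  have c': "?c k / real k = 0" for k
    using c[of k] by (cases "k = 0") auto
  have z: "(\<lambda>k. - ((- 1) ^ k) / real k * ?c k) = (\<lambda>_. 0)"
    using c' by (auto simp: fun_eq_iff)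
  have "((\<lambda>t. 1 * ln (cmod (1 + cis t))) has_integral (suminf (\<lambda>k. - ((- 1) ^ k) / real k * ?c k))) {0..pi}"
  proof (rule has_integral_ln_cmod_one_plus_cis)
    have "(\<lambda>k. \<bar>?c k\<bar> / real k) = (\<lambda>_. 0)"
      using c' by (auto simp: fun_eq_iff)
    then show "summable (\<lambda>k. \<bar>?c k\<bar> / real k)"
      by simp
  qed auto
  then have "((\<lambda>t. ln (cmod (1 + cis t))) has_integral 0) {0..pi}"
    unfolding z by simp
  then have "((\<lambda>t. 2 * ln (cmod (1 + cis t)) - ln 2) has_integral 2 * 0 - pi * ln 2) {0..pi}"
    by (intro has_integral_diff has_integral_mult_right) (use has_integral_const_real[of "ln 2 :: real" 0 pi] in simp_all)
  then have "((\<lambda>t. 2 * ln (cmod (1 + cis t)) - ln 2) has_integral (- pi * ln 2)) {0<..<pi}"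
    by (simp add: has_integral_Icc_iff_Ioo)
  then have "((\<lambda>t. ln (1 + cos t)) has_integral (- pi * ln 2)) {0<..<pi}"
    by (rule has_integral_eq[rotated]) (simp add: ln_cmod_one_plus_cis add_divide_distrib)
  then show ?thesis
    by (simp add: has_integral_Icc_iff_Ioo)
qed

text \<open>On the half interval the coefficient is sin (k pi/2) / k: zero for even
  \<open>k\<close>, alternating in sign along odd \<open>k\<close>. Divided once more by
  \<open>k\<close>, it gives Catalan's series.\<close>

lemma has_integral_ln_one_plus_cos_0_pi_half:
  "((\<lambda>t. ln (1 + cos t)) has_integral (2 * catalan_const - pi / 2 * ln 2)) {0..pi / 2}"
proof -
  let ?c = "\<lambda>k. integral {0..pi / 2} (\<lambda>t. 1 * cos (real k * t))"
  have c: "?c k = sin (real k * (pi / 2)) / real k" if "k > 0" for k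
    using has_integral_cos_mult[of 0 "pi / 2" k] that by (simp add: integral_unique)
  have "- ((- 1) ^ k) / real k * ?c k = (if even k then 0 else (- 1) ^ ((k - 1) div 2) / (2 * real ((k - 1) div 2) + 1)\<^sup>2)" for k
  proof (cases "even k")
    case True
    then obtain m where m: "k = 2 * m"
      by (elim evenE)
    have "sin (real k * (pi / 2)) = 0"
      unfolding m using sin_npi[of m] by simp
    then show ?thesis
      using c[of k] True by (cases "k = 0") auto
  next
    case False
    then obtain m where m: "k = 2 * m + 1"
      by (elim oddE)
    have "sin (real k * (pi / 2)) = (- 1) ^ m"
      unfolding m using cos_npi[of m] by (simp add: sin_add distrib_right add_divide_distrib)
    then show ?thesis
      using c[of k] False m by (simp add: power2_eq_square add.commute)
  qed
  then have sums: "(\<lambda>k. - ((- 1) ^ k) / real k * ?c k) sums catalan_const"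
    using sums_if'[OF catalan_const_sums] by simp
  have "((\<lambda>t. 1 * ln (cmod (1 + cis t))) has_integral (suminf (\<lambda>k. - ((- 1) ^ k) / real k * ?c k))) {0..pi / 2}"
  proof (rule has_integral_ln_cmod_one_plus_cis)
    show "summable (\<lambda>k. \<bar>?c k\<bar> / real k)"
    proof (rule summable_comparison_test)
      show "summable (\<lambda>n. 1 / real n ^ 2)"
        using inverse_power_summable[of 2, where ?'a = real] by (simp add: field_simps)
      have "norm (\<bar>?c n\<bar> / real n) \<le> 1 / real n ^ 2" for n
      proof (cases "n = 0")
        case False
        then have "\<bar>?c n\<bar> \<le> 1 / real n"
          using c[of n] by (auto intro: divide_right_mono)
        then have "\<bar>?c n\<bar> / real n \<le> 1 / real n / real n"
          by (rule divide_right_mono) simp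
        then show ?thesis
          by (simp add: power2_eq_square)
      qed simp
      then show "\<exists>N. \<forall>n\<ge>N. norm (\<bar>?c n\<bar> / real n) \<le> 1 / real n ^ 2"
        by blast
    qed
  qed auto
  then have "((\<lambda>t. ln (cmod (1 + cis t))) has_integral catalan_const) {0..pi / 2}"
    unfolding sums_unique[OF sums, symmetric] by simp
  then have "((\<lambda>t. 2 * ln (cmod (1 + cis t)) - ln 2) has_integral 2 * catalan_const - pi / 2 * ln 2) {0..pi / 2}"
    by (intro has_integral_diff has_integral_mult_right) (use has_integral_const_real[of "ln 2 :: real" 0 "pi / 2"] in simp_all)
  moreover have "2 * ln (cmod (1 + cis t)) - ln 2 = ln (1 + cos t)" if "t \<in> {0..pi / 2}" for t
  proof -
    have "0 \<le> t" "t \<le> pi / 2"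
      using that by auto
    moreover from this have "t < pi"
      using pi_gt_zero by linarith
    ultimately show ?thesis
      by (simp add: ln_cmod_one_plus_cis add_divide_distrib)
  qed
  ultimately show ?thesis
    by (rule has_integral_eq[rotated])
qed

text \<open>The weight is odd about pi/2, which kills the even frequencies; \<open>?F\<close> comes
  from one integration by parts.\<close>

lemma has_integral_half_pi_minus_cos:
  assumes "k > 0"
  shows "((\<lambda>t. (pi / 2 - t) * cos (real k * t)) has_integral (if odd k then 2 / (real k)\<^sup>2 else 0)) {0..pi}"
proof -
  let ?F = "\<lambda>t. (pi / 2 - t) * sin (real k * t) / real k - cos (real k * t) / (real k)\<^sup>2"
  have "((\<lambda>t. (pi / 2 - t) * cos (real k * t)) has_integral (?F pi - ?F 0)) {0..pi}"
    using assms
    by (intro fundamental_theorem_of_calculus)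
       (auto simp: has_real_derivative_iff_has_vector_derivative[symmetric] power2_eq_square field_simps
             intro!: derivative_eq_intros)
  also have "?F pi - ?F 0 = (if odd k then 2 / (real k)\<^sup>2 else 0)"
    using sin_npi[of k] cos_npi[of k] by (cases "even k") (auto simp: field_simps)
  finally show ?thesis .
qed

text \<open>The coefficients 2/k^2 over odd \<open>k\<close>, divided by \<open>k\<close>, sum to 2
  * 7/8 * zeta 3. Passing from ln |1 + cis t| to ln (1 + cos t) doubles this, and the constant ln 2
  drops out because the weight has integral 0.\<close>

lemma has_integral_half_pi_minus_ln_one_plus_cos:
  "((\<lambda>t. (pi / 2 - t) * ln (1 + cos t)) has_integral (7 / 2 * zeta 3)) {0..pi}"
proof -
  let ?c = "\<lambda>k. integral {0..pi} (\<lambda>t. (pi / 2 - t) * cos (real k * t))"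
  have c: "?c k = (if odd k then 2 / (real k)\<^sup>2 else 0)" if "k > 0" for k
    using has_integral_half_pi_minus_cos[OF that] by (rule integral_unique)
  have c': "- ((- 1) ^ k) / real k * ?c k = 2 * (if odd k then 1 / real k ^ 3 else 0)" for k
    using c[of k] by (cases "k = 0") (auto simp: power2_eq_square power3_eq_cube)
  have sums: "(\<lambda>k. - ((- 1) ^ k) / real k * ?c k) sums (7 / 4 * zeta 3)"
    unfolding c' using sums_mult[OF odd_zeta_3_sums, of 2] by simp
  have "((\<lambda>t. (pi / 2 - t) * ln (cmod (1 + cis t))) has_integral (suminf (\<lambda>k. - ((- 1) ^ k) / real k * ?c k))) {0..pi}"
  proof (rule has_integral_ln_cmod_one_plus_cis)
    have "\<bar>?c k\<bar> / real k = 2 * (if odd k then 1 / real k ^ 3 else 0)" for k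
      using c[of k] by (cases "k = 0") (auto simp: power2_eq_square power3_eq_cube)
    then show "summable (\<lambda>k. \<bar>?c k\<bar> / real k)"
      using sums_summable[OF sums_mult[OF odd_zeta_3_sums, of 2]] by simp
  qed (auto intro!: continuous_intros)
  then have 1: "((\<lambda>t. (pi / 2 - t) * ln (cmod (1 + cis t))) has_integral (7 / 4 * zeta 3)) {0..pi}"
    unfolding sums_unique[OF sums, symmetric] by simp
  have "((\<lambda>t. pi / 2 - t) has_integral ((pi / 2 * pi - pi\<^sup>2 / 2) - (pi / 2 * 0 - 0\<^sup>2 / 2))) {0..pi}"
    by (intro fundamental_theorem_of_calculus)
       (auto simp: has_real_derivative_iff_has_vector_derivative[symmetric] intro!: derivative_eq_intros)
  then have 2: "((\<lambda>t. pi / 2 - t) has_integral 0) {0..pi}"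
    by (simp add: power2_eq_square)
  have "((\<lambda>t. 2 * ((pi / 2 - t) * ln (cmod (1 + cis t))) - ln 2 * (pi / 2 - t))
      has_integral 2 * (7 / 4 * zeta 3) - ln 2 * 0) {0..pi}"
    by (intro has_integral_diff has_integral_mult_right 1 2)
  then have "((\<lambda>t. 2 * ((pi / 2 - t) * ln (cmod (1 + cis t))) - ln 2 * (pi / 2 - t))
      has_integral 7 / 2 * zeta 3) {0<..<pi}"
    by (simp add: has_integral_Icc_iff_Ioo)
  then have "((\<lambda>t. (pi / 2 - t) * ln (1 + cos t)) has_integral (7 / 2 * zeta 3)) {0<..<pi}"
    by (rule has_integral_eq[rotated]) (simp add: ln_cmod_one_plus_cis field_simps)
  then show ?thesis
    by (simp add: has_integral_Icc_iff_Ioo)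
qed

section \<open>The two double integrals as iterated integrals\<close>

lemma has_integral_reflect_about:
  fixes f :: "real \<Rightarrow> real"
  assumes "(f has_integral I) {a..b}"
  shows "((\<lambda>x. f (c - x)) has_integral I) {c - b..c - a}"
proof -
  have "((\<lambda>x. f (- 1 *\<^sub>R x + c)) has_integral (1 / \<bar>- 1\<bar> ^ DIM(real)) *\<^sub>R I)
      ((\<lambda>x. (1 / - 1) *\<^sub>R x + - ((1 / - 1) *\<^sub>R c)) ` cbox a b)"
    using assms by (intro has_integral_affinity) auto
  moreover have "(\<lambda>x. c - x) ` {a..b} = {c - b..c - a}"
    by simp
  ultimately show ?thesis
    by simp
qed

text \<open>Substitute t = 2w in the integral of ln (1 + cos t) and use 1 + cos 2w = 2 (cos
  w)^2.\<close>

lemma has_integral_ln_cos: "((\<lambda>w. ln (cos w)) has_integral (- (pi / 2) * ln 2)) {0..pi / 2}"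
proof -
  have "((\<lambda>w. ln (1 + cos (2 * w))) has_integral (1 / \<bar>2\<bar>) *\<^sub>R (- pi * ln 2)) ((\<lambda>x. x / 2) ` {0..pi})"
    using has_integral_ln_one_plus_cos_0_pi by (rule has_integral_stretch_real) simp
  also have "(\<lambda>x::real. x / 2) ` {0..pi} = {0..pi / 2}"
    by (simp add: image_divide_atLeastAtMost)
  finally have "((\<lambda>w. ln (1 + cos (2 * w))) has_integral (- (pi / 2) * ln 2)) {0..pi / 2}"
    by simp
  then have "((\<lambda>w. ln (1 + cos (2 * w)) / 2 - ln 2 / 2) has_integral (- (pi / 2) * ln 2 / 2 - pi / 2 * (ln 2 / 2))) {0..pi / 2}"
    by (intro has_integral_diff has_integral_divide)
       (use has_integral_const_real[of "ln 2 / 2 :: real" 0 "pi / 2"] in simp_all)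
  then have "((\<lambda>w. ln (1 + cos (2 * w)) / 2 - ln 2 / 2) has_integral (- (pi / 2) * ln 2)) {0<..<pi / 2}"
    by (simp add: has_integral_Icc_iff_Ioo)
  then have "((\<lambda>w. ln (cos w)) has_integral (- (pi / 2) * ln 2)) {0<..<pi / 2}"
  proof (rule has_integral_eq[rotated])
    fix w assume "w \<in> {0<..<pi / 2}"
    then have pos: "0 < cos w"
      by (auto intro: cos_gt_zero)
    have "1 + cos (2 * w) = 2 * (cos w)\<^sup>2"
      by (simp add: cos_double_cos)
    then have "ln (1 + cos (2 * w)) = ln 2 + 2 * ln (cos w)"
      using pos by (simp add: ln_mult_pos ln_realpow)
    then show "ln (1 + cos (2 * w)) / 2 - ln 2 / 2 = ln (cos w)"
      by (simp add: add_divide_distrib)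
  qed
  then show ?thesis
    by (simp add: has_integral_Icc_iff_Ioo)
qed

lemma has_integral_ln_sin: "((\<lambda>w. ln (sin w)) has_integral (- (pi / 2) * ln 2)) {0..pi / 2}"
  using has_integral_reflect_about[OF has_integral_ln_cos, of "pi / 2"]
  by (simp add: cos_diff)

text \<open>The previous integral over [0, pi] is folded at pi/2. Under v -> pi - v the weight
  changes sign and \<open>ln (1 + cos v)\<close> becomes \<open>ln (1 - cos v)\<close>, that is
  \<open>2 * ln (sin v) - ln (1 + cos v)\<close>. The two halves then add up to twice the
  integrand.\<close>

lemma has_integral_half_pi_minus_ln_cot_half:
  "((\<lambda>v. (pi / 2 - v) * (ln (1 + cos v) - ln (sin v))) has_integral (7 / 4 * zeta 3)) {0..pi / 2}"
proof -
  let ?g = "\<lambda>t. (pi / 2 - t) * ln (1 + cos t)"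
  have g: "?g integrable_on {0..pi}"
    using has_integral_half_pi_minus_ln_one_plus_cos by blast
  obtain I1 where I1: "(?g has_integral I1) {0..pi / 2}"
    using integrable_on_subinterval[OF g, of 0 "pi / 2"] by auto
  obtain I2 where I2: "(?g has_integral I2) {pi / 2..pi}"
    using integrable_on_subinterval[OF g, of "pi / 2" pi] by auto
  have "(?g has_integral (I1 + I2)) {0..pi}"
    by (rule has_integral_combine[OF _ _ I1 I2]) auto
  then have sum: "I1 + I2 = 7 / 2 * zeta 3"
    using has_integral_half_pi_minus_ln_one_plus_cos by (rule has_integral_unique)
  have "((\<lambda>v. ?g (pi - v)) has_integral I2) {0..pi / 2}"
    using has_integral_reflect_about[OF I2, of pi] by simp
  then have "((\<lambda>v. (?g v + ?g (pi - v)) / 2) has_integral (I1 + I2) / 2) {0..pi / 2}"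
    by (intro has_integral_divide has_integral_add I1)
  then have "((\<lambda>v. (?g v + ?g (pi - v)) / 2) has_integral (7 / 4 * zeta 3)) {0<..<pi / 2}"
    by (simp add: sum has_integral_Icc_iff_Ioo)
  then have "((\<lambda>v. (pi / 2 - v) * (ln (1 + cos v) - ln (sin v))) has_integral (7 / 4 * zeta 3)) {0<..<pi / 2}"
  proof (rule has_integral_eq[rotated])
    fix v assume v: "v \<in> {0<..<pi / 2}"
    then have pos: "0 < cos v" "0 < sin v"
      by (auto intro: cos_gt_zero sin_gt_zero)
    have "cos v < 1"
      using v cos_monotone_0_pi[of 0 v] by auto
    have "(sin v)\<^sup>2 = (1 + cos v) * (1 - cos v)"
      by (simp add: sin_squared_eq power2_eq_square algebra_simps)
    then have "ln ((sin v)\<^sup>2) = ln (1 + cos v) + ln (1 - cos v)"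
      using pos \<open>cos v < 1\<close> by (simp add: ln_mult_pos)
    then have ln_minus: "ln (1 - cos v) = 2 * ln (sin v) - ln (1 + cos v)"
      using pos by (simp add: ln_realpow)
    have "?g (pi - v) = (v - pi / 2) * ln (1 - cos v)"
      by (simp add: cos_diff)
    also have "\<dots> = (v - pi / 2) * (2 * ln (sin v) - ln (1 + cos v))"
      by (simp only: ln_minus)
    finally show "(?g v + ?g (pi - v)) / 2 = (pi / 2 - v) * (ln (1 + cos v) - ln (sin v))"
      by (simp only:) (simp add: field_simps)
  qed
  then show ?thesis
    by (simp add: has_integral_Icc_iff_Ioo)
qed

section \<open>The double integral of ln (1 + sin v cos u) over the square of side pi/2\<close>

lemma tan_quarter_pi_minus_half:
  "tan (pi / 4 - v / 2) = cos v / (1 + sin v)"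
  using tan_half[of "pi / 4 - v / 2"] by (simp add: right_diff_distrib sin_diff cos_diff add.commute)

text \<open>The cosine stands for the second sine after the reflection u -> pi/2 - u; it suits the
  half-angle substitution.\<close>

definition ln_sin_cos_integral :: "real \<Rightarrow> real" where
  "ln_sin_cos_integral v = integral {0..pi / 2} (\<lambda>u. ln (1 + sin v * cos u))"

lemma sin_cos_nonneg: 
  assumes "v \<in> {0..pi / 2}" "u \<in> {0..pi / 2}"
  shows "0 \<le> sin v * cos u"
  using assms by (intro mult_nonneg_nonneg) (auto intro!: sin_ge_zero cos_ge_zero)

text \<open>The integrand is (C/S) (1 - 1/(1 + S cos u)) with C = cos v, S = sin v, and 1/(1 + S cos
  u) is integrated by the substitution tan (u/2).\<close>

lemma has_integral_cos_cos_over: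
  assumes v: "0 < v" "v < pi / 2"
  shows "((\<lambda>u. cos v * cos u / (1 + sin v * cos u)) has_integral
           ((pi / 2 * cos v - (pi / 2 - v)) / sin v)) {0..pi / 2}"
proof -
  \<comment> \<open>\<open>m\<close> is the square root of (1 - S)/(1 + S), the factor inside the
    arctangent of the half-angle substitution. It equals tan (pi/4 - v/2), so at u = pi/2, where tan
    (u/2) = 1, the arctangent is explicit.\<close>
  define C S m where "C = cos v" and "S = sin v" and "m = C / (1 + S)"
  have pos: "0 < C" "0 < S"
    using v by (auto simp: C_def S_def intro: cos_gt_zero sin_gt_zero)
  have CS: "C * C + S * S = 1"
    using sin_cos_squared_add[of v] by (simp add: C_def S_def power2_eq_square)
  have m: "m * (1 + S) = C"
    using pos by (simp add: m_def)
  have "m * C * (1 + S) = (1 - S) * (1 + S)"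
    using m CS by (simp add: algebra_simps)
  then have mC: "m * C = 1 - S"
    using pos by simp
  have m0: "m > 0"
    using pos by (simp add: m_def)
  have arctan_deriv: "((\<lambda>u. arctan (tan (u / 2) * m)) has_real_derivative (C / 2 / (1 + S * cos u))) (at u)"
    if u: "u \<in> {0..pi / 2}" for u
  proof -
    define c s where "c = cos (u / 2)" and "s = sin (u / 2)"
    have "- (pi / 2) < u / 2" "u / 2 < pi / 2"
      using u pi_gt_zero unfolding atLeastAtMost_iff by linarith+
    then have c: "0 < c"
      unfolding c_def by (rule cos_gt_zero_pi)
    have cs: "c * c + s * s = 1"
      using sin_cos_squared_add[of "u / 2"] by (simp add: c_def s_def power2_eq_square)
    have cosu: "cos u = c * c - s * s"
      using cos_double[of "u / 2"] by (simp add: c_def s_def power2_eq_square)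
    have pos': "0 < 1 + S * cos u"
      using sin_cos_nonneg[of v u] u v by (simp add: S_def)
    have "m * (1 + S * (c * c - s * s)) = m * (1 + S) * (c * c) + m * (1 - S) * (s * s)"
      using cs by algebra
    also have "\<dots> = C * (c * c + s * s * (m * m))"
      unfolding m mC[symmetric] by (simp add: algebra_simps)
    finally have key: "m * (1 + S * cos u) = C * (c * c + s * s * (m * m))"
      by (simp add: cosu)
    have pos2: "0 < c * c + s * s * (m * m)"
      using c by (intro add_pos_nonneg) auto
    have "((\<lambda>u. arctan (tan (u / 2) * m)) has_real_derivative
        (inverse (1 + (tan (u / 2) * m)\<^sup>2) * (inverse ((cos (u / 2))\<^sup>2) * (1 / 2) * m))) (at u)"
      using c unfolding c_def
      by (auto intro!: derivative_eq_intros)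
    also have "inverse (1 + (tan (u / 2) * m)\<^sup>2) * (inverse ((cos (u / 2))\<^sup>2) * (1 / 2) * m)
        = m / 2 / (c * c + s * s * (m * m))"
      using c pos2 unfolding tan_def c_def[symmetric] s_def[symmetric]
      by (simp add: field_simps power2_eq_square)
    also have "\<dots> = C / 2 / (1 + S * cos u)"
    proof -
      have "m / (c * c + s * s * (m * m)) = C / (1 + S * cos u)"
        using key pos' pos2 by (subst frac_eq_eq) auto
      then show ?thesis
        by (simp only: divide_divide_eq_left mult.commute[of 2]) (simp only: divide_divide_eq_left[symmetric])
    qed
    finally show ?thesis .
  qed
  let ?F = "\<lambda>u. C / S * (u - 2 / C * arctan (tan (u / 2) * m))"
  have "(?F has_real_derivative (C * cos u / (1 + S * cos u))) (at u)" if u: "u \<in> {0..pi / 2}" for u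
  proof -
    have pos': "1 + S * cos u \<noteq> 0"
      using sin_cos_nonneg[of v u] u v by (simp add: S_def)
    have "(?F has_real_derivative (C / S * (1 - 2 / C * (C / 2 / (1 + S * cos u))))) (at u)"
      by (intro DERIV_cmult DERIV_diff DERIV_ident arctan_deriv u)
    also have "C / S * (1 - 2 / C * (C / 2 / (1 + S * cos u))) = C * cos u / (1 + S * cos u)"
      using pos pos' by (simp add: field_simps)
    finally show ?thesis .
  qed
  then have I: "((\<lambda>u. C * cos u / (1 + S * cos u)) has_integral (?F (pi / 2) - ?F 0)) {0..pi / 2}"
    by (intro fundamental_theorem_of_calculus)
       (auto simp: has_real_derivative_iff_has_vector_derivative[symmetric] intro: has_field_derivative_at_within)
  have eq: "?F (pi / 2) - ?F 0 = (pi / 2 * C - (pi / 2 - v)) / S"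
  proof -
    have am: "arctan m = pi / 4 - v / 2"
      unfolding m_def C_def S_def tan_quarter_pi_minus_half[symmetric]
      using v by (intro arctan_tan) auto
    show ?thesis
      using pos by (simp add: am tan_45 field_simps)
  qed
  show ?thesis
    using I unfolding eq unfolding C_def S_def .
qed

text \<open>Differentiation under the integral sign; the quotient is continuous on the closed square
  since 1 + sin v cos u is at least 1. The one-sided derivatives at the ends provide continuity on
  all of [0, pi/2].\<close>

lemma ln_sin_cos_integral_deriv:
  assumes v: "v \<in> {0..pi / 2}"
  shows "(ln_sin_cos_integral has_real_derivative
           integral {0..pi / 2} (\<lambda>u. cos v * cos u / (1 + sin v * cos u))) (at v within {0..pi / 2})"
proof -
  have pos: "1 + sin v * cos u > 0" if "v \<in> {0..pi / 2}" "u \<in> {0..pi / 2}" for v u :: real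
    using sin_cos_nonneg[OF that] by simp
  have "((\<lambda>v. integral (cbox 0 (pi / 2)) (\<lambda>u. ln (1 + sin v * cos u))) has_field_derivative
           integral (cbox 0 (pi / 2)) (\<lambda>u. cos v * cos u / (1 + sin v * cos u))) (at v within {0..pi / 2})"
  proof (rule leibniz_rule_field_derivative)
    fix x t :: real assume "x \<in> {0..pi / 2}" "t \<in> cbox 0 (pi / 2)"
    then show "((\<lambda>x. ln (1 + sin x * cos t)) has_real_derivative cos x * cos t / (1 + sin x * cos t))
        (at x within {0..pi / 2})"
      using pos[of x t] by (auto intro!: derivative_eq_intros)
  next
    fix x :: real assume x: "x \<in> {0..pi / 2}"
    have "1 + sin x * cos t \<noteq> 0" if "t \<in> {0..pi / 2}" for t
      using pos[OF x that] by simp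
    then show "(\<lambda>u. ln (1 + sin x * cos u)) integrable_on cbox 0 (pi / 2)"
      unfolding box_real by (intro integrable_continuous_real continuous_intros) auto
  next
    have "1 + sin (fst p) * cos (snd p) \<noteq> 0" if "p \<in> {0..pi / 2} \<times> cbox 0 (pi / 2)" for p
      using pos[of "fst p" "snd p"] that by (auto simp: mem_Times_iff)
    then show "continuous_on ({0..pi / 2} \<times> cbox 0 (pi / 2)) (\<lambda>(x, t). cos x * cos t / (1 + sin x * cos t))"
      unfolding case_prod_unfold by (intro continuous_intros) auto
  qed (use v in auto)
  then show ?thesis
    unfolding box_real by (simp add: ln_sin_cos_integral_def[abs_def])
qed

text \<open>The factor \<open>v\<close> tames the logarithm at 0, so that the antiderivative in the
  next proof is continuous up to the boundary.\<close>

lemma continuous_on_mult_ln_sin: "continuous_on {0..pi / 2} (\<lambda>v. v * ln (sin v))"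
proof (unfold continuous_on_eq_continuous_within, intro ballI)
  fix v :: real assume v: "v \<in> {0..pi / 2}"
  show "continuous (at v within {0..pi / 2}) (\<lambda>v. v * ln (sin v))"
  proof (cases "v = 0")
    case True
    have "((\<lambda>v::real. v * ln (sin v)) \<longlongrightarrow> 0) (at_right 0)"
      by real_asymp
    then have "((\<lambda>v::real. v * ln (sin v)) \<longlongrightarrow> 0) (at 0 within {0..pi / 2})"
      by (simp add: at_within_Icc_at_right)
    then show ?thesis
      by (simp add: continuous_within True)
  next
    case False
    then have "0 < v" "v < pi"
      using v pi_gt_zero unfolding atLeastAtMost_iff by linarith+
    then have "sin v > 0"
      by (rule sin_gt_zero)
    then show ?thesis
      by (intro continuous_intros) auto
  qed
qed

lemma has_integral_ln_sin_cos_integral: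
  "(ln_sin_cos_integral has_integral (7 / 2 * zeta 3 - pi\<^sup>2 / 2 * ln 2)) {0..pi / 2}"
proof -
  let ?f = ln_sin_cos_integral
  \<comment> \<open>Integration by parts with v - pi/2 leaves (pi/2 - v) times the derivative
    \<open>h\<close> of \<open>?f\<close>, and h = v cot v - (pi/2 - v) tan (v/2). The second and
    third terms of \<open>?M\<close> integrate cot and -tan (v/2) to ln (sin v) and ln (1 + cos v).
    The remainder collects into \<open>?M'\<close> because pi/2 - 2v = 2 (pi/2 - v) - pi/2.\<close>
  let ?M = "\<lambda>v. (v - pi / 2) * ?f v + (pi / 2 - v) * (v * ln (sin v)) + (pi / 2 - v)\<^sup>2 * ln (1 + cos v)"
  let ?M' = "\<lambda>v. ?f v - pi / 2 * ln (sin v) - 2 * ((pi / 2 - v) * (ln (1 + cos v) - ln (sin v)))"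
  have "(?M' has_integral (?M (pi / 2) - ?M 0)) {0..pi / 2}"
  proof (rule fundamental_theorem_of_calculus_interior)
    have "continuous_on {0..pi / 2} ?f"
      using ln_sin_cos_integral_deriv by (rule DERIV_continuous_on)
    moreover have "1 + cos v \<noteq> 0" if "v \<in> {0..pi / 2}" for v
    proof -
      have "0 \<le> cos v"
        using that by (intro cos_ge_zero) auto
      then show ?thesis
        by simp
    qed
    ultimately show "continuous_on {0..pi / 2} ?M"
      by (intro continuous_on_add continuous_on_mult[OF _ continuous_on_mult_ln_sin] continuous_intros) auto
  next
    fix v assume v: "v \<in> {0<..<pi / 2}"
    define h where "h = (pi / 2 * cos v - (pi / 2 - v)) / sin v"
    have pos: "0 < cos v" "0 < sin v"
      using v by (auto intro: cos_gt_zero sin_gt_zero)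
    have at: "at v within {0..pi / 2} = at v"
      using v by (intro at_within_interior) auto
    have f: "(?f has_real_derivative h) (at v)"
      using ln_sin_cos_integral_deriv[of v] has_integral_cos_cos_over[of v] v
      by (simp add: at h_def integral_unique)
    have ln_sin: "((\<lambda>v. ln (sin v)) has_real_derivative cos v / sin v) (at v)"
      using pos by (auto intro!: derivative_eq_intros)
    have ln_cos: "((\<lambda>v. ln (1 + cos v)) has_real_derivative - sin v / (1 + cos v)) (at v)"
      using pos by (auto intro!: derivative_eq_intros)
    have "(?M has_real_derivative (?f v + (v - pi / 2) * h
        + ((pi / 2 - v) * (ln (sin v) + v * (cos v / sin v)) - v * ln (sin v))
        + ((pi / 2 - v)\<^sup>2 * (- sin v / (1 + cos v)) - 2 * (pi / 2 - v) * ln (1 + cos v)))) (at v)"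
      using pos by (auto intro!: derivative_eq_intros f ln_sin ln_cos simp: add_pos_pos algebra_simps diff_divide_distrib add_divide_distrib)
    also have "?f v + (v - pi / 2) * h
        + ((pi / 2 - v) * (ln (sin v) + v * (cos v / sin v)) - v * ln (sin v))
        + ((pi / 2 - v)\<^sup>2 * (- sin v / (1 + cos v)) - 2 * (pi / 2 - v) * ln (1 + cos v)) = ?M' v"
    proof -
      define a b where "a = cos v / sin v" and "b = sin v / (1 + cos v)"
      have q: "sin v / (1 + cos v) = (1 - cos v) / sin v"
        using pos sin_squared_eq[of v]
        by (simp add: frac_eq_eq power2_eq_square algebra_simps)
      have "h = v * (cos v / sin v) - (pi / 2 - v) * (sin v / (1 + cos v))"
        unfolding h_def q using pos by (simp add: field_simps)
      then have hab: "h = v * a - (pi / 2 - v) * b"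
        unfolding a_def b_def .
      have mb: "- sin v / (1 + cos v) = - b"
        by (simp add: b_def)
      show ?thesis
        unfolding a_def[symmetric] mb hab by (simp add: power2_eq_square field_simps)
    qed
    finally show "(?M has_vector_derivative ?M' v) (at v)"
      by (simp add: has_real_derivative_iff_has_vector_derivative)
  qed simp
  \<comment> \<open>At pi/2 every term vanishes; at 0 the inner integral is that of ln 1, so only
    (pi/2)^2 ln 2 remains.\<close>
  moreover have "?M (pi / 2) - ?M 0 = - (pi\<^sup>2 / 4 * ln 2)"
    by (simp add: ln_sin_cos_integral_def power2_eq_square)
  ultimately have "((\<lambda>v. ?M' v + pi / 2 * ln (sin v) + 2 * ((pi / 2 - v) * (ln (1 + cos v) - ln (sin v)))) has_integral
      (- (pi\<^sup>2 / 4 * ln 2) + pi / 2 * (- (pi / 2) * ln 2) + 2 * (7 / 4 * zeta 3))) {0..pi / 2}"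
    by (intro has_integral_add has_integral_mult_right has_integral_ln_sin
          has_integral_half_pi_minus_ln_cot_half) simp
  then show ?thesis
    by (simp add: power2_eq_square algebra_simps)
qed

section \<open>The double integral of ln (sin u + sin v) over the square of side pi/2\<close>

definition ln_sin_add_sin_integral :: "real \<Rightarrow> real" where
  "ln_sin_add_sin_integral v = integral {0..pi / 2} (\<lambda>u. ln (sin u + sin v))"

lemma sin_add_sin_pos:
  assumes "u \<in> {0..pi / 2}" "v \<in> {0..pi / 2}" "0 < u \<or> 0 < v"
  shows "0 < sin u + sin v"
proof -
  have "0 \<le> sin u" "0 \<le> sin v"
    using assms by (auto intro: sin_ge_zero)
  moreover have "0 < sin w" if "0 < w" "w \<in> {0..pi / 2}" for w
    using that pi_gt_zero unfolding atLeastAtMost_iff by (intro sin_gt_zero) linarith+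
  ultimately show ?thesis
    using assms by (metis add_nonneg_pos add_pos_nonneg)
qed

lemma integrable_ln_sin_add_sin:
  assumes v: "v \<in> {0..pi / 2}"
  shows "(\<lambda>u. ln (sin u + sin v)) integrable_on {0..pi / 2}"
proof (cases "v = 0")
  case True
  then show ?thesis
    using has_integral_ln_sin by auto
next
  case False
  then have "sin u + sin v \<noteq> 0" if "u \<in> {0..pi / 2}" for u
    using sin_add_sin_pos[OF that v] v by auto
  then show ?thesis
    by (intro integrable_continuous_real continuous_intros) auto
qed

text \<open>At v = 0 the integrand is singular at u = 0, and differentiation under the integral is
  available only for v > 0. Continuity up to 0 comes from dominated convergence, the integrand lying
  between ln (sin u) and ln 2.\<close>

lemma continuous_on_ln_sin_add_sin_integral: "continuous_on {0..pi / 2} ln_sin_add_sin_integral"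
  unfolding continuous_on_sequentially comp_def
proof (intro allI ballI impI, elim conjE)
  fix x v assume v: "v \<in> {0..pi / 2}" and xn: "\<forall>n. x n \<in> {0..pi / 2}" and lim: "x \<longlonglongrightarrow> v"
  let ?f = "\<lambda>n u. ln (sin u + sin (x n))"
  have "(\<lambda>n. integral {0<..<pi / 2} (?f n)) \<longlonglongrightarrow> integral {0<..<pi / 2} (\<lambda>u. ln (sin u + sin v))"
  proof (rule dominated_convergence(2))
    show "?f n integrable_on {0<..<pi / 2}" for n
      using integrable_ln_sin_add_sin[of "x n"] xn by (simp add: integrable_on_Icc_iff_Ioo)
    have "(\<lambda>u. ln 2 - ln (sin u)) integrable_on {0..pi / 2}"
      using has_integral_ln_sin by (intro integrable_diff integrable_const_ivl) auto
    then show "(\<lambda>u. ln 2 - ln (sin u)) integrable_on {0<..<pi / 2}"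
      by (simp add: integrable_on_Icc_iff_Ioo)
    fix u :: real assume u: "u \<in> {0<..<pi / 2}"
    have pos: "0 < sin u"
      using sin_add_sin_pos[of u 0] u by simp
    show "norm (?f n u) \<le> ln 2 - ln (sin u)" for n
    proof -
      have "0 \<le> x n" "x n \<le> pi"
        using spec[OF xn, of n] pi_gt_zero unfolding atLeastAtMost_iff by linarith+
      then have "0 \<le> sin (x n)"
        by (rule sin_ge_zero)
      then have "ln (sin u) \<le> ?f n u" "?f n u \<le> ln 2"
        using pos add_mono[OF sin_le_one[of u] sin_le_one[of "x n"]] by (auto intro!: ln_mono)
      moreover have "ln (sin u) \<le> 0" "0 \<le> ln (2 :: real)"
        using pos by auto
      ultimately show ?thesis
        unfolding real_norm_def abs_le_iff by linarith
    qed
    have "0 < sin u + sin v"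
      using u v by (intro sin_add_sin_pos) auto
    then show "(\<lambda>n. ?f n u) \<longlonglongrightarrow> ln (sin u + sin v)"
      by (intro tendsto_intros lim) auto
  qed
  then show "(\<lambda>n. ln_sin_add_sin_integral (x n)) \<longlonglongrightarrow> ln_sin_add_sin_integral v"
    by (simp add: ln_sin_add_sin_integral_def integral_open_interval_real)
qed

text \<open>The derivative is ln (cot (v/2)), exactly the factor in the integral of
  \<open>(pi / 2 - v) * (ln (1 + cos v) - ln (sin v))\<close> found above.\<close>

lemma ln_sin_add_sin_integral_deriv:
  assumes v: "0 < v" "v < pi / 2"
  shows "(ln_sin_add_sin_integral has_real_derivative (ln (1 + cos v) - ln (sin v))) (at v)"
proof -
  \<comment> \<open>A neighbourhood of \<open>v\<close> bounded away from 0, on which the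
    denominator stays positive.\<close>
  let ?U = "{v / 2..pi / 2}"
  have pos: "sin t + sin x > 0" if "x \<in> ?U" "t \<in> cbox 0 (pi / 2)" for x t
    using that v by (intro sin_add_sin_pos) auto
  have "((\<lambda>v. integral (cbox 0 (pi / 2)) (\<lambda>u. ln (sin u + sin v))) has_field_derivative
           integral (cbox 0 (pi / 2)) (\<lambda>u. cos v / (sin u + sin v))) (at v within ?U)"
  proof (rule leibniz_rule_field_derivative)
    fix x t :: real assume "x \<in> ?U" "t \<in> cbox 0 (pi / 2)"
    then show "((\<lambda>x. ln (sin t + sin x)) has_real_derivative cos x / (sin t + sin x)) (at x within ?U)"
      using pos[of x t] by (auto intro!: derivative_eq_intros)
  next
    fix x :: real assume "x \<in> ?U"
    then show "(\<lambda>u. ln (sin u + sin x)) integrable_on cbox 0 (pi / 2)"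
      using v unfolding box_real by (intro integrable_ln_sin_add_sin) auto
  next
    have "sin (snd p) + sin (fst p) \<noteq> 0" if "p \<in> ?U \<times> cbox 0 (pi / 2)" for p
      using pos[of "fst p" "snd p"] that by (auto simp: mem_Times_iff)
    then show "continuous_on (?U \<times> cbox 0 (pi / 2)) (\<lambda>(x, t). cos x / (sin t + sin x))"
      unfolding case_prod_unfold by (intro continuous_intros) auto
  qed (use v in auto)
  moreover have "at v within ?U = at v"
    using v by (intro at_within_interior) auto
  moreover have "integral (cbox 0 (pi / 2)) (\<lambda>u. cos v / (sin u + sin v)) = ln (1 + cos v) - ln (sin v)"
  proof (rule integral_unique)
    \<comment> \<open>Writing v as (u + v)/2 - (u - v)/2 and factoring sin u + sin v splits the
      integrand into half of cot ((u + v)/2) + tan ((u - v)/2). At u = pi/2 the two logarithms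
      cancel.\<close>
    let ?F = "\<lambda>u. ln (sin ((u + v) / 2)) - ln (cos ((u - v) / 2))"
    have "((\<lambda>u. cos v / (sin u + sin v)) has_integral (?F (pi / 2) - ?F 0)) {0..pi / 2}"
    proof (rule fundamental_theorem_of_calculus)
      fix u assume u: "u \<in> {0..pi / 2}"
      have "0 \<le> u" "u \<le> pi / 2"
        using u by auto
      then have "0 < u + v" "u + v < pi * 2" "- pi < u - v" "u - v < pi"
        using v pi_gt_zero by linarith+
      then have "0 < (u + v) / 2" "(u + v) / 2 < pi" "- (pi / 2) < (u - v) / 2" "(u - v) / 2 < pi / 2"
        by simp_all
      then have s: "0 < sin ((u + v) / 2)" and c: "0 < cos ((u - v) / 2)"
        by (auto intro: sin_gt_zero cos_gt_zero_pi)
      have "cos v = cos ((u + v) / 2 - (u - v) / 2)"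
        by (simp add: field_simps)
      also have "\<dots> = cos ((u + v) / 2) * cos ((u - v) / 2) + sin ((u + v) / 2) * sin ((u - v) / 2)"
        by (rule cos_diff)
      finally have cosv: "cos v = \<dots>" .
      have "(?F has_real_derivative (cos ((u + v) / 2) / 2 / sin ((u + v) / 2) + sin ((u - v) / 2) / 2 / cos ((u - v) / 2))) (at u)"
        using s c by (auto intro!: derivative_eq_intros)
      also have "cos ((u + v) / 2) / 2 / sin ((u + v) / 2) + sin ((u - v) / 2) / 2 / cos ((u - v) / 2)
          = cos v / (2 * sin ((u + v) / 2) * cos ((u - v) / 2))"
        unfolding cosv using s c by (simp add: field_simps)
      also have "2 * sin ((u + v) / 2) * cos ((u - v) / 2) = sin u + sin v"
        by (rule sin_plus_sin[symmetric])
      finally show "(?F has_vector_derivative cos v / (sin u + sin v)) (at u within {0..pi / 2})"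
        unfolding has_real_derivative_iff_has_vector_derivative[symmetric]
        by (rule has_field_derivative_at_within)
    qed simp
    also have "?F (pi / 2) - ?F 0 = ln (1 + cos v) - ln (sin v)"
    proof -
      have "0 < v / 2" "v / 2 < pi" "- (pi / 2) < v / 2" "v / 2 < pi / 2"
        using v pi_gt_zero by linarith+
      then have s: "0 < sin (v / 2)" and c: "0 < cos (v / 2)"
        by (auto intro: sin_gt_zero cos_gt_zero_pi)
      have "(pi / 2 + v) / 2 = pi / 2 - (pi / 2 - v) / 2"
        by (simp add: field_simps)
      then have "sin ((pi / 2 + v) / 2) = cos ((pi / 2 - v) / 2)"
        by (simp only: sin_cos_eq) simp
      moreover have "sin v = 2 * sin (v / 2) * cos (v / 2)" "1 + cos v = 2 * (cos (v / 2))\<^sup>2"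
        using sin_double[of "v / 2"] cos_double_cos[of "v / 2"] by simp_all
      moreover have "- v / 2 = - (v / 2)"
        by simp
      ultimately show ?thesis
        using s c by (simp add: ln_mult_pos ln_realpow)
    qed
    finally show "((\<lambda>u. cos v / (sin u + sin v)) has_integral (ln (1 + cos v) - ln (sin v))) (cbox 0 (pi / 2))"
      by simp
  qed
  ultimately show ?thesis
    by (simp add: ln_sin_add_sin_integral_def[abs_def])
qed

lemma has_integral_ln_sin_add_sin_integral:
  "(ln_sin_add_sin_integral has_integral (7 / 4 * zeta 3 - pi\<^sup>2 / 4 * ln 2)) {0..pi / 2}"
proof -
  let ?f = ln_sin_add_sin_integral
  \<comment> \<open>The antiderivative v - pi/2 of 1 makes the boundary term at pi/2 vanish and
    produces the weight pi/2 - v. At v = 0 the boundary term is the known integral of ln (sin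
    u).\<close>
  let ?M = "\<lambda>v. (v - pi / 2) * ?f v"
  let ?M' = "\<lambda>v. ?f v - (pi / 2 - v) * (ln (1 + cos v) - ln (sin v))"
  have "(?M' has_integral (?M (pi / 2) - ?M 0)) {0..pi / 2}"
  proof (rule fundamental_theorem_of_calculus_interior)
    show "continuous_on {0..pi / 2} ?M"
      by (intro continuous_intros continuous_on_ln_sin_add_sin_integral)
    show "(?M has_vector_derivative ?M' v) (at v)" if "v \<in> {0<..<pi / 2}" for v
      using ln_sin_add_sin_integral_deriv[of v] that
      by (auto simp: has_real_derivative_iff_has_vector_derivative[symmetric] field_simps
               intro!: derivative_eq_intros)
  qed simp
  also have "?M (pi / 2) - ?M 0 = - (pi\<^sup>2 / 4 * ln 2)"
    using integral_unique[OF has_integral_ln_sin]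
    by (simp add: ln_sin_add_sin_integral_def power2_eq_square)
  finally have "(?M' has_integral - (pi\<^sup>2 / 4 * ln 2)) {0..pi / 2}" .
  then have "((\<lambda>v. ?M' v + (pi / 2 - v) * (ln (1 + cos v) - ln (sin v))) has_integral
      (- (pi\<^sup>2 / 4 * ln 2) + 7 / 4 * zeta 3)) {0..pi / 2}"
    by (intro has_integral_add has_integral_half_pi_minus_ln_cot_half)
  then show ?thesis
    by simp
qed

section \<open>Integration over the unit square and the unit cube\<close>

text \<open>As a density on the whole line, its measurable sets are those of \<open>borel\<close>,
  which keeps product measurability free of restrictions to the interval.\<close>

definition unit_uniform :: "real measure" where
  "unit_uniform = density lborel (indicator {0..1})"

lemma sets_unit_uniform [simp, measurable_cong]: "sets unit_uniform = sets borel"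
  by (simp add: unit_uniform_def)

lemma space_unit_uniform [simp]: "space unit_uniform = UNIV"
  by (simp add: unit_uniform_def)

lemma emeasure_unit_uniform: 
  "A \<in> sets borel \<Longrightarrow> emeasure unit_uniform A = emeasure lborel ({0..1} \<inter> A)"
  by (simp add: unit_uniform_def emeasure_density flip: indicator_inter_arith)

interpretation unit_uniform: finite_measure unit_uniform
  by standard (simp add: emeasure_unit_uniform)

interpretation unit_uniform2: finite_measure "unit_uniform \<Otimes>\<^sub>M unit_uniform"
  by (rule finite_measure_pair_measure) unfold_locales

lemma measure_unit_uniform [simp]: "measure unit_uniform UNIV = 1"
  by (simp add: measure_def emeasure_unit_uniform)

lemma AE_unit_uniform: "(AE t in lborel. t \<in> {0..1} \<longrightarrow> P t) \<Longrightarrow> AE t in unit_uniform. P t"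
  unfolding unit_uniform_def by (subst AE_density) (auto simp: indicator_def split: if_splits)

lemma AE_unit_uniform_finite:
  assumes "finite A" "\<And>t. 0 \<le> t \<Longrightarrow> t \<le> 1 \<Longrightarrow> t \<notin> A \<Longrightarrow> P t"
  shows "AE t in unit_uniform. P t"
proof (rule AE_unit_uniform)
  have "AE t in lborel. t \<notin> A"
    using assms(1) by (intro AE_not_in finite_imp_null_set_lborel)
  then show "AE t in lborel. t \<in> {0..1} \<longrightarrow> P t"
    by eventually_elim (use assms(2) in auto)
qed

section \<open>Fubini rules and measure-preserving substitutions\<close>

text \<open>If f is at most C, then |f| is at most 2|C| - f. So the iterated integral of the
  absolute value is controlled by that of f itself, and the upper bound replaces an integrability
  hypothesis on the product.\<close>

lemma has_bochner_integral_pair_bounded_above: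
  fixes f :: "'a \<times> 'b \<Rightarrow> real"
  assumes "finite_measure M" "finite_measure N"
    and f [measurable]: "f \<in> borel_measurable (M \<Otimes>\<^sub>M N)"
    and le: "AE x in M. AE y in N. f (x, y) \<le> C"
    and inner: "AE x in M. has_bochner_integral N (\<lambda>y. f (x, y)) (g x)"
    and outer: "has_bochner_integral M g I"
  shows "has_bochner_integral (M \<Otimes>\<^sub>M N) f I"
proof -
  interpret M: finite_measure M by fact
  interpret N: finite_measure N by fact
  interpret P: pair_sigma_finite M N ..
  have g [measurable]: "g \<in> borel_measurable M"
    using outer by (rule borel_measurable_has_bochner_integral)
  have int: "integrable (M \<Otimes>\<^sub>M N) f"
  proof (rule P.Fubini_integrable)
    show "AE x in M. integrable N (\<lambda>y. f (x, y))"
      using inner by eventually_elim (simp add: has_bochner_integral_iff)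
    show "integrable M (\<lambda>x. \<integral>y. norm (f (x, y)) \<partial>N)"
    proof (rule Bochner_Integration.integrable_bound)
      show "integrable M (\<lambda>x. 2 * \<bar>C\<bar> * measure N (space N) - g x)"
        using outer by (auto simp: has_bochner_integral_iff)
      show "AE x in M. norm (\<integral>y. norm (f (x, y)) \<partial>N) \<le> norm (2 * \<bar>C\<bar> * measure N (space N) - g x)"
        using inner le
      proof eventually_elim
        case (elim x)
        then have i: "integrable N (\<lambda>y. f (x, y))" and gx: "g x = (\<integral>y. f (x, y) \<partial>N)"
          by (auto simp: has_bochner_integral_iff)
        have "(\<integral>y. norm (f (x, y)) \<partial>N) \<le> (\<integral>y. 2 * \<bar>C\<bar> - f (x, y) \<partial>N)"
        proof (rule integral_mono_AE)
          show "AE y in N. norm (f (x, y)) \<le> 2 * \<bar>C\<bar> - f (x, y)"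
            using elim(2) by eventually_elim auto
        qed (use i in auto)
        also have "\<dots> = 2 * \<bar>C\<bar> * measure N (space N) - g x"
          using i gx by (simp add: mult_ac)
        finally show ?case
          by (simp add: abs_le_iff integral_nonneg_AE)
      qed
    qed measurable
  qed measurable
  have "integral\<^sup>L (M \<Otimes>\<^sub>M N) f = (\<integral>x. (\<integral>y. f (x, y) \<partial>N) \<partial>M)"
    using int by (rule P.integral_fst'[symmetric])
  also have "\<dots> = (\<integral>x. g x \<partial>M)"
    by (rule integral_cong_AE) (use inner in \<open>auto elim!: eventually_mono simp: has_bochner_integral_iff\<close>)
  also have "\<dots> = I"
    using outer by (simp add: has_bochner_integral_iff)
  finally show ?thesis
    using int by (simp add: has_bochner_integral_iff)
qed

lemma has_bochner_integral_pair_swap: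
  fixes f :: "'a \<times> 'b \<Rightarrow> real"
  assumes "finite_measure M" "finite_measure N"
    and "has_bochner_integral (M \<Otimes>\<^sub>M N) f I"
  shows "has_bochner_integral (N \<Otimes>\<^sub>M M) (\<lambda>(y, x). f (x, y)) I"
proof -
  interpret M: finite_measure M by fact
  interpret N: finite_measure N by fact
  interpret P: pair_sigma_finite M N ..
  have f: "integrable (M \<Otimes>\<^sub>M N) f" "integral\<^sup>L (M \<Otimes>\<^sub>M N) f = I"
    using assms(3) by (auto simp: has_bochner_integral_iff)
  show ?thesis
    unfolding has_bochner_integral_iff f(2)[symmetric]
    using P.integrable_product_swap[OF f(1)] P.integral_product_swap[OF borel_measurable_integrable[OF f(1)]]
    by (rule conjI)
qed

text \<open>The reverse direction: from a known product integral and known slice integrals it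
  recovers the outer integral. After a swap this evaluates the same double integral in the other
  order.\<close>

lemma has_bochner_integral_pair_fst:
  fixes f :: "'a \<times> 'b \<Rightarrow> real"
  assumes "finite_measure M" "finite_measure N"
    and f: "has_bochner_integral (M \<Otimes>\<^sub>M N) f I"
    and inner: "AE x in M. has_bochner_integral N (\<lambda>y. f (x, y)) (g x)"
    and g [measurable]: "g \<in> borel_measurable M"
  shows "has_bochner_integral M g I"
proof -
  interpret M: finite_measure M by fact
  interpret N: finite_measure N by fact
  interpret P: pair_sigma_finite M N ..
  have [measurable]: "f \<in> borel_measurable (M \<Otimes>\<^sub>M N)"
    using f by (rule borel_measurable_has_bochner_integral)
  have int: "integrable (M \<Otimes>\<^sub>M N) f" "integral\<^sup>L (M \<Otimes>\<^sub>M N) f = I"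
    using f by (auto simp: has_bochner_integral_iff)
  have "has_bochner_integral M (\<lambda>x. \<integral>y. f (x, y) \<partial>N) I"
    using P.integrable_fst'[OF int(1)] P.integral_fst'[OF int(1)] int(2)
    by (simp add: has_bochner_integral_iff)
  then show ?thesis
    by (rule has_bochner_integralI_AE)
       (use inner in \<open>auto elim!: eventually_mono simp: has_bochner_integral_iff\<close>)
qed

lemma has_bochner_integral_measure_preserving:
  fixes f :: "'a \<Rightarrow> real"
  assumes "distr M N h = N" "h \<in> measurable M N" "has_bochner_integral N f I"
  shows "has_bochner_integral M (\<lambda>x. f (h x)) I"
proof -
  have [measurable]: "f \<in> borel_measurable N"
    using assms(3) by (rule borel_measurable_has_bochner_integral)
  have "has_bochner_integral (distr M N h) f I"
    using assms(1,3) by simp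
  then show ?thesis
    using assms(2) by (simp add: has_bochner_integral_iff integrable_distr_eq integral_distr)
qed

lemma has_bochner_integral_unit_uniform_pair_map:
  fixes f :: "real \<times> real \<Rightarrow> real"
  assumes "distr unit_uniform unit_uniform h = unit_uniform" "h \<in> borel_measurable borel"
    and "distr unit_uniform unit_uniform k = unit_uniform" "k \<in> borel_measurable borel"
    and f: "has_bochner_integral (unit_uniform \<Otimes>\<^sub>M unit_uniform) f I"
  shows "has_bochner_integral (unit_uniform \<Otimes>\<^sub>M unit_uniform) (\<lambda>(x, y). f (h x, k y)) I"
proof -
  have h: "h \<in> measurable unit_uniform unit_uniform" and k: "k \<in> measurable unit_uniform unit_uniform"
    unfolding measurable_cong_sets[OF sets_unit_uniform sets_unit_uniform] by (rule assms)+
  have "distr unit_uniform unit_uniform h \<Otimes>\<^sub>M distr unit_uniform unit_uniform k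
      = distr (unit_uniform \<Otimes>\<^sub>M unit_uniform) (unit_uniform \<Otimes>\<^sub>M unit_uniform) (\<lambda>(x, y). (h x, k y))"
    by (rule pair_measure_distr[OF h k])
       (simp only: assms(3), rule unit_uniform.sigma_finite_measure_axioms)
  then have eq: "distr (unit_uniform \<Otimes>\<^sub>M unit_uniform) (unit_uniform \<Otimes>\<^sub>M unit_uniform) (\<lambda>(x, y). (h x, k y))
      = unit_uniform \<Otimes>\<^sub>M unit_uniform"
    unfolding assms(1,3) by (rule sym)
  have m: "(\<lambda>(x, y). (h x, k y)) \<in> measurable (unit_uniform \<Otimes>\<^sub>M unit_uniform) (unit_uniform \<Otimes>\<^sub>M unit_uniform)"
    unfolding case_prod_unfold
    by (intro measurable_Pair measurable_compose[OF measurable_fst h] measurable_compose[OF measurable_snd k])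
  show ?thesis
    using has_bochner_integral_measure_preserving[OF eq m f] unfolding case_prod_unfold .
qed

lemma distr_unit_uniform_reflect: "distr unit_uniform unit_uniform (\<lambda>t. 1 - t) = unit_uniform"
proof (rule measure_eqI)
  fix A :: "real set" assume "A \<in> sets (distr unit_uniform unit_uniform (\<lambda>t. 1 - t))"
  then have [measurable]: "A \<in> sets borel"
    by simp
  have "emeasure unit_uniform A = (\<integral>\<^sup>+t. indicator {0..1} t * indicator A t \<partial>lborel)"
    by (simp add: unit_uniform_def emeasure_density)
  also have "\<dots> = (\<integral>\<^sup>+t. indicator {0..1} (1 - t) * indicator A (1 - t) \<partial>lborel)"
    by (subst nn_integral_real_affine[where t = 1 and c = "-1"]) auto
  also have "\<dots> = (\<integral>\<^sup>+t. indicator {0..1} t * indicator ((\<lambda>t. 1 - t) -` A) t \<partial>lborel)"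
    by (intro nn_integral_cong) (auto simp: indicator_def)
  also have "\<dots> = emeasure unit_uniform ((\<lambda>t. 1 - t) -` A)"
    using measurable_sets[of "\<lambda>t. 1 - t" borel borel A] by (simp add: unit_uniform_def emeasure_density)
  also have "\<dots> = emeasure (distr unit_uniform unit_uniform (\<lambda>t. 1 - t)) A"
    by (subst emeasure_distr) auto
  finally show "emeasure (distr unit_uniform unit_uniform (\<lambda>t. 1 - t)) A = emeasure unit_uniform A" ..
qed simp

text \<open>The tent map of dynamics. It folds [0, 1] two-to-one onto itself and turns the quarter
  period sin (pi t/2) into the full arch |sin (pi t)|.\<close>

definition tent :: "real \<Rightarrow> real" where
  "tent t = 1 - \<bar>2 * t - 1\<bar>"

lemma tent_measurable [measurable]: "tent \<in> borel_measurable borel"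
  unfolding tent_def by measurable

lemma ennreal_half_add_half: "ennreal (1 / 2) * x + ennreal (1 / 2) * x = x"
proof -
  have "ennreal (1 / 2) + ennreal (1 / 2) = ennreal (1 / 2 + 1 / 2)"
    by (rule ennreal_plus[symmetric]) auto
  then have half: "ennreal (1 / 2) + ennreal (1 / 2) = 1"
    by (simp only: field_sum_of_halves ennreal_1)
  show ?thesis
    by (simp only: distrib_right[symmetric] half mult_1_left)
qed

lemma distr_unit_uniform_tent: "distr unit_uniform unit_uniform tent = unit_uniform"
proof (rule measure_eqI)
  fix A :: "real set" assume "A \<in> sets (distr unit_uniform unit_uniform tent)"
  then have [measurable]: "A \<in> sets borel"
    by simp
  have [measurable]: "tent -` A \<in> sets borel"
    using measurable_sets[of tent borel borel A] by simp
  let ?I = "\<lambda>t. indicator {0..1} t * indicator A t :: ennreal"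
  have "emeasure (distr unit_uniform unit_uniform tent) A = emeasure unit_uniform (tent -` A)"
    by (subst emeasure_distr) auto
  also have "\<dots> = (\<integral>\<^sup>+t. indicator {0..1} t * indicator (tent -` A) t \<partial>lborel)"
    by (simp add: unit_uniform_def emeasure_density)
  \<comment> \<open>One summand per affine branch of the tent; each branch has slope 2 in absolute
    value and so contributes half of the measure.\<close>
  also have "\<dots> = (\<integral>\<^sup>+t. ?I (0 + 2 * t) + ?I (2 + (- 2) * t) \<partial>lborel)"
  proof (rule nn_integral_cong_AE)
    \<comment> \<open>At the peak both branches lie in the interval and would be counted
      twice.\<close>
    have "AE t in lborel. t \<noteq> (1 / 2 :: real)"
      by (rule AE_lborel_singleton)
    then show "AE t in lborel. indicator {0..1} t * indicator (tent -` A) t = ?I (0 + 2 * t) + ?I (2 + (- 2) * t)"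
    proof eventually_elim
      case (elim t)
      show ?case
      proof (cases "t < 1 / 2")
        case True
        then have "tent t = 2 * t" "2 - 2 * t \<notin> {0..1}" "t \<in> {0..1} \<longleftrightarrow> 2 * t \<in> {0..1}"
          by (auto simp: tent_def)
        then show ?thesis
          by (simp add: indicator_def)
      next
        case False
        with elim have "tent t = 2 - 2 * t" "2 * t \<notin> {0..1}" "t \<in> {0..1} \<longleftrightarrow> 2 - 2 * t \<in> {0..1}"
          by (auto simp: tent_def)
        then show ?thesis
          by (simp add: indicator_def)
      qed
    qed
  qed
  also have "\<dots> = (\<integral>\<^sup>+t. ?I (0 + 2 * t) \<partial>lborel) + (\<integral>\<^sup>+t. ?I (2 + (- 2) * t) \<partial>lborel)"
    by (rule nn_integral_add) auto
  also have "\<dots> = ennreal (1 / 2) * emeasure unit_uniform A + ennreal (1 / 2) * emeasure unit_uniform A"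
  proof -
    have "emeasure unit_uniform A = (\<integral>\<^sup>+t. ?I t \<partial>lborel)"
      by (simp add: unit_uniform_def emeasure_density)
    moreover have "(\<integral>\<^sup>+t. ?I t \<partial>lborel) = ennreal \<bar>2\<bar> * (\<integral>\<^sup>+t. ?I (0 + 2 * t) \<partial>lborel)"
      by (rule nn_integral_real_affine) auto
    moreover have "(\<integral>\<^sup>+t. ?I t \<partial>lborel) = ennreal \<bar>- 2\<bar> * (\<integral>\<^sup>+t. ?I (2 + (- 2) * t) \<partial>lborel)"
      by (rule nn_integral_real_affine) auto
    ultimately have 1: "emeasure unit_uniform A = ennreal 2 * (\<integral>\<^sup>+t. ?I (0 + 2 * t) \<partial>lborel)"
      and 2: "emeasure unit_uniform A = ennreal 2 * (\<integral>\<^sup>+t. ?I (2 + (- 2) * t) \<partial>lborel)"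
      by (simp_all only: abs_minus_cancel abs_numeral)
    have "ennreal (1 / 2) * ennreal 2 = ennreal (1 / 2 * 2)"
      by (rule ennreal_mult[symmetric]) auto
    then have 3: "ennreal (1 / 2) * (ennreal 2 * x) = x" for x
      by (simp only: mult.assoc[symmetric]) simp
    show ?thesis
      using 3[of "\<integral>\<^sup>+t. ?I (0 + 2 * t) \<partial>lborel", folded 1] 3[of "\<integral>\<^sup>+t. ?I (2 + (- 2) * t) \<partial>lborel", folded 2]
      by (simp only:)
  qed
  also have "\<dots> = emeasure unit_uniform A"
    by (rule ennreal_half_add_half)
  finally show "emeasure (distr unit_uniform unit_uniform tent) A = emeasure unit_uniform A" .
qed simp

section \<open>Evaluation of Laurent polynomials as a ring homomorphism\<close>

text \<open>Lets polynomials with different supports be summed over one common set of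
  exponents.\<close>

lemma laurent_eval_superset:
  assumes "finite K" "Poly_Mapping.keys P \<subseteq> K"
  shows "laurent_eval P w = (\<Sum>e\<in>K. Poly_Mapping.lookup P e * (\<Prod>i\<in>UNIV. (w $ i) powi (e $ i)))"
  unfolding laurent_eval_def
  by (rule sum.mono_neutral_left) (use assms in \<open>auto simp: in_keys_iff\<close>)

lemma laurent_eval_add: "laurent_eval (P + Q) w = laurent_eval P w + laurent_eval Q w"
proof -
  let ?K = "Poly_Mapping.keys P \<union> Poly_Mapping.keys Q"
  have "laurent_eval R w = (\<Sum>e\<in>?K. Poly_Mapping.lookup R e * (\<Prod>i\<in>UNIV. (w $ i) powi (e $ i)))"
    if "R = P + Q \<or> R = P \<or> R = Q" for R
    using that keys_add[of P Q] by (intro laurent_eval_superset) auto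
  then show ?thesis
    by (simp add: lookup_add distrib_right sum.distrib)
qed

lemma laurent_eval_0 [simp]: "laurent_eval 0 w = 0"
  by (simp add: laurent_eval_def)

lemma laurent_eval_sum: "laurent_eval (\<Sum>x\<in>A. f x) w = (\<Sum>x\<in>A. laurent_eval (f x) w)"
  by (induction A rule: infinite_finite_induct) (simp_all add: laurent_eval_add)

lemma laurent_eval_single:
  "laurent_eval (Poly_Mapping.single e c) w = c * (\<Prod>i\<in>UNIV. (w $ i) powi (e $ i))"
  using laurent_eval_superset[of "{e}" "Poly_Mapping.single e c" w] by simp

lemma laurent_eval_uminus: "laurent_eval (- P) w = - laurent_eval P w"
  using laurent_eval_add[of P "- P" w] by (simp add: eq_neg_iff_add_eq_0 add.commute)

lemma laurent_eval_diff: "laurent_eval (P - Q) w = laurent_eval P w - laurent_eval Q w"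
  using laurent_eval_add[of P "- Q" w] by (simp add: laurent_eval_uminus)

lemma poly_mapping_eq_sum_single:
  "P = (\<Sum>k\<in>Poly_Mapping.keys P. Poly_Mapping.single k (Poly_Mapping.lookup P k))"
  by (rule poly_mapping_eqI)
     (auto simp: lookup_sum lookup_single when_def in_keys_iff sum.delta' if_distrib cong: if_cong)

text \<open>By bilinearity the claim reduces to monomials, where it is the addition law of
  \<open>powi\<close>; with exponents of both signs that law requires nonzero coordinates.\<close>

lemma laurent_eval_mult:
  assumes "\<And>i. w $ i \<noteq> 0"
  shows "laurent_eval (P * Q) w = laurent_eval P w * laurent_eval Q w"
proof -
  have single: "laurent_eval (Poly_Mapping.single e c * Poly_Mapping.single e' c') w
      = laurent_eval (Poly_Mapping.single e c) w * laurent_eval (Poly_Mapping.single e' c') w" for e e' c c'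
    using assms by (simp add: mult_single laurent_eval_single power_int_add prod.distrib mult_ac)
  have "P * Q = (\<Sum>k\<in>Poly_Mapping.keys P. Poly_Mapping.single k (Poly_Mapping.lookup P k))
      * (\<Sum>l\<in>Poly_Mapping.keys Q. Poly_Mapping.single l (Poly_Mapping.lookup Q l))"
    by (simp only: poly_mapping_eq_sum_single[symmetric])
  also have "laurent_eval \<dots> w
      = laurent_eval (\<Sum>k\<in>Poly_Mapping.keys P. Poly_Mapping.single k (Poly_Mapping.lookup P k)) w
      * laurent_eval (\<Sum>l\<in>Poly_Mapping.keys Q. Poly_Mapping.single l (Poly_Mapping.lookup Q l)) w"
    by (simp only: sum_product laurent_eval_sum single)
  also have "\<dots> = laurent_eval P w * laurent_eval Q w"
    by (simp only: poly_mapping_eq_sum_single[symmetric])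
  finally show ?thesis .
qed

lemma laurent_eval_1 [simp]: "laurent_eval 1 w = 1"
  unfolding single_one[symmetric] laurent_eval_single by simp

lemma laurent_eval_numeral [simp]: "laurent_eval (numeral n) w = numeral n"
  unfolding single_numeral[symmetric] laurent_eval_single by simp

lemma laurent_eval_power:
  assumes "\<And>i. w $ i \<noteq> 0"
  shows "laurent_eval (P ^ n) w = laurent_eval P w ^ n"
  by (induction n) (simp_all add: laurent_eval_mult[OF assms])

lemma prod_powi_axis:
  fixes w :: "'a::field ^ 'n::finite"
  shows "(\<Prod>j\<in>UNIV. (w $ j) powi (axis i k $ j)) = (w $ i) powi k"
proof -
  have "(\<Prod>j\<in>UNIV. (w $ j) powi (axis i k $ j)) = (\<Prod>j\<in>UNIV. if j = i then (w $ i) powi k else 1)"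
    by (intro prod.cong) (auto simp: axis_def)
  then show ?thesis
    by simp
qed

lemma laurent_eval_var: "laurent_eval (laurent_var i) w = w $ i"
  by (simp add: laurent_var_def laurent_eval_single prod_powi_axis)

lemma laurent_eval_var_inverse: "laurent_eval (laurent_var_inverse i) w = inverse (w $ i)"
  by (simp add: laurent_var_inverse_def laurent_eval_single prod_powi_axis power_int_minus)

section \<open>From Lebesgue measure on three-dimensional vectors to iterated integrals\<close>

text \<open>The index different from \<open>j\<close> and \<open>k\<close> receives
  \<open>snd p\<close>, the variable integrated innermost. The choice of \<open>j\<close> and
  \<open>k\<close> thus selects the variable for Jensen's formula.\<close>

definition vec3 :: "3 \<Rightarrow> 3 \<Rightarrow> (real \<times> real) \<times> real \<Rightarrow> real ^ 3" where
  "vec3 j k p = (\<chi> n. if n = j then fst (fst p) else if n = k then snd (fst p) else snd p)"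

lemma vec3_measurable [measurable]: "vec3 j k \<in> borel_measurable borel"
proof -
  have "continuous_on UNIV (\<lambda>p :: (real \<times> real) \<times> real. if n = j then fst (fst p) else if n = k then snd (fst p) else snd p)" for n
    by (cases "n = j"; cases "n = k") (auto intro!: continuous_intros)
  then show ?thesis
    unfolding vec3_def[abs_def]
    by (intro borel_measurable_continuous_onI continuous_on_vec_lambda)
qed

text \<open>Lebesgue measure is determined by boxes, and the preimage of a box under a rearrangement
  of coordinates is the box with rearranged sides, of equal volume.\<close>

lemma lborel_vec3:
  assumes UNIV: "UNIV = {i, j, k :: 3}" and distinct: "distinct [i, j, k]"
  shows "lborel = distr lborel borel (vec3 j k)"
proof (rule lborel_eqI)
  fix l u :: "real ^ 3"
  assume le: "\<And>b. b \<in> Basis \<Longrightarrow> l \<bullet> b \<le> u \<bullet> b"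
  have le': "l $ n \<le> u $ n" for n
    using le[of "axis n 1"] by (simp add: inner_axis axis_in_Basis_iff)
  have "vec3 j k -` box l u = box ((l $ j, l $ k), l $ i) ((u $ j, u $ k), u $ i)"
  proof -
    have "p \<in> vec3 j k -` box l u \<longleftrightarrow> p \<in> box ((l $ j, l $ k), l $ i) ((u $ j, u $ k), u $ i)" for p
    proof -
      have "p \<in> vec3 j k -` box l u \<longleftrightarrow> (\<forall>n\<in>{i, j, k}. l $ n < vec3 j k p $ n \<and> vec3 j k p $ n < u $ n)"
        unfolding UNIV[symmetric] by (simp add: mem_box_cart)
      also have "\<dots> \<longleftrightarrow> p \<in> box ((l $ j, l $ k), l $ i) ((u $ j, u $ k), u $ i)"
        using distinct by (cases p) (auto simp: vec3_def box_def Basis_prod_def)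
      finally show ?thesis .
    qed
    then show ?thesis
      by blast
  qed
  then have "emeasure (distr lborel borel (vec3 j k)) (box l u)
      = emeasure lborel (box ((l $ j, l $ k), l $ i) ((u $ j, u $ k), u $ i))"
    by (subst emeasure_distr) auto
  also have "\<dots> = ennreal (\<Prod>b\<in>Basis. (((u $ j, u $ k), u $ i) - ((l $ j, l $ k), l $ i)) \<bullet> b)"
    using le' by (intro emeasure_lborel_box) (auto simp: Basis_prod_def)
  also have "(\<Prod>b\<in>Basis. (((u $ j, u $ k), u $ i) - ((l $ j, l $ k), l $ i)) \<bullet> b)
      = (\<Prod>n\<in>{i, j, k}. u $ n - l $ n)"
    using distinct by (simp add: Basis_prod_def prod.union_disjoint prod.reindex inj_on_def image_Un image_image)
  also have "\<dots> = (\<Prod>n\<in>UNIV. (u - l) $ n)"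
    by (simp add: UNIV)
  also have "\<dots> = (\<Prod>b\<in>Basis. (u - l) \<bullet> b)"
    by (simp add: Basis_vec_def UNION_singleton_eq_range prod.reindex inj_on_def axis_eq_axis inner_axis)
  finally show "emeasure (distr lborel borel (vec3 j k)) (box l u) = (\<Prod>b\<in>Basis. (u - l) \<bullet> b)" .
qed simp

lemma unit_uniform_triple:
  "(unit_uniform \<Otimes>\<^sub>M unit_uniform) \<Otimes>\<^sub>M unit_uniform = density lborel (indicator (cbox ((0, 0), 0) ((1, 1), 1)))"
proof -
  have sf: "sigma_finite_measure unit_uniform" "sigma_finite_measure (unit_uniform \<Otimes>\<^sub>M unit_uniform)"
    by unfold_locales
  have 2: "unit_uniform \<Otimes>\<^sub>M unit_uniform = density (lborel \<Otimes>\<^sub>M lborel) (\<lambda>(x, y). indicator {0..1} x * indicator {0..1} y)"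
    unfolding unit_uniform_def
    by (rule pair_measure_density) (use sf in \<open>auto simp: unit_uniform_def intro: lborel.sigma_finite_measure_axioms\<close>)
  have "(unit_uniform \<Otimes>\<^sub>M unit_uniform) \<Otimes>\<^sub>M unit_uniform
      = density ((lborel \<Otimes>\<^sub>M lborel) \<Otimes>\<^sub>M lborel)
          (\<lambda>(p, z). (case p of (x, y) \<Rightarrow> indicator {0..1} x * indicator {0..1} y) * indicator {0..1} z)"
    unfolding 2 unfolding unit_uniform_def
    by (rule pair_measure_density) (use sf in \<open>auto simp: unit_uniform_def intro: lborel.sigma_finite_measure_axioms\<close>)
  also have "\<dots> = density lborel (indicator (cbox ((0, 0), 0) ((1, 1), 1)))"
  proof -
    have "(case p of (x, y) \<Rightarrow> indicator {0..1} x * indicator {0..1} y) * indicator {0..1} z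
        = (indicator (cbox ((0, 0), 0) ((1, 1), 1)) (p, z) :: ennreal)" for p :: "real \<times> real" and z :: real
      by (cases p) (auto simp: indicator_def cbox_Pair_eq)
    then show ?thesis
      by (simp add: lborel_prod case_prod_unfold)
  qed
  finally show ?thesis .
qed

text \<open>The first two premises say that \<open>i\<close>, \<open>j\<close>, \<open>k\<close>
  enumerate the three indices, so the Mahler measure becomes an integral over nested pairs with the
  variable of index \<open>i\<close> last.\<close>

lemma mahler_measure_eqI:
  fixes P :: "(3, complex) laurent_poly"
  assumes UNIV: "UNIV = {i, j, k :: 3}" and distinct: "distinct [i, j, k]"
    and F: "\<And>p. ln (cmod (laurent_eval P (\<chi> n. exp (2 * of_real pi * \<i> * of_real (vec3 j k p $ n))))) = F p"
    and int: "has_bochner_integral ((unit_uniform \<Otimes>\<^sub>M unit_uniform) \<Otimes>\<^sub>M unit_uniform) F I"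
  shows "mahler_measure P = I"
proof -
  let ?F = "\<lambda>\<theta> :: real ^ 3. ln (cmod (laurent_eval P (\<chi> n. exp (2 * of_real pi * \<i> * of_real (\<theta> $ n)))))"
  have [measurable]: "?F \<in> borel_measurable borel"
    unfolding laurent_eval_def
    by (intro borel_measurable_ln borel_measurable_norm borel_measurable_sum borel_measurable_times
          borel_measurable_prod borel_measurable_const borel_measurable_continuous_onI) 
       (auto intro!: continuous_intros)
  have "mahler_measure P = (LINT \<theta>|lborel. indicator (cbox 0 1) \<theta> *\<^sub>R ?F \<theta>)"
    by (simp add: mahler_measure_def set_lebesgue_integral_def)
  also have "\<dots> = (LINT \<theta>|distr lborel borel (vec3 j k). indicator (cbox 0 1) \<theta> *\<^sub>R ?F \<theta>)"
    using lborel_vec3[OF UNIV distinct] by simp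
  also have "\<dots> = (LINT p|lborel. indicator (cbox 0 1) (vec3 j k p) *\<^sub>R ?F (vec3 j k p))"
    by (rule integral_distr) auto
  also have "\<dots> = (LINT p|lborel. indicator (cbox ((0, 0), 0) ((1, 1), 1)) p *\<^sub>R F p)"
  proof (intro Bochner_Integration.integral_cong refl)
    fix p :: "(real \<times> real) \<times> real"
    have "vec3 j k p \<in> cbox 0 1 \<longleftrightarrow> (\<forall>n\<in>{i, j, k}. 0 \<le> vec3 j k p $ n \<and> vec3 j k p $ n \<le> 1)"
      unfolding UNIV[symmetric] by (simp add: mem_box_cart)
    also have "\<dots> \<longleftrightarrow> p \<in> cbox ((0, 0), 0) ((1, 1), 1)"
      using distinct by (cases p) (auto simp: vec3_def cbox_Pair_eq)
    finally show "indicator (cbox 0 1) (vec3 j k p) *\<^sub>R ?F (vec3 j k p) = indicator (cbox ((0, 0), 0) ((1, 1), 1)) p *\<^sub>R F p"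
      by (simp add: indicator_def F)
  qed
  also have "\<dots> = integral\<^sup>L (density lborel (\<lambda>p. ennreal (indicator (cbox ((0, 0), 0) ((1, 1), 1)) p))) F"
  proof (rule integral_density[symmetric])
    have "(\<lambda>p. ?F (vec3 j k p)) \<in> borel_measurable borel"
      by measurable
    then show "F \<in> borel_measurable lborel"
      by (simp add: F)
  qed auto
  also have "\<dots> = I"
    using int unfolding unit_uniform_triple by (simp add: has_bochner_integral_iff ennreal_indicator)
  finally show ?thesis .
qed

section \<open>Jensen's formula on the unit circle\<close>

text \<open>Bridge from gauge to Lebesgue integrals: C - f is nonnegative on the interval and gauge
  integrable, hence absolutely integrable.\<close>

lemma has_bochner_integral_unit_uniform:
  fixes f :: "real \<Rightarrow> real"
  assumes f [measurable]: "f \<in> borel_measurable borel" 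
    and le: "\<And>t. t \<in> {0..1} \<Longrightarrow> f t \<le> C"
    and int: "(f has_integral I) {0..1}"
  shows "has_bochner_integral unit_uniform f I"
proof -
  have "(\<lambda>t. C - f t) integrable_on {0..1}"
    using int by (intro integrable_diff integrable_const_ivl) auto
  then have "(\<lambda>t. C - f t) absolutely_integrable_on {0..1}"
    using le by (intro nonnegative_absolutely_integrable_1) auto
  then have "(\<lambda>t. C - (C - f t)) absolutely_integrable_on {0..1}"
    by (rule set_integral_diff(1)[rotated]) (rule absolutely_integrable_on_const, simp)
  then have abs: "set_integrable lebesgue {0..1} f"
    by simp
  then have "integrable lebesgue (\<lambda>t. indicator {0..1} t *\<^sub>R f t)"
    by (simp add: set_integrable_def)
  then have i: "integrable lborel (\<lambda>t. indicator {0..1} t *\<^sub>R f t)"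
    by (subst (asm) integrable_completion) auto
  have "(LINT t|lborel. indicator {0..1} t *\<^sub>R f t) = (LINT t|lebesgue. indicator {0..1} t *\<^sub>R f t)"
    by (subst integral_completion) auto
  also have "\<dots> = I"
    using has_integral_set_lebesgue[OF abs] int unfolding set_lebesgue_integral_def
    by (rule has_integral_unique)
  finally have "has_bochner_integral lborel (\<lambda>t. indicator {0..1} t *\<^sub>R f t) I"
    using i by (simp add: has_bochner_integral_iff)
  then have "has_bochner_integral (density lborel (\<lambda>t. ennreal (indicator {0..1} t))) f I"
    by (intro has_bochner_integral_density) auto
  then show ?thesis
    by (simp add: unit_uniform_def ennreal_indicator)
qed

text \<open>The indicator supplies Borel measurability on the whole line for a function known to be
  continuous only on the interval.\<close>

lemma has_bochner_integral_unit_uniform_continuous: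
  fixes f :: "real \<Rightarrow> real"
  assumes f: "continuous_on {0..1} f" and int: "(f has_integral I) {0..1}"
  shows "has_bochner_integral unit_uniform (\<lambda>t. indicator {0..1} t * f t) I"
proof -
  have "compact (f ` {0..1})"
    by (intro compact_continuous_image f) auto
  then obtain C where C: "\<And>t. t \<in> {0..1} \<Longrightarrow> norm (f t) \<le> C"
    by (fastforce dest!: compact_imp_bounded simp: bounded_iff)
  show ?thesis
  proof (rule has_bochner_integral_unit_uniform)
    show "(\<lambda>t. indicator {0..1} t * f t) \<in> borel_measurable borel"
      using borel_measurable_continuous_on_indicator[OF _ f] by simp
    show "indicator {0..1} t * f t \<le> C" if "t \<in> {0..1}" for t
      using C[OF that] that by simp
    show "((\<lambda>t. indicator {0..1} t * f t) has_integral I) {0..1}"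
      using int by (rule has_integral_eq[rotated]) simp
  qed
qed

definition unit_circle :: "real \<Rightarrow> complex" where
  "unit_circle t = exp (2 * of_real pi * \<i> * of_real t)"

lemma unit_circle_eq_cis: "unit_circle t = cis (2 * pi * t)"
  by (simp add: unit_circle_def cis_conv_exp mult_ac)

lemma norm_unit_circle [simp]: "cmod (unit_circle t) = 1"
  by (simp add: unit_circle_eq_cis)

lemma unit_circle_nonzero [simp]: "unit_circle t \<noteq> 0"
  by (simp add: unit_circle_def)

lemma continuous_on_unit_circle [continuous_intros]: "continuous_on S unit_circle"
  unfolding unit_circle_def by (intro continuous_intros)

lemma unit_circle_measurable [measurable]: "unit_circle \<in> borel_measurable borel"
  by (intro borel_measurable_continuous_onI continuous_intros)

text \<open>Mean value property of Ln (1 + z u), read off from Cauchy's integral formula at the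
  centre, where the value is Ln 1 = 0. For |z| < 1 the argument has positive real part on the closed
  disc and avoids the branch cut.\<close>

lemma jensen_unit_circle_less_1:
  assumes z: "cmod z < 1"
  shows "((\<lambda>t. ln (cmod (1 + z * unit_circle t))) has_integral 0) {0..1}"
proof -
  have Re_pos: "0 < Re (1 + z * u)" if "u \<in> cball 0 1" for u
  proof -
    have "cmod (z * u) \<le> cmod z * 1"
      unfolding norm_mult using that by (intro mult_left_mono) (auto simp: dist_norm)
    then show ?thesis
      using z abs_Re_le_cmod[of "z * u"] by (simp del: times_complex.sel)
  qed
  have "(\<lambda>u. Ln (1 + z * u)) holomorphic_on cball 0 1"
  proof (intro holomorphic_intros)
    show "1 + z * u \<notin> \<real>\<^sub>\<le>\<^sub>0" if "u \<in> cball 0 1" for u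
      using Re_pos[OF that] by (auto simp: complex_nonpos_Reals_iff)
  qed
  then have "((\<lambda>u. Ln (1 + z * u) / (u - 0)) has_contour_integral 2 * of_real pi * \<i> * Ln (1 + z * 0)) (circlepath 0 1)"
    by (rule Cauchy_integral_circlepath_simple) simp
  then have int: "((\<lambda>t. Ln (1 + z * circlepath 0 1 t) / (circlepath 0 1 t - 0) *
      vector_derivative (circlepath 0 1) (at t)) has_integral 0) {0..1}"
    by (simp only: has_contour_integral mult_zero_right add_0_right Ln_1)
  have c: "circlepath 0 1 t = unit_circle t" for t
    by (simp add: circlepath unit_circle_def)
  have d: "vector_derivative (circlepath 0 1) (at t) = 2 * of_real pi * \<i> * unit_circle t" for t
    by (simp add: vector_derivative_circlepath unit_circle_def)
  have "((\<lambda>t. 2 * of_real pi * \<i> * Ln (1 + z * unit_circle t)) has_integral 0) {0..1}"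
    using int unfolding c d by (rule has_integral_eq[rotated]) simp
  from has_integral_mult_right[OF this, of "1 / (2 * of_real pi * \<i>)"]
  have "((\<lambda>t. Ln (1 + z * unit_circle t)) has_integral 0) {0..1}"
    by simp
  from has_integral_linear[OF this bounded_linear_Re]
  have "((\<lambda>t. Re (Ln (1 + z * unit_circle t))) has_integral 0) {0..1}"
    by (simp add: o_def)
  then show ?thesis
  proof (rule has_integral_eq[rotated])
    fix t :: real
    have "0 < Re (1 + z * unit_circle t)"
      by (rule Re_pos) simp
    then have "1 + z * unit_circle t \<noteq> 0"
      by (intro notI) (simp only: zero_complex.sel less_irrefl)
    then show "Re (Ln (1 + z * unit_circle t)) = ln (cmod (1 + z * unit_circle t))"
      by (rule Re_Ln)
  qed
qed

text \<open>The coefficient of larger modulus is factored out, which leaves the mean 0 case. Unequal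
  moduli keep \<open>p + q * unit_circle t\<close> away from 0.\<close>

lemma jensen_unit_circle:
  assumes "cmod p \<noteq> cmod q"
  shows "has_bochner_integral unit_uniform (\<lambda>t. ln (cmod (p + q * unit_circle t))) (ln (max (cmod p) (cmod q)))"
proof (rule has_bochner_integral_unit_uniform)
  show "ln (cmod (p + q * unit_circle t)) \<le> ln (cmod p + cmod q)" for t
  proof -
    have "cmod (p + q * unit_circle t) \<le> cmod p + cmod q"
      using norm_triangle_ineq[of p "q * unit_circle t"] by (simp add: norm_mult)
    moreover have "cmod p - cmod q \<le> cmod (p + q * unit_circle t)" "cmod q - cmod p \<le> cmod (p + q * unit_circle t)"
      using norm_diff_ineq[of p "q * unit_circle t"] norm_diff_ineq[of "q * unit_circle t" p]
      by (simp_all add: norm_mult add.commute)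
    ultimately show ?thesis
      using assms by (intro ln_mono) linarith+
  qed
  show "((\<lambda>t. ln (cmod (p + q * unit_circle t))) has_integral ln (max (cmod p) (cmod q))) {0..1}"
  proof (cases "cmod q < cmod p")
    case True
    then have "0 < cmod p"
      using norm_ge_zero[of q] by linarith
    with True have z: "cmod (q / p) < 1" and p: "p \<noteq> 0"
      by (auto simp: norm_divide)
    have "((\<lambda>t. ln (cmod p) + ln (cmod (1 + q / p * unit_circle t))) has_integral (ln (cmod p) + 0)) {0..1}"
      using has_integral_const_real[of "ln (cmod p)" 0 1]
      by (intro has_integral_add jensen_unit_circle_less_1 z) simp
    moreover have "ln (cmod p) + ln (cmod (1 + q / p * unit_circle t)) = ln (cmod (p + q * unit_circle t))" for t
    proof -
      have "cmod (q / p * unit_circle t) < 1"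
        using z by (simp only: norm_mult norm_unit_circle mult_1_right)
      then have "1 + q / p * unit_circle t \<noteq> 0"
        by (metis add_eq_0_iff norm_minus_cancel norm_one order_less_irrefl)
      then have "ln (cmod p) + ln (cmod (1 + q / p * unit_circle t)) = ln (cmod (p * (1 + q / p * unit_circle t)))"
        using p by (simp add: norm_mult ln_mult_pos)
      also have "p * (1 + q / p * unit_circle t) = p + q * unit_circle t"
        using p by (simp add: field_simps)
      finally show ?thesis .
    qed
    ultimately show ?thesis
      using True by (simp add: max_def)
  next
    case False
    with assms have less: "cmod p < cmod q"
      by simp
    then have "0 < cmod q"
      using norm_ge_zero[of p] by linarith
    \<comment> \<open>For |u| = 1 one has p + q u = q u (1 + (p/q) cnj u), and the modulus of the
      bracket is unchanged by conjugation. This brings the second case into the form of the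
      first.\<close>
    with less have z: "cmod (cnj (p / q)) < 1" and q: "q \<noteq> 0"
      by (auto simp: norm_divide)
    have "((\<lambda>t. ln (cmod q) + ln (cmod (1 + cnj (p / q) * unit_circle t))) has_integral (ln (cmod q) + 0)) {0..1}"
      using has_integral_const_real[of "ln (cmod q)" 0 1]
      by (intro has_integral_add jensen_unit_circle_less_1 z) simp
    moreover have "ln (cmod q) + ln (cmod (1 + cnj (p / q) * unit_circle t)) = ln (cmod (p + q * unit_circle t))" for t
    proof -
      have "cmod (cnj (p / q) * unit_circle t) < 1"
        using z by (simp only: norm_mult norm_unit_circle mult_1_right)
      then have "1 + cnj (p / q) * unit_circle t \<noteq> 0"
        by (metis add_eq_0_iff norm_minus_cancel norm_one order_less_irrefl)
      then have "ln (cmod q) + ln (cmod (1 + cnj (p / q) * unit_circle t)) = ln (cmod (q * unit_circle t) * cmod (cnj (1 + cnj (p / q) * unit_circle t)))"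
        using q by (simp add: norm_mult ln_mult_pos del: complex_cnj_add complex_cnj_mult)
      also have "cmod (q * unit_circle t) * cmod (cnj (1 + cnj (p / q) * unit_circle t)) = cmod (p + q * unit_circle t)"
      proof -
        have "unit_circle t * cnj (unit_circle t) = 1"
          by (simp add: complex_norm_square[symmetric])
        then have "q * unit_circle t * cnj (1 + cnj (p / q) * unit_circle t) = p + q * unit_circle t"
          using q by (simp add: field_simps)
        then show ?thesis
          by (metis norm_mult)
      qed
      finally show ?thesis .
    qed
    ultimately show ?thesis
      using False by (simp add: max_def)
  qed
qed measurable

text \<open>With x = pi t, a cos x + i b sin x = q cis x + p cis (-x) for p = (a - b)/2 and q = (a +
  b)/2. Multiplying by cis x shows that the argument of the logarithm is the squared modulus of p +
  q cis (2x), and q dominates p for positive a and b.\<close>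

lemma jensen_cos_sin:
  fixes a b :: real
  assumes "0 < a" "0 < b"
  shows "has_bochner_integral unit_uniform (\<lambda>t. ln (a\<^sup>2 * (cos (pi * t))\<^sup>2 + b\<^sup>2 * (sin (pi * t))\<^sup>2)) (2 * ln ((a + b) / 2))"
proof -
  define p q where "p = (a - b) / 2" and "q = (a + b) / 2"
  have less: "\<bar>p\<bar> < \<bar>q\<bar>"
  proof -
    have "\<bar>a - b\<bar> < \<bar>a + b\<bar>"
      using assms by linarith
    then show ?thesis
      by (simp add: p_def q_def)
  qed
  have "has_bochner_integral unit_uniform
      (\<lambda>t. 2 * ln (cmod (of_real p + of_real q * unit_circle t))) (2 * ln (max (cmod (of_real p)) (cmod (of_real q))))"
    using less by (intro has_bochner_integral_mult_right jensen_unit_circle) simp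
  also have "max (cmod (of_real p)) (cmod (of_real q)) = (a + b) / 2"
    using less assms unfolding norm_of_real by (simp add: max_def q_def)
  also have "(\<lambda>t. 2 * ln (cmod (of_real p + of_real q * unit_circle t)))
      = (\<lambda>t. ln (a\<^sup>2 * (cos (pi * t))\<^sup>2 + b\<^sup>2 * (sin (pi * t))\<^sup>2))"
  proof
    fix t
    have "(cmod (of_real p + of_real q * unit_circle t))\<^sup>2 = (p + q * cos (2 * (pi * t)))\<^sup>2 + (q * sin (2 * (pi * t)))\<^sup>2"
      by (simp add: cmod_power2 unit_circle_eq_cis mult_ac)
    also have "\<dots> = p\<^sup>2 + q\<^sup>2 * ((cos (2 * (pi * t)))\<^sup>2 + (sin (2 * (pi * t)))\<^sup>2) + 2 * p * q * cos (2 * (pi * t))"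
      by algebra
    also have "\<dots> = p\<^sup>2 + q\<^sup>2 + 2 * p * q * (2 * (cos (pi * t))\<^sup>2 - 1)"
      unfolding sin_cos_squared_add2 by (simp add: cos_double_cos)
    also have "\<dots> = a\<^sup>2 * (cos (pi * t))\<^sup>2 + b\<^sup>2 * (sin (pi * t))\<^sup>2"
      unfolding sin_squared_eq p_def q_def by (simp add: power2_eq_square field_simps)
    finally have sq: "(cmod (of_real p + of_real q * unit_circle t))\<^sup>2 = a\<^sup>2 * (cos (pi * t))\<^sup>2 + b\<^sup>2 * (sin (pi * t))\<^sup>2" .
    have "cmod (of_real p + of_real q * unit_circle t) \<noteq> 0"
    proof
      assume "cmod (of_real p + of_real q * unit_circle t) = 0"
      then have "of_real p = - (of_real q * unit_circle t)"
        by (simp add: add_eq_0_iff2)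
      then have "cmod (of_real p) = cmod (of_real q)"
        by (simp add: norm_mult)
      with less show False
        by simp
    qed
    then show "2 * ln (cmod (of_real p + of_real q * unit_circle t)) = ln (a\<^sup>2 * (cos (pi * t))\<^sup>2 + b\<^sup>2 * (sin (pi * t))\<^sup>2)"
      unfolding sq[symmetric] by (subst ln_realpow) auto
  qed
  finally show ?thesis .
qed

section \<open>Means over the unit square\<close>

lemma has_integral_unit_interval_scale:
  fixes f :: "real \<Rightarrow> real"
  assumes "(f has_integral I) {0..pi / 2}"
  shows "((\<lambda>t. f (pi / 2 * t)) has_integral (2 / pi * I)) {0..1}"
proof -
  have "((\<lambda>t. f (pi / 2 * t)) has_integral (1 / \<bar>pi / 2\<bar>) *\<^sub>R I) ((\<lambda>x. x / (pi / 2)) ` {0..pi / 2})"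
    using assms by (rule has_integral_stretch_real) simp
  also have "(\<lambda>x. x / (pi / 2)) ` {0..pi / 2} = {0..1}"
    by (subst image_divide_atLeastAtMost) auto
  finally show ?thesis
    by simp
qed

lemma has_integral_unit_interval_scale_reflect:
  fixes f :: "real \<Rightarrow> real"
  assumes "(f has_integral I) {0..pi / 2}"
  shows "((\<lambda>t. f (pi / 2 - pi / 2 * t)) has_integral (2 / pi * I)) {0..1}"
proof -
  have "((\<lambda>x. f (pi / 2 - x)) has_integral I) {0..pi / 2}"
    using has_integral_reflect_about[OF assms, of "pi / 2"] by simp
  then show ?thesis
    by (rule has_integral_unit_interval_scale)
qed

lemma half_pi_mult_mem: "t \<in> {0..1} \<Longrightarrow> pi / 2 * t \<in> {0..pi / 2}"
  using mult_left_le[of t "pi / 2"] by auto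

lemmas has_bochner_integral_pair_unit_uniform =
  has_bochner_integral_pair_bounded_above[OF unit_uniform.finite_measure_axioms unit_uniform.finite_measure_axioms]

lemma AE_unit_uniform_in: "AE t in unit_uniform. t \<in> {0..1}"
  by (rule AE_unit_uniform) simp

lemma AE_unit_uniform_pair_finite:
  assumes A: "finite A"
    and P: "\<And>a b. a \<in> {0..1} - A \<Longrightarrow> b \<in> {0..1} - A \<Longrightarrow> P (a, b)"
  shows "AE p in unit_uniform \<Otimes>\<^sub>M unit_uniform. P p"
proof -
  interpret pair_sigma_finite unit_uniform unit_uniform ..
  have [measurable]: "A \<in> sets borel"
    using A by (rule borel_closed[OF finite_imp_closed])
  have "AE p in unit_uniform \<Otimes>\<^sub>M unit_uniform. fst p \<in> {0..1} - A \<and> snd p \<in> {0..1} - A"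
  proof (rule AE_pair_measure)
    have *: "AE t in unit_uniform. t \<in> {0..1} - A"
      by (rule AE_unit_uniform_finite[OF A]) auto
    then show "AE x in unit_uniform. AE y in unit_uniform. fst (x, y) \<in> {0..1} - A \<and> snd (x, y) \<in> {0..1} - A"
    proof eventually_elim
      case (elim x)
      show ?case
        using * by eventually_elim (use elim in simp)
    qed
  qed measurable
  then show ?thesis
    by eventually_elim (use P in \<open>metis prod.collapse\<close>)
qed

lemma has_bochner_integral_pair_ln_one_plus_sin_sin:
  "has_bochner_integral (unit_uniform \<Otimes>\<^sub>M unit_uniform)
     (\<lambda>(a, b). ln (1 + sin (pi / 2 * a) * sin (pi / 2 * b))) (14 / pi\<^sup>2 * zeta 3 - 2 * ln 2)"
proof (rule has_bochner_integral_pair_unit_uniform)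
  \<comment> \<open>The factor 2/pi comes from rescaling [0, pi/2] to [0, 1]; it occurs once more in
    the outer integral.\<close>
  let ?g = "\<lambda>a. indicator {0..1} a * (2 / pi * ln_sin_cos_integral (pi / 2 * a))"
  have le: "ln (1 + sin (pi / 2 * a) * sin (pi / 2 * b)) \<le> ln 2" if "a \<in> {0..1}" "b \<in> {0..1}" for a b
  proof -
    have "pi / 2 - pi / 2 * b \<in> {0..pi / 2}"
      using half_pi_mult_mem[OF that(2)] by auto
    from sin_cos_nonneg[OF half_pi_mult_mem[OF that(1)] this]
    have "0 \<le> sin (pi / 2 * a) * sin (pi / 2 * b)"
      by (simp add: cos_diff)
    moreover have "\<bar>sin (pi / 2 * a) * sin (pi / 2 * b)\<bar> \<le> 1 * 1"
      unfolding abs_mult by (intro mult_mono) auto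
    ultimately show ?thesis
      by (intro ln_mono) auto
  qed
  show "AE a in unit_uniform. AE b in unit_uniform.
      (case (a, b) of (a, b) \<Rightarrow> ln (1 + sin (pi / 2 * a) * sin (pi / 2 * b))) \<le> ln 2"
    using AE_unit_uniform_in
  proof eventually_elim
    case (elim a)
    show ?case
      using AE_unit_uniform_in by eventually_elim (use le elim in simp)
  qed
  show "AE a in unit_uniform. has_bochner_integral unit_uniform
      (\<lambda>b. case (a, b) of (a, b) \<Rightarrow> ln (1 + sin (pi / 2 * a) * sin (pi / 2 * b))) (?g a)"
    using AE_unit_uniform_in
  proof eventually_elim
    case (elim a)
    have "1 + sin (pi / 2 * a) * cos u \<noteq> 0" if "u \<in> {0..pi / 2}" for u
      using sin_cos_nonneg[OF half_pi_mult_mem[OF elim] that] by simp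
    then have "(\<lambda>u. ln (1 + sin (pi / 2 * a) * cos u)) integrable_on {0..pi / 2}"
      by (intro integrable_continuous_real continuous_intros) auto
    then have "((\<lambda>u. ln (1 + sin (pi / 2 * a) * cos u)) has_integral ln_sin_cos_integral (pi / 2 * a)) {0..pi / 2}"
      unfolding ln_sin_cos_integral_def by (rule integrable_integral)
    from has_integral_unit_interval_scale_reflect[OF this]
    have "((\<lambda>b. ln (1 + sin (pi / 2 * a) * sin (pi / 2 * b))) has_integral ?g a) {0..1}"
      using elim by (simp add: cos_diff)
    moreover have "(\<lambda>b. ln (1 + sin (pi / 2 * a) * sin (pi / 2 * b))) \<in> borel_measurable borel"
      by measurable
    ultimately have "has_bochner_integral unit_uniform (\<lambda>b. ln (1 + sin (pi / 2 * a) * sin (pi / 2 * b))) (?g a)"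
      by (intro has_bochner_integral_unit_uniform[where C = "ln 2"] le elim)
    then show ?case
      by simp
  qed
  have "has_bochner_integral unit_uniform ?g (2 / pi * (2 / pi * (7 / 2 * zeta 3 - pi\<^sup>2 / 2 * ln 2)))"
  proof (rule has_bochner_integral_unit_uniform_continuous)
    have "continuous_on {0..pi / 2} ln_sin_cos_integral"
      using ln_sin_cos_integral_deriv by (rule DERIV_continuous_on)
    then have "continuous_on {0..1} (\<lambda>a. ln_sin_cos_integral (pi / 2 * a))"
      by (rule continuous_on_compose2) (auto intro!: continuous_intros half_pi_mult_mem[unfolded atLeastAtMost_iff, THEN conjunct2] mult_left_le)
    then show "continuous_on {0..1} (\<lambda>a. 2 / pi * ln_sin_cos_integral (pi / 2 * a))"
      by (intro continuous_intros)
    show "((\<lambda>a. 2 / pi * ln_sin_cos_integral (pi / 2 * a)) has_integral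
        2 / pi * (2 / pi * (7 / 2 * zeta 3 - pi\<^sup>2 / 2 * ln 2))) {0..1}"
      by (intro has_integral_mult_right has_integral_unit_interval_scale has_integral_ln_sin_cos_integral)
  qed
  also have "2 / pi * (2 / pi * (7 / 2 * zeta 3 - pi\<^sup>2 / 2 * ln 2)) = 14 / pi\<^sup>2 * zeta 3 - 2 * ln 2"
    by (simp add: field_simps power2_eq_square)
  finally show "has_bochner_integral unit_uniform ?g (14 / pi\<^sup>2 * zeta 3 - 2 * ln 2)" .
qed measurable

lemma has_bochner_integral_pair_ln_sin_add_sin:
  "has_bochner_integral (unit_uniform \<Otimes>\<^sub>M unit_uniform)
     (\<lambda>(a, b). ln (sin (pi / 2 * a) + sin (pi / 2 * b))) (7 / pi\<^sup>2 * zeta 3 - ln 2)"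
proof (rule has_bochner_integral_pair_unit_uniform)
  let ?g = "\<lambda>a. indicator {0..1} a * (2 / pi * ln_sin_add_sin_integral (pi / 2 * a))"
  have le: "ln (sin (pi / 2 * a) + sin (pi / 2 * b)) \<le> ln 2" if "a \<in> {0..1}" "b \<in> {0..1}" for a b
  proof (cases "0 < a \<or> 0 < b")
    case True
    then have "0 < sin (pi / 2 * a) + sin (pi / 2 * b)"
      using that by (intro sin_add_sin_pos half_pi_mult_mem) auto
    moreover have "sin (pi / 2 * a) + sin (pi / 2 * b) \<le> 1 + 1"
      by (intro add_mono) auto
    ultimately show ?thesis
      by (intro ln_mono) auto
  next
    case False
    \<comment> \<open>At this corner the argument is 0, and the convention ln 0 = 0 respects the
      bound.\<close>
    then have "a = 0" "b = 0"
      using that by auto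
    then show ?thesis
      by simp
  qed
  show "AE a in unit_uniform. AE b in unit_uniform.
      (case (a, b) of (a, b) \<Rightarrow> ln (sin (pi / 2 * a) + sin (pi / 2 * b))) \<le> ln 2"
    using AE_unit_uniform_in
  proof eventually_elim
    case (elim a)
    show ?case
      using AE_unit_uniform_in by eventually_elim (use le elim in simp)
  qed
  show "AE a in unit_uniform. has_bochner_integral unit_uniform
      (\<lambda>b. case (a, b) of (a, b) \<Rightarrow> ln (sin (pi / 2 * a) + sin (pi / 2 * b))) (?g a)"
    using AE_unit_uniform_in
  proof eventually_elim
    case (elim a)
    have "((\<lambda>u. ln (sin u + sin (pi / 2 * a))) has_integral ln_sin_add_sin_integral (pi / 2 * a)) {0..pi / 2}"
      unfolding ln_sin_add_sin_integral_def
      by (intro integrable_integral integrable_ln_sin_add_sin half_pi_mult_mem elim)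
    from has_integral_unit_interval_scale[OF this]
    have "((\<lambda>b. ln (sin (pi / 2 * a) + sin (pi / 2 * b))) has_integral ?g a) {0..1}"
      using elim by (simp add: add.commute)
    moreover have "(\<lambda>b. ln (sin (pi / 2 * a) + sin (pi / 2 * b))) \<in> borel_measurable borel"
      by measurable
    ultimately have "has_bochner_integral unit_uniform (\<lambda>b. ln (sin (pi / 2 * a) + sin (pi / 2 * b))) (?g a)"
      by (intro has_bochner_integral_unit_uniform[where C = "ln 2"] le elim)
    then show ?case
      by simp
  qed
  have "has_bochner_integral unit_uniform ?g (2 / pi * (2 / pi * (7 / 4 * zeta 3 - pi\<^sup>2 / 4 * ln 2)))"
  proof (rule has_bochner_integral_unit_uniform_continuous)
    have "continuous_on {0..1} (\<lambda>a. ln_sin_add_sin_integral (pi / 2 * a))"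
      using continuous_on_ln_sin_add_sin_integral
      by (rule continuous_on_compose2) (auto intro!: continuous_intros half_pi_mult_mem[unfolded atLeastAtMost_iff, THEN conjunct2] mult_left_le)
    then show "continuous_on {0..1} (\<lambda>a. 2 / pi * ln_sin_add_sin_integral (pi / 2 * a))"
      by (intro continuous_intros)
    show "((\<lambda>a. 2 / pi * ln_sin_add_sin_integral (pi / 2 * a)) has_integral
        2 / pi * (2 / pi * (7 / 4 * zeta 3 - pi\<^sup>2 / 4 * ln 2))) {0..1}"
      by (intro has_integral_mult_right has_integral_unit_interval_scale has_integral_ln_sin_add_sin_integral)
  qed
  also have "2 / pi * (2 / pi * (7 / 4 * zeta 3 - pi\<^sup>2 / 4 * ln 2)) = 7 / pi\<^sup>2 * zeta 3 - ln 2"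
    by (simp add: field_simps power2_eq_square)
  finally show "has_bochner_integral unit_uniform ?g (7 / pi\<^sup>2 * zeta 3 - ln 2)" .
qed measurable

lemma has_bochner_integral_ln_one_plus_sin:
  "has_bochner_integral unit_uniform (\<lambda>t. ln (1 + sin (pi / 2 * t))) (4 / pi * catalan_const - ln 2)"
proof (rule has_bochner_integral_unit_uniform)
  show "ln (1 + sin (pi / 2 * t)) \<le> ln 2" if "t \<in> {0..1}" for t
  proof -
    have "0 \<le> sin (pi / 2 * t)"
      using half_pi_mult_mem[OF that] by (intro sin_ge_zero) (auto intro: order_trans)
    then show ?thesis
      by (intro ln_mono) auto
  qed
  have "((\<lambda>t. ln (1 + cos (pi / 2 - pi / 2 * t))) has_integral (2 / pi * (2 * catalan_const - pi / 2 * ln 2))) {0..1}"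
    by (rule has_integral_unit_interval_scale_reflect[OF has_integral_ln_one_plus_cos_0_pi_half])
  moreover have "cos (pi / 2 - pi / 2 * t) = sin (pi / 2 * t)" for t
    by (simp add: cos_diff)
  moreover have "2 / pi * (2 * catalan_const - pi / 2 * ln 2) = 4 / pi * catalan_const - ln 2"
    by (simp add: field_simps)
  ultimately show "((\<lambda>t. ln (1 + sin (pi / 2 * t))) has_integral (4 / pi * catalan_const - ln 2)) {0..1}"
    by (simp only:)
qed measurable

section \<open>Unfolding quarter-period means to full-period means\<close>

lemma tent_mem: "t \<in> {0..1} \<Longrightarrow> tent t \<in> {0..1}"
  by (auto simp: tent_def abs_if)

text \<open>On the rising branch the angle is pi t, on the falling one pi - pi t. The folded angle
  lies in [0, pi/2], so both functions are nonnegative and equal the absolute values.\<close>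

lemma
  assumes "t \<in> {0..1}"
  shows sin_half_pi_tent: "sin (pi / 2 * tent t) = \<bar>sin (pi * t)\<bar>"
    and cos_half_pi_tent: "cos (pi / 2 * tent t) = \<bar>cos (pi * t)\<bar>"
proof -
  consider "t \<le> 1 / 2" | "1 / 2 < t"
    by linarith
  then have "sin (pi / 2 * tent t) = sin (pi * t) \<and> \<bar>cos (pi / 2 * tent t)\<bar> = \<bar>cos (pi * t)\<bar>"
  proof cases
    case 1
    then have "pi / 2 * tent t = pi * t"
      by (simp add: tent_def)
    then show ?thesis
      by simp
  next
    case 2
    then have "pi / 2 * tent t = pi - pi * t"
      by (simp add: tent_def field_simps)
    then show ?thesis
      by (simp only: sin_diff cos_diff) simp
  qed
  moreover have "0 \<le> pi / 2 * tent t" "pi / 2 * tent t \<le> pi / 2"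
    using half_pi_mult_mem[OF tent_mem[OF assms]] by auto
  then have "0 \<le> sin (pi / 2 * tent t)" "0 \<le> cos (pi / 2 * tent t)"
    using pi_gt_zero by (intro sin_ge_zero cos_ge_zero; linarith)+
  ultimately show "sin (pi / 2 * tent t) = \<bar>sin (pi * t)\<bar>" "cos (pi / 2 * tent t) = \<bar>cos (pi * t)\<bar>"
    by auto
qed

lemma
  shows abs_sin_pi_tent: "\<bar>sin (pi * tent t)\<bar> = \<bar>sin (2 * pi * t)\<bar>"
    and abs_cos_pi_tent: "\<bar>cos (pi * tent t)\<bar> = \<bar>cos (2 * pi * t)\<bar>"
proof -
  consider "t \<le> 1 / 2" | "1 / 2 < t"
    by linarith
  then have "\<bar>sin (pi * tent t)\<bar> = \<bar>sin (2 * pi * t)\<bar> \<and> \<bar>cos (pi * tent t)\<bar> = \<bar>cos (2 * pi * t)\<bar>"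
  proof cases
    case 1
    then have "pi * tent t = 2 * pi * t"
      by (simp add: tent_def)
    then show ?thesis
      by (simp only: simp_thms)
  next
    case 2
    then have "pi * tent t = 2 * pi - 2 * pi * t"
      by (simp add: tent_def field_simps)
    then show ?thesis
      by (simp only: sin_diff cos_diff) simp
  qed
  then show "\<bar>sin (pi * tent t)\<bar> = \<bar>sin (2 * pi * t)\<bar>" "\<bar>cos (pi * tent t)\<bar> = \<bar>cos (2 * pi * t)\<bar>"
    by auto
qed

text \<open>On [0, 1] the function |sin (2 pi t)| consists of four quarter arches, so a quarter
  period must be folded twice.\<close>

definition tent2 :: "real \<Rightarrow> real" where
  "tent2 t = tent (tent t)"

lemma tent2_measurable [measurable]: "tent2 \<in> borel_measurable borel"
  unfolding tent2_def[abs_def] by measurable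

lemma distr_unit_uniform_comp:
  assumes "distr unit_uniform unit_uniform h = unit_uniform" "h \<in> borel_measurable borel"
    and "distr unit_uniform unit_uniform k = unit_uniform" "k \<in> borel_measurable borel"
  shows "distr unit_uniform unit_uniform (\<lambda>t. h (k t)) = unit_uniform"
proof -
  have h: "h \<in> measurable unit_uniform unit_uniform" and k: "k \<in> measurable unit_uniform unit_uniform"
    unfolding measurable_cong_sets[OF sets_unit_uniform sets_unit_uniform] by (rule assms)+
  have "distr (distr unit_uniform unit_uniform k) unit_uniform h = distr unit_uniform unit_uniform (h \<circ> k)"
    by (rule distr_distr[OF h k])
  then show ?thesis
    unfolding assms(1,3) o_def by (rule sym)
qed

lemma distr_unit_uniform_tent2: "distr unit_uniform unit_uniform tent2 = unit_uniform"
  unfolding tent2_def[abs_def]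
  by (rule distr_unit_uniform_comp[OF distr_unit_uniform_tent tent_measurable
        distr_unit_uniform_tent tent_measurable])

lemma distr_unit_uniform_reflect_tent2: "distr unit_uniform unit_uniform (\<lambda>t. 1 - tent2 t) = unit_uniform"
  by (rule distr_unit_uniform_comp[OF distr_unit_uniform_reflect _ distr_unit_uniform_tent2 tent2_measurable]) measurable

lemma
  assumes "t \<in> {0..1}"
  shows sin_half_pi_tent2: "sin (pi / 2 * tent2 t) = \<bar>sin (2 * pi * t)\<bar>"
    and sin_half_pi_reflect_tent2: "sin (pi / 2 * (1 - tent2 t)) = \<bar>cos (2 * pi * t)\<bar>"
proof -
  show "sin (pi / 2 * tent2 t) = \<bar>sin (2 * pi * t)\<bar>"
    unfolding tent2_def using sin_half_pi_tent[OF tent_mem[OF assms]] abs_sin_pi_tent[of t] by simp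
  have "sin (pi / 2 * (1 - tent2 t)) = cos (pi / 2 * tent2 t)"
    by (simp add: right_diff_distrib sin_diff)
  then show "sin (pi / 2 * (1 - tent2 t)) = \<bar>cos (2 * pi * t)\<bar>"
    unfolding tent2_def using cos_half_pi_tent[OF tent_mem[OF assms]] abs_cos_pi_tent[of t] by simp
qed

text \<open>Both substitutions preserve the measure; composing the second one with t -> 1 - t
  changes the sine into a cosine. The trigonometric identities hold on [0, 1], hence almost
  everywhere.\<close>

lemma has_bochner_integral_pair_tent2:
  fixes f :: "real \<Rightarrow> real \<Rightarrow> real"
  assumes f: "has_bochner_integral (unit_uniform \<Otimes>\<^sub>M unit_uniform) (\<lambda>(a, b). f (sin (pi / 2 * a)) (sin (pi / 2 * b))) I"
    and meas [measurable]: "case_prod f \<in> borel_measurable borel"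
  shows "has_bochner_integral (unit_uniform \<Otimes>\<^sub>M unit_uniform) (\<lambda>(a, b). f \<bar>sin (2 * pi * a)\<bar> \<bar>sin (2 * pi * b)\<bar>) I"
    and "has_bochner_integral (unit_uniform \<Otimes>\<^sub>M unit_uniform) (\<lambda>(a, b). f \<bar>sin (2 * pi * a)\<bar> \<bar>cos (2 * pi * b)\<bar>) I"
proof -
  have *: "(\<lambda>p. f (g (fst p)) (h (snd p))) \<in> borel_measurable (unit_uniform \<Otimes>\<^sub>M unit_uniform)"
    if [measurable]: "g \<in> borel_measurable borel" "h \<in> borel_measurable borel" for g h
  proof -
    have "(\<lambda>p. case_prod f (g (fst p), h (snd p))) \<in> borel_measurable (unit_uniform \<Otimes>\<^sub>M unit_uniform)"
      by measurable
    then show ?thesis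
      by (simp only: prod.case)
  qed
  have meas_reflect: "(\<lambda>t. 1 - tent2 t) \<in> borel_measurable borel"
    by measurable
  have "has_bochner_integral (unit_uniform \<Otimes>\<^sub>M unit_uniform)
      (\<lambda>(a, b). f (sin (pi / 2 * tent2 a)) (sin (pi / 2 * tent2 b))) I"
    using has_bochner_integral_unit_uniform_pair_map[OF distr_unit_uniform_tent2 tent2_measurable
        distr_unit_uniform_tent2 tent2_measurable f] unfolding prod.case .
  then show "has_bochner_integral (unit_uniform \<Otimes>\<^sub>M unit_uniform) (\<lambda>(a, b). f \<bar>sin (2 * pi * a)\<bar> \<bar>sin (2 * pi * b)\<bar>) I"
  proof (rule has_bochner_integralI_AE)
    show "(\<lambda>(a, b). f \<bar>sin (2 * pi * a)\<bar> \<bar>sin (2 * pi * b)\<bar>) \<in> borel_measurable (unit_uniform \<Otimes>\<^sub>M unit_uniform)"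
      unfolding case_prod_unfold by (rule *) measurable
    show "AE p in unit_uniform \<Otimes>\<^sub>M unit_uniform. (case p of (a, b) \<Rightarrow> f (sin (pi / 2 * tent2 a)) (sin (pi / 2 * tent2 b)))
        = (case p of (a, b) \<Rightarrow> f \<bar>sin (2 * pi * a)\<bar> \<bar>sin (2 * pi * b)\<bar>)"
      by (rule AE_unit_uniform_pair_finite[of "{}"]) (simp_all only: prod.case sin_half_pi_tent2 finite.emptyI Diff_empty)
  qed
  have "has_bochner_integral (unit_uniform \<Otimes>\<^sub>M unit_uniform)
      (\<lambda>(a, b). f (sin (pi / 2 * tent2 a)) (sin (pi / 2 * (1 - tent2 b)))) I"
    using has_bochner_integral_unit_uniform_pair_map[OF distr_unit_uniform_tent2 tent2_measurable
        distr_unit_uniform_reflect_tent2 meas_reflect f] unfolding prod.case .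
  then show "has_bochner_integral (unit_uniform \<Otimes>\<^sub>M unit_uniform) (\<lambda>(a, b). f \<bar>sin (2 * pi * a)\<bar> \<bar>cos (2 * pi * b)\<bar>) I"
  proof (rule has_bochner_integralI_AE)
    show "(\<lambda>(a, b). f \<bar>sin (2 * pi * a)\<bar> \<bar>cos (2 * pi * b)\<bar>) \<in> borel_measurable (unit_uniform \<Otimes>\<^sub>M unit_uniform)"
      unfolding case_prod_unfold by (rule *) measurable
    show "AE p in unit_uniform \<Otimes>\<^sub>M unit_uniform. (case p of (a, b) \<Rightarrow> f (sin (pi / 2 * tent2 a)) (sin (pi / 2 * (1 - tent2 b))))
        = (case p of (a, b) \<Rightarrow> f \<bar>sin (2 * pi * a)\<bar> \<bar>cos (2 * pi * b)\<bar>)"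
      by (rule AE_unit_uniform_pair_finite[of "{}"])
         (simp_all only: prod.case sin_half_pi_tent2 sin_half_pi_reflect_tent2 finite.emptyI Diff_empty)
  qed
qed

abbreviation unit_square :: "(real \<times> real) measure" where
  "unit_square \<equiv> unit_uniform \<Otimes>\<^sub>M unit_uniform"

lemma has_bochner_integral_unit_square_const: "has_bochner_integral unit_square (\<lambda>_. c :: real) c"
proof -
  have "has_bochner_integral unit_uniform (\<lambda>_. c) c"
    by (simp add: has_bochner_integral_iff)
  then have "has_bochner_integral unit_square (\<lambda>_. c) c"
    by (intro has_bochner_integral_pair_unit_uniform[where C = c and g = "\<lambda>_. c"]) auto
  then show ?thesis .
qed

lemma has_bochner_integral_ln_one_plus_abs_sin_abs_sin:
  "has_bochner_integral unit_square (\<lambda>(a, b). ln (1 + \<bar>sin (2 * pi * a)\<bar> * \<bar>sin (2 * pi * b)\<bar>))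
     (14 / pi\<^sup>2 * zeta 3 - 2 * ln 2)"
  and has_bochner_integral_ln_one_plus_abs_sin_abs_cos:
  "has_bochner_integral unit_square (\<lambda>(a, b). ln (1 + \<bar>sin (2 * pi * a)\<bar> * \<bar>cos (2 * pi * b)\<bar>))
     (14 / pi\<^sup>2 * zeta 3 - 2 * ln 2)"
proof -
  have "case_prod (\<lambda>x y. ln (1 + x * y) :: real) \<in> borel_measurable borel"
    unfolding borel_prod[symmetric] by measurable
  note * = has_bochner_integral_pair_tent2[OF has_bochner_integral_pair_ln_one_plus_sin_sin this]
  show "has_bochner_integral unit_square (\<lambda>(a, b). ln (1 + \<bar>sin (2 * pi * a)\<bar> * \<bar>sin (2 * pi * b)\<bar>))
     (14 / pi\<^sup>2 * zeta 3 - 2 * ln 2)"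
    by (rule *(1))
  show "has_bochner_integral unit_square (\<lambda>(a, b). ln (1 + \<bar>sin (2 * pi * a)\<bar> * \<bar>cos (2 * pi * b)\<bar>))
     (14 / pi\<^sup>2 * zeta 3 - 2 * ln 2)"
    by (rule *(2))
qed

lemma has_bochner_integral_ln_abs_sin_add_abs_sin:
  "has_bochner_integral unit_square (\<lambda>(a, b). ln (\<bar>sin (2 * pi * a)\<bar> + \<bar>sin (2 * pi * b)\<bar>))
     (7 / pi\<^sup>2 * zeta 3 - ln 2)"
proof -
  have "case_prod (\<lambda>x y. ln (x + y) :: real) \<in> borel_measurable borel"
    unfolding borel_prod[symmetric] by measurable
  from has_bochner_integral_pair_tent2(1)[OF has_bochner_integral_pair_ln_sin_add_sin this] show ?thesis .
qed

lemma has_bochner_integral_ln_one_plus_abs_cos: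
  "has_bochner_integral unit_uniform (\<lambda>t. ln (1 + \<bar>cos (2 * pi * t)\<bar>)) (4 / pi * catalan_const - ln 2)"
proof -
  have "(\<lambda>t. 1 - tent2 t) \<in> measurable unit_uniform unit_uniform"
    unfolding measurable_cong_sets[OF sets_unit_uniform sets_unit_uniform] by measurable
  from has_bochner_integral_measure_preserving[OF distr_unit_uniform_reflect_tent2 this has_bochner_integral_ln_one_plus_sin]
  have "has_bochner_integral unit_uniform (\<lambda>t. ln (1 + sin (pi / 2 * (1 - tent2 t)))) (4 / pi * catalan_const - ln 2)" .
  then show ?thesis
  proof (rule has_bochner_integralI_AE)
    show "AE t in unit_uniform. ln (1 + sin (pi / 2 * (1 - tent2 t))) = ln (1 + \<bar>cos (2 * pi * t)\<bar>)"
      using AE_unit_uniform_in by eventually_elim (simp only: sin_half_pi_reflect_tent2)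
  qed measurable
qed

text \<open>The reflection a -> 1 - a changes s = sin (2 pi a) sin (2 pi b) into -s, and ln (max 1
  (1 + s)) + ln (max 1 (1 - s)) = ln (1 + |s|). So the mean is half of that of ln (1 + |s|), which
  also dominates the integrand.\<close>

lemma has_bochner_integral_ln_one_plus_pos_part_sin_sin:
  "has_bochner_integral unit_square (\<lambda>(a, b). ln (max 1 (1 + sin (2 * pi * a) * sin (2 * pi * b))))
     (7 / pi\<^sup>2 * zeta 3 - ln 2)"
proof -
  let ?G = "\<lambda>(a, b). ln (1 + \<bar>sin (2 * pi * a)\<bar> * \<bar>sin (2 * pi * b)\<bar>)"
  let ?F = "\<lambda>(a, b). ln (max 1 (1 + sin (2 * pi * a) * sin (2 * pi * b)))"
  let ?E = "14 / pi\<^sup>2 * zeta 3 - 2 * ln 2"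
  have meas: "?F \<in> borel_measurable unit_square"
    by measurable
  have "integrable unit_square ?F"
  proof (rule Bochner_Integration.integrable_bound)
    show "integrable unit_square ?G"
      using has_bochner_integral_ln_one_plus_abs_sin_abs_sin by (rule integrable.intros)
    have "norm (?F (a, b)) \<le> norm (?G (a, b))" for a b
    proof -
      define s where "s = sin (2 * pi * a) * sin (2 * pi * b)"
      have "\<bar>s\<bar> = \<bar>sin (2 * pi * a)\<bar> * \<bar>sin (2 * pi * b)\<bar>"
        by (simp add: s_def abs_mult)
      moreover have "0 \<le> ln (max 1 (1 + s))" "ln (max 1 (1 + s)) \<le> ln (1 + \<bar>s\<bar>)"
        by (auto intro!: ln_mono)
      ultimately show ?thesis
        by (simp add: s_def)
    qed
    then show "AE p in unit_square. norm (?F p) \<le> norm (?G p)"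
      by (intro AE_I2) (simp add: split_paired_all)
  qed (rule meas)
  then obtain I where I: "has_bochner_integral unit_square ?F I"
    by (auto elim: integrable.cases)
  have "has_bochner_integral unit_square (\<lambda>(a, b). ?F (1 - a, id b)) I"
  proof (rule has_bochner_integral_unit_uniform_pair_map[OF distr_unit_uniform_reflect _ _ _ I])
    show "distr unit_uniform unit_uniform id = unit_uniform"
      by (simp add: id_def)
  qed measurable
  then have "has_bochner_integral unit_square (\<lambda>p. ?F p + (case p of (a, b) \<Rightarrow> ?F (1 - a, id b))) (I + I)"
    using I by (intro has_bochner_integral_add)
  also have "(\<lambda>p. ?F p + (case p of (a, b) \<Rightarrow> ?F (1 - a, id b))) = ?G"
  proof
    fix p :: "real \<times> real"
    obtain a b where p: "p = (a, b)"
      by (cases p)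
    define s where "s = sin (2 * pi * a) * sin (2 * pi * b)"
    have 1: "sin (2 * pi * (1 - a)) = - sin (2 * pi * a)"
      by (simp add: right_diff_distrib sin_diff)
    have "ln (max 1 (1 + s)) + ln (max 1 (1 - s)) = ln (1 + \<bar>s\<bar>)"
      by (cases "0 \<le> s") (simp_all add: max_def)
    moreover have "\<bar>s\<bar> = \<bar>sin (2 * pi * a)\<bar> * \<bar>sin (2 * pi * b)\<bar>"
      by (simp add: s_def abs_mult)
    ultimately show "?F p + (case p of (a, b) \<Rightarrow> ?F (1 - a, id b)) = ?G p"
      by (simp only: p prod.case id_apply 1 mult_minus_left s_def[symmetric] add_uminus_conv_diff)
  qed
  finally have "I + I = ?E"
    using has_bochner_integral_ln_one_plus_abs_sin_abs_sin by (rule has_bochner_integral_eq)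
  then have "I = 7 / pi\<^sup>2 * zeta 3 - ln 2"
    by simp
  with I show ?thesis
    by simp
qed

text \<open>One fold by the tent map doubles the frequency, since squares of sine and cosine do not
  see signs.\<close>

lemma jensen_cos_sin_2pi:
  fixes a b :: real
  assumes "0 < a" "0 < b"
  shows "has_bochner_integral unit_uniform (\<lambda>t. ln (a\<^sup>2 * (cos (2 * pi * t))\<^sup>2 + b\<^sup>2 * (sin (2 * pi * t))\<^sup>2)) (2 * ln ((a + b) / 2))"
proof -
  have "tent \<in> measurable unit_uniform unit_uniform"
    unfolding measurable_cong_sets[OF sets_unit_uniform sets_unit_uniform] by measurable
  from has_bochner_integral_measure_preserving[OF distr_unit_uniform_tent this jensen_cos_sin[OF assms]]
  have "has_bochner_integral unit_uniform (\<lambda>t. ln (a\<^sup>2 * (cos (pi * tent t))\<^sup>2 + b\<^sup>2 * (sin (pi * tent t))\<^sup>2)) (2 * ln ((a + b) / 2))" .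
  moreover have "(cos (pi * tent t))\<^sup>2 = (cos (2 * pi * t))\<^sup>2" "(sin (pi * tent t))\<^sup>2 = (sin (2 * pi * t))\<^sup>2" for t
    by (metis abs_cos_pi_tent power2_abs) (metis abs_sin_pi_tent power2_abs)
  ultimately show ?thesis
    by (simp only:)
qed

text \<open>The zeros in [0, 1] of sin (2 pi t) and of cos (2 pi t) together.\<close>

definition zeros_sin_cos :: "real set" where
  "zeros_sin_cos = {0, 1 / 4, 1 / 2, 3 / 4, 1}"

lemma
  assumes "t \<in> {0..1} - zeros_sin_cos"
  shows sin_2pi_nonzero: "sin (2 * pi * t) \<noteq> 0" and cos_2pi_nonzero: "cos (2 * pi * t) \<noteq> 0"
proof -
  show "sin (2 * pi * t) \<noteq> 0"
  proof
    assume "sin (2 * pi * t) = 0"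
    then obtain n :: int where "2 * pi * t = of_int n * pi"
      by (auto simp: sin_zero_iff_int2)
    then have n: "2 * t = of_int n"
      by simp
    with assms have "of_int 0 \<le> (of_int n :: real)" "(of_int n :: real) \<le> of_int 2"
      by auto
    then have "n \<in> {0, 1, 2}"
      unfolding of_int_le_iff by auto
    with n have "t \<in> {0, 1 / 2, 1}"
      by auto
    with assms show False
      by (auto simp: zeros_sin_cos_def)
  qed
  show "cos (2 * pi * t) \<noteq> 0"
  proof
    assume "cos (2 * pi * t) = 0"
    then obtain n :: int where "odd n" "2 * pi * t = of_int n * (pi / 2)"
      by (auto simp: cos_zero_iff_int)
    then have n: "4 * t = of_int n"
      by simp
    with assms have "of_int 0 \<le> (of_int n :: real)" "(of_int n :: real) \<le> of_int 4"
      by auto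
    then have "n \<in> {0, 1, 2, 3, 4}"
      unfolding of_int_le_iff by auto
    with n \<open>odd n\<close> have "t \<in> {1 / 4, 3 / 4}"
      by auto
    with assms show False
      by (auto simp: zeros_sin_cos_def)
  qed
qed

lemma AE_unit_uniform_generic: "AE t in unit_uniform. t \<in> {0..1} - zeros_sin_cos"
  by (rule AE_unit_uniform_finite[of zeros_sin_cos]) (auto simp: zeros_sin_cos_def)

lemma AE_unit_square_generic:
  assumes "\<And>a b. a \<in> {0..1} - zeros_sin_cos \<Longrightarrow> b \<in> {0..1} - zeros_sin_cos \<Longrightarrow> P (a, b)"
  shows "AE p in unit_square. P p"
  by (rule AE_unit_uniform_pair_finite[of zeros_sin_cos]) (use assms in \<open>auto simp: zeros_sin_cos_def\<close>)

text \<open>On the torus the fourth polynomial is \<open>16 ((1 + y)\<^sup>2 A\<^sup>2 - cos\<^sup>2 v)\<close> with \<open>A\<close> as follows.\<close>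

definition hyp :: "real \<Rightarrow> real \<Rightarrow> real" where
  "hyp a c = sqrt ((cos (2 * pi * c))\<^sup>2 + (sin (2 * pi * c))\<^sup>2 * (sin (2 * pi * a))\<^sup>2)"

lemma hyp_squared: "(hyp a c)\<^sup>2 = (cos (2 * pi * c))\<^sup>2 + (sin (2 * pi * c))\<^sup>2 * (sin (2 * pi * a))\<^sup>2"
  by (simp add: hyp_def)

text \<open>The form in which the square emerges as the coefficient of (1 + y)^2 in the fourth
  polynomial; it also shows at once that \<open>hyp\<close> is at most 1.\<close>

lemma hyp_squared': "(hyp a c)\<^sup>2 = 1 - (sin (2 * pi * c))\<^sup>2 * (cos (2 * pi * a))\<^sup>2"
  unfolding hyp_squared cos_squared_eq by (simp add: algebra_simps)

lemma abs_cos_le_hyp: "\<bar>cos (2 * pi * c)\<bar> \<le> hyp a c"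
  unfolding hyp_def by (rule real_le_rsqrt) simp

lemma hyp_le_1: "hyp a c \<le> 1"
  by (rule power2_le_imp_le) (simp_all add: hyp_squared')

lemma hyp_measurable [measurable]:
  "(\<lambda>p. hyp (f p) (g p)) \<in> borel_measurable M"
  if [measurable]: "f \<in> borel_measurable M" "g \<in> borel_measurable M"
  unfolding hyp_def by measurable

text \<open>For fixed \<open>c\<close> the square of \<open>hyp a c\<close> is cos^2 (2 pi c) cos^2
  (2 pi a) + sin^2 (2 pi a), so Jensen's formula in \<open>a\<close> yields ln ((1 + |cos (2 pi
  c)|)/2). The pair is taken as \<open>(c, a)\<close> and swapped at the end, because
  \<open>a\<close> is integrated first.\<close>

lemma has_bochner_integral_ln_hyp:
  "has_bochner_integral unit_square (\<lambda>(a, c). ln (hyp a c)) (4 / pi * catalan_const - 2 * ln 2)"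
proof -
  have "has_bochner_integral unit_square (\<lambda>(c, a). ln (hyp a c)) (4 / pi * catalan_const - ln 2 - ln 2)"
  proof (rule has_bochner_integral_pair_unit_uniform)
    show "AE c in unit_uniform. AE a in unit_uniform. (case (c, a) of (c, a) \<Rightarrow> ln (hyp a c)) \<le> 0"
      using AE_unit_uniform_generic
    proof eventually_elim
      case (elim c)
      have "0 < hyp a c" for a
        using cos_2pi_nonzero[OF elim] abs_cos_le_hyp[of c a] by linarith
      then show ?case
        by (intro AE_I2) (simp add: hyp_le_1)
    qed
    show "AE c in unit_uniform. has_bochner_integral unit_uniform
        (\<lambda>a. case (c, a) of (c, a) \<Rightarrow> ln (hyp a c)) (ln (1 + \<bar>cos (2 * pi * c)\<bar>) - ln 2)"
      using AE_unit_uniform_generic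
    proof eventually_elim
      case (elim c)
      then have pos: "0 < \<bar>cos (2 * pi * c)\<bar>"
        by (simp add: cos_2pi_nonzero)
      have "has_bochner_integral unit_uniform
          (\<lambda>a. 1 / 2 * ln (\<bar>cos (2 * pi * c)\<bar>\<^sup>2 * (cos (2 * pi * a))\<^sup>2 + 1\<^sup>2 * (sin (2 * pi * a))\<^sup>2))
          (1 / 2 * (2 * ln ((\<bar>cos (2 * pi * c)\<bar> + 1) / 2)))"
        by (intro has_bochner_integral_mult_right jensen_cos_sin_2pi pos) simp
      also have "1 / 2 * (2 * ln ((\<bar>cos (2 * pi * c)\<bar> + 1) / 2)) = ln (1 + \<bar>cos (2 * pi * c)\<bar>) - ln 2"
        using pos by (simp add: ln_div add.commute)
      also have "(\<lambda>a. 1 / 2 * ln (\<bar>cos (2 * pi * c)\<bar>\<^sup>2 * (cos (2 * pi * a))\<^sup>2 + 1\<^sup>2 * (sin (2 * pi * a))\<^sup>2))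
          = (\<lambda>a. ln (hyp a c))"
      proof
        fix a
        have "0 < hyp a c"
          using pos abs_cos_le_hyp[of c a] by linarith
        then have "2 * ln (hyp a c) = ln ((hyp a c)\<^sup>2)"
          by (simp add: ln_realpow)
        also have "(hyp a c)\<^sup>2 = \<bar>cos (2 * pi * c)\<bar>\<^sup>2 * (cos (2 * pi * a))\<^sup>2 + 1\<^sup>2 * (sin (2 * pi * a))\<^sup>2"
          unfolding hyp_squared power2_abs sin_squared_eq by (simp add: algebra_simps)
        finally show "1 / 2 * ln (\<bar>cos (2 * pi * c)\<bar>\<^sup>2 * (cos (2 * pi * a))\<^sup>2 + 1\<^sup>2 * (sin (2 * pi * a))\<^sup>2) = ln (hyp a c)"
          by simp
      qed
      finally show ?case
        by simp
    qed
    show "has_bochner_integral unit_uniform (\<lambda>c. ln (1 + \<bar>cos (2 * pi * c)\<bar>) - ln 2) (4 / pi * catalan_const - ln 2 - ln 2)"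
      by (intro has_bochner_integral_diff has_bochner_integral_ln_one_plus_abs_cos)
         (simp add: has_bochner_integral_iff)
  qed measurable
  from has_bochner_integral_pair_swap[OF unit_uniform.finite_measure_axioms unit_uniform.finite_measure_axioms this]
  show ?thesis
    unfolding prod.case by simp
qed

lemma has_bochner_integral_ln_hyp_add_abs_cos:
  "has_bochner_integral unit_square (\<lambda>(a, c). ln (hyp a c + \<bar>cos (2 * pi * c)\<bar>)) (14 / pi\<^sup>2 * zeta 3 - 2 * ln 2)"
proof -
  let ?E = "14 / pi\<^sup>2 * zeta 3 - 2 * ln 2"
  let ?k = "\<lambda>a t. \<bar>sin (2 * pi * a)\<bar> * \<bar>cos (2 * pi * t)\<bar>"
  let ?inner = "\<lambda>a t. 2 * ln ((1 + ?k a t) / 2)"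
  \<comment> \<open>The mean over \<open>t\<close> for fixed \<open>a\<close> after \<open>c\<close>
    has been integrated out; its mean over \<open>a\<close> is known from ln (1 + |sin||cos|). It is
    the common value of both orders of integration in the slice at \<open>a\<close>, so Fubini is
    applied only to pairs.\<close>
  define m where "m = (\<lambda>a. \<integral>t. ?inner a t \<partial>unit_uniform)"
  interpret pair_sigma_finite unit_uniform unit_uniform ..
  have "has_bochner_integral unit_square (\<lambda>p. 2 * ((case p of (a, t) \<Rightarrow> ln (1 + ?k a t)) - ln 2)) (2 * (?E - ln 2))"
    by (intro has_bochner_integral_mult_right has_bochner_integral_diff
          has_bochner_integral_ln_one_plus_abs_sin_abs_cos has_bochner_integral_unit_square_const)
  also have "(\<lambda>p. 2 * ((case p of (a, t) \<Rightarrow> ln (1 + ?k a t)) - ln 2)) = (\<lambda>(a, t). ?inner a t)"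
  proof
    fix p :: "real \<times> real"
    obtain a t where p: "p = (a, t)"
      by (cases p)
    have "0 < 1 + ?k a t"
      by (intro add_pos_nonneg) auto
    then show "2 * ((case p of (a, t) \<Rightarrow> ln (1 + ?k a t)) - ln 2) = (case p of (a, t) \<Rightarrow> ?inner a t)"
      by (simp add: p ln_div)
  qed
  finally have inner: "has_bochner_integral unit_square (\<lambda>(a, t). ?inner a t) (2 * (?E - ln 2))" .
  then have int: "integrable unit_square (\<lambda>(a, t). ?inner a t)"
    and lint: "(\<integral>p. (case p of (a, t) \<Rightarrow> ?inner a t) \<partial>unit_square) = 2 * (?E - ln 2)"
    by (simp_all only: has_bochner_integral_iff)
  have m_int: "has_bochner_integral unit_uniform m (2 * (?E - ln 2))"
    using integrable_fst'[OF int] integral_fst'[OF int] lint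
    unfolding has_bochner_integral_iff m_def prod.case by simp
  have m_AE: "AE a in unit_uniform. has_bochner_integral unit_uniform (?inner a) (m a)"
    using AE_integrable_fst'[OF int] unfolding has_bochner_integral_iff m_def prod.case by simp
  have slice: "has_bochner_integral unit_uniform (\<lambda>c. 2 * ln ((hyp a c + \<bar>cos (2 * pi * c)\<bar>) / 2)) (m a)"
    if a: "a \<in> {0..1} - zeros_sin_cos" and ma: "has_bochner_integral unit_uniform (?inner a) (m a)" for a
  proof -
    \<comment> \<open>Integrated over \<open>c\<close> by Jensen's formula with coefficients 1 and
      \<open>?k a t\<close>, this gives \<open>?inner a t\<close>.\<close>
    let ?\<Phi> = "\<lambda>t c. ln ((cos (2 * pi * c))\<^sup>2 + (sin (2 * pi * c))\<^sup>2 * (?k a t)\<^sup>2)"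
    have "has_bochner_integral unit_square (\<lambda>(t, c). ?\<Phi> t c) (m a)"
    proof (rule has_bochner_integral_pair_unit_uniform[OF _ _ _ ma])
      show "AE t in unit_uniform. AE c in unit_uniform. (case (t, c) of (t, c) \<Rightarrow> ?\<Phi> t c) \<le> ln 2"
      proof (rule AE_I2)
        fix t :: real
        have "(cos (2 * pi * c))\<^sup>2 + (sin (2 * pi * c))\<^sup>2 * (?k a t)\<^sup>2 \<le> 1 + 1 * 1" for c
          by (intro add_mono mult_mono) (auto simp: abs_square_le_1 abs_mult mult_le_one power_mult_distrib)
        show "AE c in unit_uniform. (case (t, c) of (t, c) \<Rightarrow> ?\<Phi> t c) \<le> ln 2"
          using AE_unit_uniform_generic
        proof eventually_elim
          case (elim c)
          have "0 < (cos (2 * pi * c))\<^sup>2 + (sin (2 * pi * c))\<^sup>2 * (?k a t)\<^sup>2"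
            using cos_2pi_nonzero[OF elim] by (intro add_pos_nonneg) auto
          with \<open>\<And>c. (cos (2 * pi * c))\<^sup>2 + (sin (2 * pi * c))\<^sup>2 * (?k a t)\<^sup>2 \<le> 1 + 1 * 1\<close>[of c]
          show ?case
            by (simp only: prod.case, intro ln_mono) auto
        qed
      qed
      show "AE t in unit_uniform. has_bochner_integral unit_uniform (\<lambda>c. case (t, c) of (t, c) \<Rightarrow> ?\<Phi> t c) (?inner a t)"
        using AE_unit_uniform_generic
      proof eventually_elim
        case (elim t)
        have k: "0 < ?k a t"
          using sin_2pi_nonzero[OF a] cos_2pi_nonzero[OF elim] by simp
        show ?case
          using jensen_cos_sin_2pi[OF zero_less_one k] by (simp only: prod.case one_power2 mult_1_left mult.commute)
      qed
      show "(\<lambda>(t, c). ?\<Phi> t c) \<in> borel_measurable unit_square"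
        by measurable
    qed
    then have "has_bochner_integral unit_square (\<lambda>(c, t). ?\<Phi> t c) (m a)"
      using has_bochner_integral_pair_swap[OF unit_uniform.finite_measure_axioms unit_uniform.finite_measure_axioms]
      by fastforce
    then show ?thesis
    proof (rule has_bochner_integral_pair_fst[OF unit_uniform.finite_measure_axioms unit_uniform.finite_measure_axioms])
      show "AE c in unit_uniform. has_bochner_integral unit_uniform (\<lambda>t. case (c, t) of (c, t) \<Rightarrow> ?\<Phi> t c)
          (2 * ln ((hyp a c + \<bar>cos (2 * pi * c)\<bar>) / 2))"
        using AE_unit_uniform_generic
      proof eventually_elim
        case (elim c)
        have C: "0 < \<bar>cos (2 * pi * c)\<bar>"
          using cos_2pi_nonzero[OF elim] by simp
        then have A: "0 < hyp a c"
          using abs_cos_le_hyp[of c a] by linarith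
        \<comment> \<open>The same expression regrouped in \<open>t\<close>, so that Jensen's
          formula applies with coefficients \<open>hyp a c\<close> and
          \<open>\<bar>cos (2 * pi * c)\<bar>\<close>.\<close>
        have "(hyp a c)\<^sup>2 * (cos (2 * pi * t))\<^sup>2 + \<bar>cos (2 * pi * c)\<bar>\<^sup>2 * (sin (2 * pi * t))\<^sup>2
            = (cos (2 * pi * c))\<^sup>2 + (sin (2 * pi * c))\<^sup>2 * (?k a t)\<^sup>2" for t
          unfolding hyp_squared power_mult_distrib power2_abs sin_squared_eq[of "2 * pi * t"]
          by (simp add: algebra_simps)
        then show ?case
          using jensen_cos_sin_2pi[OF A C] by (simp only: prod.case)
      qed
    qed measurable
  qed
  have "has_bochner_integral unit_square (\<lambda>(a, c). 2 * ln ((hyp a c + \<bar>cos (2 * pi * c)\<bar>) / 2)) (2 * (?E - ln 2))"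
  proof (rule has_bochner_integral_pair_unit_uniform[OF _ _ _ m_int])
    show "AE a in unit_uniform. AE c in unit_uniform.
        (case (a, c) of (a, c) \<Rightarrow> 2 * ln ((hyp a c + \<bar>cos (2 * pi * c)\<bar>) / 2)) \<le> 0"
    proof (rule AE_I2)
      fix a :: real
      show "AE c in unit_uniform. (case (a, c) of (a, c) \<Rightarrow> 2 * ln ((hyp a c + \<bar>cos (2 * pi * c)\<bar>) / 2)) \<le> 0"
        using AE_unit_uniform_generic
      proof eventually_elim
        case (elim c)
        have "0 < \<bar>cos (2 * pi * c)\<bar>"
          using cos_2pi_nonzero[OF elim] by simp
        then show ?case
          using abs_cos_le_hyp[of c a] hyp_le_1[of a c] by simp
      qed
    qed
    show "AE a in unit_uniform. has_bochner_integral unit_uniform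
        (\<lambda>c. case (a, c) of (a, c) \<Rightarrow> 2 * ln ((hyp a c + \<bar>cos (2 * pi * c)\<bar>) / 2)) (m a)"
      using AE_unit_uniform_generic m_AE by eventually_elim (simp only: prod.case slice)
    show "(\<lambda>(a, c). 2 * ln ((hyp a c + \<bar>cos (2 * pi * c)\<bar>) / 2)) \<in> borel_measurable unit_square"
      by measurable
  qed
  then have "has_bochner_integral unit_square
      (\<lambda>p. 1 / 2 * (case p of (a, c) \<Rightarrow> 2 * ln ((hyp a c + \<bar>cos (2 * pi * c)\<bar>) / 2)) + ln 2) (1 / 2 * (2 * (?E - ln 2)) + ln 2)"
    by (intro has_bochner_integral_add has_bochner_integral_mult_right has_bochner_integral_unit_square_const)
  also have "1 / 2 * (2 * (?E - ln 2)) + ln 2 = ?E"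
    by (simp add: field_simps)
  finally show ?thesis
  proof (rule has_bochner_integralI_AE)
    show "AE p in unit_square. 1 / 2 * (case p of (a, c) \<Rightarrow> 2 * ln ((hyp a c + \<bar>cos (2 * pi * c)\<bar>) / 2)) + ln 2
        = (case p of (a, c) \<Rightarrow> ln (hyp a c + \<bar>cos (2 * pi * c)\<bar>))"
    proof (rule AE_unit_square_generic)
      fix a c assume "c \<in> {0..1} - zeros_sin_cos"
      then have "0 < \<bar>cos (2 * pi * c)\<bar>"
        using cos_2pi_nonzero by simp
      then have "0 < hyp a c + \<bar>cos (2 * pi * c)\<bar>"
        using abs_cos_le_hyp[of c a] by linarith
      then show "1 / 2 * (case (a, c) of (a, c) \<Rightarrow> 2 * ln ((hyp a c + \<bar>cos (2 * pi * c)\<bar>) / 2)) + ln 2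
        = (case (a, c) of (a, c) \<Rightarrow> ln (hyp a c + \<bar>cos (2 * pi * c)\<bar>))"
        by (simp add: ln_div diff_divide_distrib)
    qed
  qed measurable
qed

section \<open>Upper bounds on the torus and reduction of the triple integrals to Jensen's
  formula\<close>

text \<open>The condition \<open>1 \<le> C\<close> covers w = 0, where the logarithm has the default
  value 0.\<close>

lemma ln_cmod_le:
  assumes "cmod w \<le> C" "1 \<le> C"
  shows "ln (cmod w) \<le> ln C"
  using assms by (cases "w = 0") (auto intro: ln_mono)

lemma norm_mult_mono: "norm a \<le> r \<Longrightarrow> norm b \<le> s \<Longrightarrow> norm (a * b :: 'a::real_normed_algebra) \<le> r * s"
  by (rule order_trans[OF norm_mult_ineq mult_mono]) (auto intro: order_trans[OF norm_ge_zero])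

lemma norm_diff_mono: "norm a \<le> r \<Longrightarrow> norm b \<le> s \<Longrightarrow> norm (a - b) \<le> r + s"
  by (rule order_trans[OF norm_triangle_ineq4 add_mono])

lemma unit_circle_minus_inverse: "unit_circle t - inverse (unit_circle t) = 2 * \<i> * of_real (sin (2 * pi * t))"
  by (simp add: unit_circle_eq_cis complex_eq_iff)

lemma unit_circle_plus_inverse: "unit_circle t + inverse (unit_circle t) = 2 * of_real (cos (2 * pi * t))"
  by (simp add: unit_circle_eq_cis complex_eq_iff)

lemma norm_unit_circle_combinations:
  "cmod (1 + unit_circle t) \<le> 2"
  "cmod (1 - unit_circle t) \<le> 2"
  "cmod (unit_circle t - unit_circle u) \<le> 2"
  "cmod (unit_circle t - inverse (unit_circle t)) \<le> 2"
  "cmod (unit_circle t + inverse (unit_circle t)) \<le> 2"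
  using norm_triangle_mono[of 1 1 "unit_circle t" 1] norm_diff_mono[of 1 1 "unit_circle t" 1]
    norm_diff_mono[of "unit_circle t" 1 "unit_circle u" 1]
    norm_diff_mono[of "unit_circle t" 1 "inverse (unit_circle t)" 1]
    norm_triangle_mono[of "unit_circle t" 1 "inverse (unit_circle t)" 1]
  by (simp_all add: norm_inverse)

text \<open>Common frame of the four computations: a crude bound on the polynomial gives the upper
  bound for Fubini, Jensen's formula at generic \<open>(a, b)\<close> gives the inner mean, and a
  double mean finishes.\<close>

lemma has_bochner_integral_unit_cube:
  fixes f :: "(real \<times> real) \<times> real \<Rightarrow> complex"
  assumes [measurable]: "f \<in> borel_measurable (unit_square \<Otimes>\<^sub>M unit_uniform)"
    and bound: "\<And>p. cmod (f p) \<le> C" and C: "1 \<le> C"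
    and inner: "\<And>a b. a \<in> {0..1} - zeros_sin_cos \<Longrightarrow> b \<in> {0..1} - zeros_sin_cos \<Longrightarrow>
      has_bochner_integral unit_uniform (\<lambda>t. ln (cmod (f ((a, b), t)))) (g a b)"
    and outer: "has_bochner_integral unit_square (\<lambda>(a, b). g a b) I"
  shows "has_bochner_integral (unit_square \<Otimes>\<^sub>M unit_uniform) (\<lambda>p. ln (cmod (f p))) I"
proof (rule has_bochner_integral_pair_bounded_above[OF unit_uniform2.finite_measure_axioms
      unit_uniform.finite_measure_axioms _ _ _ outer])
  show "AE p in unit_square. AE t in unit_uniform. ln (cmod (f (p, t))) \<le> ln C"
    by (intro AE_I2 ln_cmod_le bound C)
  show "AE p in unit_square. has_bochner_integral unit_uniform (\<lambda>t. ln (cmod (f (p, t)))) (case p of (a, b) \<Rightarrow> g a b)"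
    by (rule AE_unit_square_generic) (simp add: inner)
qed measurable

section \<open>The four Mahler measures\<close>

text \<open>The polynomial is linear in \<open>y\<close>: p + q y with q = 2z and p = 1 + z + (1 -
  z) x. On the torus |q| = 2 and |p|^2 = 4 (1 + s), where s is the product of the two sines, so the
  larger modulus is 2 sqrt (max 1 (1 + s)).\<close>

lemma mahler_measure_first:
  fixes x y z :: "(3, complex) laurent_poly"
  assumes x: "x = laurent_var 1" and y: "y = laurent_var 2" and z: "z = laurent_var 3"
  shows "mahler_measure ((1 + z) * (1 + y) + (1 - z) * (x - y)) = 7 / (2 * pi\<^sup>2) * zeta 3 + ln 2 / 2"
proof (rule mahler_measure_eqI[where i = 2 and j = 1 and k = 3])
  let ?f = "\<lambda>p. (1 + unit_circle (snd (fst p))) * (1 + unit_circle (snd p))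
      + (1 - unit_circle (snd (fst p))) * (unit_circle (fst (fst p)) - unit_circle (snd p))"
  show "ln (cmod (laurent_eval ((1 + z) * (1 + y) + (1 - z) * (x - y))
      (\<chi> n. exp (2 * of_real pi * \<i> * of_real (vec3 1 3 p $ n))))) = ln (cmod (?f p))" for p
    unfolding x y z unit_circle_def[symmetric]
    by (simp add: laurent_eval_add laurent_eval_diff laurent_eval_mult laurent_eval_var vec3_def)
  show "has_bochner_integral (unit_square \<Otimes>\<^sub>M unit_uniform) (\<lambda>p. ln (cmod (?f p)))
      (7 / (2 * pi\<^sup>2) * zeta 3 + ln 2 / 2)"
  proof (rule has_bochner_integral_unit_cube)
    show "?f \<in> borel_measurable (unit_square \<Otimes>\<^sub>M unit_uniform)"
      by measurable
    show "cmod (?f p) \<le> 8" for p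
    proof -
      have "cmod (?f p) \<le> 2 * 2 + 2 * 2"
        by (intro norm_triangle_mono norm_mult_mono norm_unit_circle_combinations)
      then show ?thesis
        by simp
    qed
    show "(1 :: real) \<le> 8"
      by simp
    let ?g = "\<lambda>a c. ln 2 + 1 / 2 * ln (max 1 (1 + sin (2 * pi * a) * sin (2 * pi * c)))"
    show "has_bochner_integral unit_uniform (\<lambda>t. ln (cmod (?f ((a, c), t)))) (?g a c)"
      if a: "a \<in> {0..1} - zeros_sin_cos" and c: "c \<in> {0..1} - zeros_sin_cos" for a c
    proof -
      define s where "s = sin (2 * pi * a) * sin (2 * pi * c)"
      have s: "s \<noteq> 0"
        using sin_2pi_nonzero[OF a] sin_2pi_nonzero[OF c] by (simp add: s_def)
      have s_ge: "0 \<le> 1 + s"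
      proof -
        have "\<bar>s\<bar> \<le> 1 * 1"
          unfolding s_def abs_mult by (intro mult_mono) auto
        then show ?thesis
          by linarith
      qed
      define p q where "p = 1 + unit_circle c + (1 - unit_circle c) * unit_circle a" and "q = 2 * unit_circle c"
      have q: "cmod q = 2"
        by (simp add: q_def norm_mult)
      have p: "(cmod p)\<^sup>2 = 4 * (1 + s)"
      proof -
        define C S C' S' where "C = cos (2 * pi * a)" and "S = sin (2 * pi * a)" and "C' = cos (2 * pi * c)" and "S' = sin (2 * pi * c)"
        have 1: "C\<^sup>2 + S\<^sup>2 = 1" "C'\<^sup>2 + S'\<^sup>2 = 1"
          by (simp_all add: C_def S_def C'_def S'_def)
        have "(cmod p)\<^sup>2 = (1 + C' + ((1 - C') * C + S' * S))\<^sup>2 + (S' + ((1 - C') * S - S' * C))\<^sup>2"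
          by (simp add: p_def cmod_power2 unit_circle_eq_cis C_def S_def C'_def S'_def)
        \<comment> \<open>The squares of 1 + z and 1 - z in modulus add to 4, and the cross term
          uses that (1 + z)(1 - cnj z) = 2 i S' on the circle.\<close>
        also have "\<dots> = 4 * (1 + S * S')"
          using 1 by algebra
        finally show ?thesis
          by (simp add: s_def S_def S'_def)
      qed
      have ne: "cmod p \<noteq> cmod q"
        using p q s by auto
      have "max (cmod p) (cmod q) = 2 * sqrt (max 1 (1 + s))"
      proof -
        have "cmod p = 2 * sqrt (1 + s)"
          using p s_ge by (metis norm_ge_zero power2_eq_square real_sqrt_four real_sqrt_mult real_sqrt_unique)
        then show ?thesis
          by (simp add: q max_def)
      qed
      then have "ln (max (cmod p) (cmod q)) = ?g a c"
        by (simp add: ln_mult_pos ln_sqrt s_def)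
      with jensen_unit_circle[OF ne]
      have "has_bochner_integral unit_uniform (\<lambda>t. ln (cmod (p + q * unit_circle t))) (?g a c)"
        by (simp only:)
      moreover have "?f ((a, c), t) = p + q * unit_circle t" for t
        by (simp add: p_def q_def algebra_simps)
      ultimately show ?thesis
        by (simp only:)
    qed
    have "has_bochner_integral unit_square (\<lambda>p. ln 2 + 1 / 2 * (case p of (a, c) \<Rightarrow> ln (max 1 (1 + sin (2 * pi * a) * sin (2 * pi * c)))))
        (ln 2 + 1 / 2 * (7 / pi\<^sup>2 * zeta 3 - ln 2))"
      by (intro has_bochner_integral_add has_bochner_integral_mult_right has_bochner_integral_unit_square_const
            has_bochner_integral_ln_one_plus_pos_part_sin_sin)
    also have "ln 2 + 1 / 2 * (7 / pi\<^sup>2 * zeta 3 - ln 2) = 7 / (2 * pi\<^sup>2) * zeta 3 + ln 2 / 2"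
      by (simp add: field_simps)
    finally show "has_bochner_integral unit_square (\<lambda>(a, c). ?g a c) (7 / (2 * pi\<^sup>2) * zeta 3 + ln 2 / 2)"
      unfolding case_prod_unfold .
  qed
qed (subst UNIV_3, auto)

text \<open>On the torus the two differences multiply to -4s, so the polynomial is 4 (1 - s) + 4 (1
  + s) y with larger coefficient 4 (1 + |s|). The factor 4 cancels the -2 ln 2 of the double
  mean.\<close>

lemma mahler_measure_second:
  fixes x y z x' z' :: "(3, complex) laurent_poly"
  assumes x: "x = laurent_var 1" and y: "y = laurent_var 2" and z: "z = laurent_var 3"
    and x': "x' = laurent_var_inverse 1" and z': "z' = laurent_var_inverse 3"
  shows "mahler_measure (4 * (1 + y) + (1 - y) * (x - x') * (z - z')) = 14 / pi\<^sup>2 * zeta 3"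
proof (rule mahler_measure_eqI[where i = 2 and j = 1 and k = 3])
  let ?f = "\<lambda>p. 4 * (1 + unit_circle (snd p)) + (1 - unit_circle (snd p))
      * (unit_circle (fst (fst p)) - inverse (unit_circle (fst (fst p))))
      * (unit_circle (snd (fst p)) - inverse (unit_circle (snd (fst p))))"
  show "ln (cmod (laurent_eval (4 * (1 + y) + (1 - y) * (x - x') * (z - z'))
      (\<chi> n. exp (2 * of_real pi * \<i> * of_real (vec3 1 3 p $ n))))) = ln (cmod (?f p))" for p
    unfolding x y z x' z' unit_circle_def[symmetric]
    by (simp add: laurent_eval_add laurent_eval_diff laurent_eval_mult laurent_eval_var laurent_eval_var_inverse vec3_def)
  show "has_bochner_integral (unit_square \<Otimes>\<^sub>M unit_uniform) (\<lambda>p. ln (cmod (?f p))) (14 / pi\<^sup>2 * zeta 3)"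
  proof (rule has_bochner_integral_unit_cube)
    show "?f \<in> borel_measurable (unit_square \<Otimes>\<^sub>M unit_uniform)"
      by measurable
    show "cmod (?f p) \<le> 16" for p
    proof -
      have "cmod (?f p) \<le> 4 * 2 + 2 * 2 * 2"
        by (intro norm_triangle_mono norm_mult_mono norm_unit_circle_combinations) simp_all
      then show ?thesis
        by simp
    qed
    show "(1 :: real) \<le> 16"
      by simp
    let ?g = "\<lambda>a c. ln 4 + ln (1 + \<bar>sin (2 * pi * a)\<bar> * \<bar>sin (2 * pi * c)\<bar>)"
    show "has_bochner_integral unit_uniform (\<lambda>t. ln (cmod (?f ((a, c), t)))) (?g a c)"
      if a: "a \<in> {0..1} - zeros_sin_cos" and c: "c \<in> {0..1} - zeros_sin_cos" for a c
    proof -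
      define s where "s = sin (2 * pi * a) * sin (2 * pi * c)"
      have s: "s \<noteq> 0"
        using sin_2pi_nonzero[OF a] sin_2pi_nonzero[OF c] by (simp add: s_def)
      define p q where "p = 4 * (1 - s)" and "q = 4 * (1 + s)"
      have ne: "cmod (of_real p) \<noteq> cmod (of_real q)"
        unfolding norm_of_real p_def q_def using s by (auto simp: abs_if)
      have s_le: "\<bar>s\<bar> \<le> 1 * 1"
        unfolding s_def abs_mult by (intro mult_mono) auto
      have "max (cmod (of_real p)) (cmod (of_real q)) = 4 * (1 + \<bar>s\<bar>)"
        unfolding norm_of_real p_def q_def using s_le by (auto simp: abs_if max_def)
      then have "ln (max (cmod (of_real p)) (cmod (of_real q))) = ln 4 + ln (1 + \<bar>s\<bar>)"
        by (simp only:) (rule ln_mult_pos, auto)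
      also have "\<dots> = ?g a c"
        by (simp add: s_def abs_mult)
      finally have "has_bochner_integral unit_uniform (\<lambda>t. ln (cmod (of_real p + of_real q * unit_circle t))) (?g a c)"
        using jensen_unit_circle[OF ne] by (simp only:)
      moreover have "?f ((a, c), t) = of_real p + of_real q * unit_circle t" for t
        unfolding fst_conv snd_conv unit_circle_minus_inverse p_def q_def s_def by (simp add: algebra_simps)
      ultimately show ?thesis
        by (simp only:)
    qed
    have "has_bochner_integral unit_square (\<lambda>p. ln 4 + (case p of (a, c) \<Rightarrow> ln (1 + \<bar>sin (2 * pi * a)\<bar> * \<bar>sin (2 * pi * c)\<bar>)))
        (ln 4 + (14 / pi\<^sup>2 * zeta 3 - 2 * ln 2))"
      by (intro has_bochner_integral_add has_bochner_integral_unit_square_const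
            has_bochner_integral_ln_one_plus_abs_sin_abs_sin)
    also have "ln 4 + (14 / pi\<^sup>2 * zeta 3 - 2 * ln 2) = 14 / pi\<^sup>2 * zeta 3"
      using ln_realpow[of 2 2] by simp
    finally show "has_bochner_integral unit_square (\<lambda>(a, c). ?g a c) (14 / pi\<^sup>2 * zeta 3)"
      unfolding case_prod_unfold .
  qed
qed (subst UNIV_3, auto)

text \<open>Linear in \<open>x\<close>, with coefficients 2i (s + s') and 2i (s - s') for the two
  sines. The larger of |s + s'| and |s - s'| is |s| + |s'|, and the factor 2 cancels the -ln 2 of
  the double mean.\<close>

lemma mahler_measure_third:
  fixes x y z y' z' :: "(3, complex) laurent_poly"
  assumes x: "x = laurent_var 1" and y: "y = laurent_var 2" and z: "z = laurent_var 3"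
    and y': "y' = laurent_var_inverse 2" and z': "z' = laurent_var_inverse 3"
  shows "mahler_measure ((1 + x) * (y - y') + (1 - x) * (z - z')) = 7 / pi\<^sup>2 * zeta 3"
proof (rule mahler_measure_eqI[where i = 1 and j = 2 and k = 3])
  let ?f = "\<lambda>p. (1 + unit_circle (snd p)) * (unit_circle (fst (fst p)) - inverse (unit_circle (fst (fst p))))
      + (1 - unit_circle (snd p)) * (unit_circle (snd (fst p)) - inverse (unit_circle (snd (fst p))))"
  show "ln (cmod (laurent_eval ((1 + x) * (y - y') + (1 - x) * (z - z'))
      (\<chi> n. exp (2 * of_real pi * \<i> * of_real (vec3 2 3 p $ n))))) = ln (cmod (?f p))" for p
    unfolding x y z y' z' unit_circle_def[symmetric]
    by (simp add: laurent_eval_add laurent_eval_diff laurent_eval_mult laurent_eval_var laurent_eval_var_inverse vec3_def)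
  show "has_bochner_integral (unit_square \<Otimes>\<^sub>M unit_uniform) (\<lambda>p. ln (cmod (?f p))) (7 / pi\<^sup>2 * zeta 3)"
  proof (rule has_bochner_integral_unit_cube)
    show "?f \<in> borel_measurable (unit_square \<Otimes>\<^sub>M unit_uniform)"
      by measurable
    show "cmod (?f p) \<le> 8" for p
    proof -
      have "cmod (?f p) \<le> 2 * 2 + 2 * 2"
        by (intro norm_triangle_mono norm_mult_mono norm_unit_circle_combinations)
      then show ?thesis
        by simp
    qed
    show "(1 :: real) \<le> 8"
      by simp
    let ?g = "\<lambda>a c. ln 2 + ln (\<bar>sin (2 * pi * a)\<bar> + \<bar>sin (2 * pi * c)\<bar>)"
    show "has_bochner_integral unit_uniform (\<lambda>t. ln (cmod (?f ((a, c), t)))) (?g a c)"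
      if a: "a \<in> {0..1} - zeros_sin_cos" and c: "c \<in> {0..1} - zeros_sin_cos" for a c
    proof -
      define s s' where "s = sin (2 * pi * a)" and "s' = sin (2 * pi * c)"
      have s: "s \<noteq> 0" "s' \<noteq> 0"
        using sin_2pi_nonzero[OF a] sin_2pi_nonzero[OF c] by (simp_all add: s_def s'_def)
      define p q where "p = 2 * \<i> * of_real (s + s')" and "q = 2 * \<i> * of_real (s - s')"
      have pq: "cmod p = 2 * \<bar>s + s'\<bar>" "cmod q = 2 * \<bar>s - s'\<bar>"
        unfolding p_def q_def norm_mult norm_of_real by simp_all
      have ne: "cmod p \<noteq> cmod q"
        unfolding pq using s by (auto simp: abs_if split: if_splits)
      have "max (cmod p) (cmod q) = 2 * (\<bar>s\<bar> + \<bar>s'\<bar>)"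
        unfolding pq by (auto simp: abs_if max_def)
      then have "ln (max (cmod p) (cmod q)) = ln 2 + ln (\<bar>s\<bar> + \<bar>s'\<bar>)"
        using s by (simp only:) (rule ln_mult_pos, auto)
      also have "\<dots> = ?g a c"
        by (simp add: s_def s'_def)
      finally have "has_bochner_integral unit_uniform (\<lambda>t. ln (cmod (p + q * unit_circle t))) (?g a c)"
        using jensen_unit_circle[OF ne] by (simp only:)
      moreover have "?f ((a, c), t) = p + q * unit_circle t" for t
        unfolding fst_conv snd_conv unit_circle_minus_inverse p_def q_def s_def s'_def by (simp add: algebra_simps)
      ultimately show ?thesis
        by (simp only:)
    qed
    have "has_bochner_integral unit_square (\<lambda>p. ln 2 + (case p of (a, c) \<Rightarrow> ln (\<bar>sin (2 * pi * a)\<bar> + \<bar>sin (2 * pi * c)\<bar>)))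
        (ln 2 + (7 / pi\<^sup>2 * zeta 3 - ln 2))"
      by (intro has_bochner_integral_add has_bochner_integral_unit_square_const
            has_bochner_integral_ln_abs_sin_add_abs_sin)
    also have "ln 2 + (7 / pi\<^sup>2 * zeta 3 - ln 2) = 7 / pi\<^sup>2 * zeta 3"
      by simp
    finally show "has_bochner_integral unit_square (\<lambda>(a, c). ?g a c) (7 / pi\<^sup>2 * zeta 3)"
      unfolding case_prod_unfold .
  qed
qed (subst UNIV_3, auto)

text \<open>On the torus the polynomial is 16 (A - C + A y)(A + C + A y) with A =
  \<open>hyp a c\<close> and C = cos (2 pi c), so Jensen's formula applies to each linear factor in
  \<open>y\<close>. The factor 16 cancels the two terms -2 ln 2.\<close>

lemma mahler_measure_fourth:
  fixes x y z x' z' :: "(3, complex) laurent_poly"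
  assumes x: "x = laurent_var 1" and y: "y = laurent_var 2" and z: "z = laurent_var 3"
    and x': "x' = laurent_var_inverse 1" and z': "z' = laurent_var_inverse 3"
  shows "mahler_measure (16 * (1 + y)\<^sup>2 - 4 * (z + z')\<^sup>2 + (1 + y)\<^sup>2 * (z - z')\<^sup>2 * (x + x')\<^sup>2)
         = 14 / pi\<^sup>2 * zeta 3 + 4 / pi * catalan_const"
proof (rule mahler_measure_eqI[where i = 2 and j = 1 and k = 3])
  let ?f = "\<lambda>p. 16 * (1 + unit_circle (snd p))\<^sup>2 - 4 * (unit_circle (snd (fst p)) + inverse (unit_circle (snd (fst p))))\<^sup>2
      + (1 + unit_circle (snd p))\<^sup>2 * (unit_circle (snd (fst p)) - inverse (unit_circle (snd (fst p))))\<^sup>2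
        * (unit_circle (fst (fst p)) + inverse (unit_circle (fst (fst p))))\<^sup>2"
  show "ln (cmod (laurent_eval (16 * (1 + y)\<^sup>2 - 4 * (z + z')\<^sup>2 + (1 + y)\<^sup>2 * (z - z')\<^sup>2 * (x + x')\<^sup>2)
      (\<chi> n. exp (2 * of_real pi * \<i> * of_real (vec3 1 3 p $ n))))) = ln (cmod (?f p))" for p
    unfolding x y z x' z' unit_circle_def[symmetric]
    by (simp add: laurent_eval_add laurent_eval_diff laurent_eval_mult laurent_eval_power laurent_eval_var
          laurent_eval_var_inverse vec3_def)
  let ?I = "14 / pi\<^sup>2 * zeta 3 + 4 / pi * catalan_const"
  show "has_bochner_integral (unit_square \<Otimes>\<^sub>M unit_uniform) (\<lambda>p. ln (cmod (?f p))) ?I"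
  proof (rule has_bochner_integral_unit_cube)
    show "?f \<in> borel_measurable (unit_square \<Otimes>\<^sub>M unit_uniform)"
      by measurable
    show "cmod (?f p) \<le> 144" for p
    proof -
      have "cmod (?f p) \<le> (16 * (2 * 2) + 4 * (2 * 2)) + (2 * 2) * (2 * 2) * (2 * 2)"
        unfolding power2_eq_square
        by (intro norm_triangle_mono norm_diff_mono norm_mult_mono norm_unit_circle_combinations) simp_all
      then show ?thesis
        by simp
    qed
    show "(1 :: real) \<le> 144"
      by simp
    let ?g = "\<lambda>a c. ln 16 + ln (hyp a c) + ln (hyp a c + \<bar>cos (2 * pi * c)\<bar>)"
    show "has_bochner_integral unit_uniform (\<lambda>t. ln (cmod (?f ((a, c), t)))) (?g a c)"
      if a: "a \<in> {0..1} - zeros_sin_cos" and c: "c \<in> {0..1} - zeros_sin_cos" for a c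
    proof -
      define A C where "A = hyp a c" and "C = cos (2 * pi * c)"
      have C: "C \<noteq> 0" and AC: "\<bar>C\<bar> \<le> A"
        using cos_2pi_nonzero[OF c] abs_cos_le_hyp[of c a] by (simp_all add: A_def C_def)
      have A: "0 < A"
        using C AC by linarith
      have ne: "cmod (of_real (A - C)) \<noteq> cmod (of_real A)" "cmod (of_real (A + C)) \<noteq> cmod (of_real A)"
        unfolding norm_of_real using C AC A by (auto simp: abs_if split: if_splits)
      \<comment> \<open>As |C| is at most A, the factor whose constant term is A - |C| contributes
        A, and the other one contributes A + |C|.\<close>
      have max: "ln (max (cmod (of_real (A - C))) (cmod (of_real A))) + ln (max (cmod (of_real (A + C))) (cmod (of_real A)))
          = ln A + ln (A + \<bar>C\<bar>)"
        unfolding norm_of_real using C AC A by (cases "0 < C") (auto simp: max_def)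
      have "has_bochner_integral unit_uniform
          (\<lambda>t. ln 16 + (ln (cmod (of_real (A - C) + of_real A * unit_circle t)) + ln (cmod (of_real (A + C) + of_real A * unit_circle t))))
          (ln 16 + (ln A + ln (A + \<bar>C\<bar>)))"
        unfolding max[symmetric]
        by (intro has_bochner_integral_add jensen_unit_circle ne) (simp add: has_bochner_integral_iff)
      moreover have "ln 16 + (ln (cmod (of_real (A - C) + of_real A * unit_circle t)) + ln (cmod (of_real (A + C) + of_real A * unit_circle t)))
          = ln (cmod (?f ((a, c), t)))" for t
      proof -
        have nz: "of_real B + of_real A * unit_circle t \<noteq> 0" if "cmod (of_real B) \<noteq> cmod (of_real A)" for B
        proof
          assume "of_real B + of_real A * unit_circle t = 0"
          then have "of_real B = - (of_real A * unit_circle t)"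
            by (simp add: add_eq_0_iff2)
          then have "cmod (of_real B) = cmod (of_real A)"
            by (simp add: norm_mult)
          with that show False
            by simp
        qed
        define u v where "u = of_real (A - C) + of_real A * unit_circle t" and "v = of_real (A + C) + of_real A * unit_circle t"
        have uv: "u \<noteq> 0" "v \<noteq> 0"
          unfolding u_def v_def by (intro nz ne)+
        have "ln 16 + (ln (cmod u) + ln (cmod v)) = ln (16 * (cmod u * cmod v))"
          using uv by (simp add: ln_mult_pos)
        also have "16 * (cmod u * cmod v) = cmod (16 * (u * v))"
          by (simp add: norm_mult)
        also have "16 * (u * v) = ?f ((a, c), t)"
        proof -
          have "complex_of_real (A\<^sup>2) = of_real (1 - (sin (2 * pi * c))\<^sup>2 * (cos (2 * pi * a))\<^sup>2)"
            unfolding A_def hyp_squared' ..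
          then have A2: "(complex_of_real A)\<^sup>2 = 1 - (of_real (sin (2 * pi * c)))\<^sup>2 * (of_real (cos (2 * pi * a)))\<^sup>2"
            by simp
          have uv_eq: "u * v = (1 + unit_circle t)\<^sup>2 * (of_real A)\<^sup>2 - (of_real C)\<^sup>2"
            unfolding u_def v_def of_real_add of_real_diff by algebra
          show ?thesis
            unfolding fst_conv snd_conv unit_circle_minus_inverse unit_circle_plus_inverse uv_eq A2 C_def
            by (simp add: power_mult_distrib algebra_simps)
        qed
        finally show ?thesis
          unfolding u_def v_def .
      qed
      ultimately have "has_bochner_integral unit_uniform (\<lambda>t. ln (cmod (?f ((a, c), t)))) (ln 16 + (ln A + ln (A + \<bar>C\<bar>)))"
        by (simp only:)
      then show ?thesis
        unfolding A_def C_def add.assoc .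
    qed
    have "has_bochner_integral unit_square (\<lambda>p. ln 16 + (case p of (a, c) \<Rightarrow> ln (hyp a c))
          + (case p of (a, c) \<Rightarrow> ln (hyp a c + \<bar>cos (2 * pi * c)\<bar>)))
        (ln 16 + (4 / pi * catalan_const - 2 * ln 2) + (14 / pi\<^sup>2 * zeta 3 - 2 * ln 2))"
      by (intro has_bochner_integral_add has_bochner_integral_unit_square_const
            has_bochner_integral_ln_hyp has_bochner_integral_ln_hyp_add_abs_cos)
    also have "ln 16 + (4 / pi * catalan_const - 2 * ln 2) + (14 / pi\<^sup>2 * zeta 3 - 2 * ln 2) = ?I"
      using ln_realpow[of 2 4] by simp
    finally show "has_bochner_integral unit_square (\<lambda>(a, c). ?g a c) ?I"
      unfolding case_prod_unfold .
  qed
qed (subst UNIV_3, auto)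

theorem corollary7p4:
  shows
    "let x = laurent_var 1 :: (3, complex) laurent_poly;
         y = laurent_var 2;
         z = laurent_var 3;
         x' = laurent_var_inverse 1;
         y' = laurent_var_inverse 2;
         z' = laurent_var_inverse 3
     in
       mahler_measure ((1 + z) * (1 + y) + (1 - z) * (x - y))
         = 7 / (2 * pi\<^sup>2) * zeta 3 + ln 2 / 2
     \<and> mahler_measure (4 * (1 + y) + (1 - y) * (x - x') * (z - z'))
         = 14 / pi\<^sup>2 * zeta 3
     \<and> mahler_measure ((1 + x) * (y - y') + (1 - x) * (z - z'))
         = 7 / pi\<^sup>2 * zeta 3
     \<and> mahler_measure (16 * (1 + y)\<^sup>2 - 4 * (z + z')\<^sup>2 + (1 + y)\<^sup>2 * (z - z')\<^sup>2 * (x + x')\<^sup>2)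
         = 14 / pi\<^sup>2 * zeta 3 + 4 / pi * catalan_const"
  unfolding Let_def
  by (intro conjI mahler_measure_first mahler_measure_second mahler_measure_third mahler_measure_fourth) (rule refl)+

end
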